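(* Consider the control problem with input-output partition constraint for a plant $\mathcal{P}_{\mathrm{full}}$ with to-be-controlled variable $w$, control variables $c=(u,y)$ ($y$ being the declared outputs), and specification $\mathcal{S}$. If $\mathcal{S}$ is not regularly implementable, the problem is not solvable. If $\mathcal{S}$ is regularly implementable, then $\mathfrak{C}_{\mathrm{can}}^{\mathrm{reg}}$ is nonempty, and for any controller $\mathcal{C}\in\mathfrak{C}_{\mathrm{can}}^{\mathrm{reg}}$, with full row rank kernel representations $$\mathcal{C}=\{(u,y) : C_1(\tfrac{d}{dt})u+C_2(\tfrac{d}{dt})y=0\},\qquad \mathcal{P}_c=\{(u,y) : P_1(\tfrac{d}{dt})u+P_2(\tfrac{d}{dt})y=0\},$$ the problem is solvable if and only if $$\operatorname{rank}\begin{bmatrix}C_1\\P_1\end{bmatrix}\ \geq\ \mathtt{p}(\mathcal{C}).$$ Moreover, if this rank condition holds, then there exists a polynomial matrix $V$ such that $C_1+VP_1$ has full row rank, and for such a $V$ the controller $$\mathcal{C}'=\left\{(u,y) : (C_1+VP_1)(\tfrac{d}{dt})u+(C_2+VP_2)(\tfrac{d}{dt})y=0\right\}$$ solves the problem.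
   Context: A (linear differential) behavior in $q$ variables is a set of the form $\{x\in\mathfrak{C}^\infty(\mathbb{R},\mathbb{R}^q) : A(\frac{d}{dt})x=0\}$ with $A\in\mathbb{R}^{g\times q}[\xi]$ a real polynomial matrix ($g\ge 0$); $A$ is called a kernel representation. Here $\mathfrak{C}^\infty$ denotes infinitely differentiable functions; all signals are infinitely differentiable. Ranks of polynomial matrices are taken over the field $\mathbb{R}(\xi)$. Every behavior $\mathfrak{B}$ has a kernel representation of full row rank; its number of rows is independent of the choice, is denoted $\mathtt{p}(\mathfrak{B})$, and is called the number of outputs of $\mathfrak{B}$. If $\mathfrak{B}$ is the kernel of a full row rank $A(\frac{d}{dt})$, a partition of the variables $x$ (after a permutation) into $(x_1,x_2)$, with $A(\frac{d}{dt})x=A_1(\frac{d}{dt})x_1+A_2(\frac{d}{dt})x_2$, is an input-output partition with output $x_1$ and input $x_2$ if $A_1$ is square and of full row rank. Full plant behavior: $\mathcal{P}_{\mathrm{full}}=\{(w,u,y) : R(\frac{d}{dt})w+P(\frac{d}{dt})u+Q(\frac{d}{dt})y=0\}$, with $R,P,Q$ real polynomial matrices. A specification is a behavior $\mathcal{S}=\{w : S(\frac{d}{dt})w=0\}$. A controller is a behavior $\mathcal{C}$ in the variables $c=(u,y)$. A controller $\mathcal{C}$ implements $\mathcal{S}$ if $\{w : \exists\,(u,y)\in\mathcal{C},\ (w,u,y)\in\mathcal{P}_{\mathrm{full}}\}=\mathcal{S}$. A controller given by a full row rank matrix $C=\begin{bmatrix}C_1&C_2\end{bmatrix}$ is regular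 if $\operatorname{rank}\begin{bmatrix}R&P&Q\\0&C_1&C_2\end{bmatrix}=\operatorname{rank}\begin{bmatrix}R&P&Q\end{bmatrix}+\operatorname{rank}C$ (independent of the representations). $\mathcal{S}$ is regularly implementable if some regular controller implements it. Control problem with input-output partition constraint: find a regular controller $\mathcal{C}$ that implements $\mathcal{S}$ and whose variables $(u,y)$ admit an input-output partition in which all of $y$ belongs to the input part. The problem is solvable if such a controller exists; such a controller is said to solve the problem. Control manifest behavior: $\mathcal{P}_c=\{(u,y) : \exists\, w,\ (w,u,y)\in\mathcal{P}_{\mathrm{full}}\}$. Canonical controller: $\mathcal{C}_{\mathrm{can}}=\{(u,y) : \exists\, w\in\mathcal{S},\ (w,u,y)\in\mathcal{P}_{\mathrm{full}}\}$. Both $\mathcal{P}_c$ and $\mathcal{C}_{\mathrm{can}}$ are linear differential behaviors in the variables $(u,y)$, i.e. each is the set of infinitely differentiable solutions $(u,y)$ of an equation $K_1(\frac{d}{dt})u+K_2(\frac{d}{dt})y=0$ for some real polynomial matrices $K_1,K_2$. $\mathfrak{C}_{\mathrm{can}}^{\mathrm{reg}}=\{\mathcal{C} : \mathcal{C}\text{ is a regular controller and }\mathcal{C}\cap\mathcal{P}_c=\mathcal{C}_{\mathrm{can}}\cap\mathcal{P}_c\}$. *)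

theory Defs
  imports
    "HOL-Analysis.Derivative"
    "HOL-Computational_Algebra.Polynomial_Factorial"
    "Jordan_Normal_Form.DL_Rank"
    "Jordan_Normal_Form.DL_Submatrix"
begin

unbundle no vec_syntax

subsection \<open>Polynomial matrices\<close>

definition append_cols :: "'a :: zero mat \<Rightarrow> 'a mat \<Rightarrow> 'a mat" (infixr \<open>@\<^sub>c\<close> 65) where
  "A @\<^sub>c B = four_block_mat A B (0\<^sub>m 0 (dim_col A)) (0\<^sub>m 0 (dim_col B))"

definition poly_rank :: "real poly mat \<Rightarrow> nat" where
  "poly_rank A = vec_space.rank (dim_row A) (map_mat to_fract A :: real poly fract mat)"

definition full_row_rank :: "real poly mat \<Rightarrow> bool" where
  "full_row_rank A \<longleftrightarrow> poly_rank A = dim_row A"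

subsection \<open>Signals and behaviors\<close>

text \<open>A signal in \<open>q\<close> variables is a function from the reals to vectors of dimension \<open>q\<close>.
  A composite signal such as \<open>(u, y)\<close> is the stacked signal \<open>u \<oplus>\<^sub>s y\<close>.\<close>

type_synonym signal = "real \<Rightarrow> real vec"

definition smooth :: "(real \<Rightarrow> real) \<Rightarrow> bool" where
  "smooth f \<longleftrightarrow> (\<forall>k t. (deriv ^^ k) f differentiable (at t))"

definition signals :: "nat \<Rightarrow> signal set" where
  "signals q = {x. (\<forall>t. x t \<in> carrier_vec q) \<and> (\<forall>i<q. smooth (\<lambda>t. x t $ i))}"

definition stack :: "signal \<Rightarrow> signal \<Rightarrow> signal" (infixr \<open>\<oplus>\<^sub>s\<close> 65) where
  "x \<oplus>\<^sub>s z = (\<lambda>t. x t @\<^sub>v z t)"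

definition poly_ddt :: "real poly \<Rightarrow> (real \<Rightarrow> real) \<Rightarrow> real \<Rightarrow> real" where
  "poly_ddt p f t = (\<Sum>i\<le>degree p. coeff p i * (deriv ^^ i) f t)"

definition mat_ddt :: "real poly mat \<Rightarrow> signal \<Rightarrow> signal" where
  "mat_ddt A x t =
     vec (dim_row A) (\<lambda>i. \<Sum>j<dim_col A. poly_ddt (A $$ (i, j)) (\<lambda>s. x s $ j) t)"

definition ker_ddt :: "real poly mat \<Rightarrow> signal set" where
  "ker_ddt A = {x \<in> signals (dim_col A). \<forall>t. mat_ddt A x t = 0\<^sub>v (dim_row A)}"

definition behavior :: "nat \<Rightarrow> signal set \<Rightarrow> bool" where
  "behavior q B \<longleftrightarrow> (\<exists>g. \<exists>A \<in> carrier_mat g q. B = ker_ddt A)"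

definition num_outputs :: "nat \<Rightarrow> signal set \<Rightarrow> nat" where
  "num_outputs q B = (THE g. \<exists>A \<in> carrier_mat g q. full_row_rank A \<and> B = ker_ddt A)"

text \<open>A partition of the \<open>q\<close> variables is given by the sets of indices of its two parts;
  \<open>submatrix A UNIV Out\<close> consists of the columns of \<open>A\<close> acting on the output part.\<close>

definition io_partition :: "nat \<Rightarrow> signal set \<Rightarrow> nat set \<Rightarrow> nat set \<Rightarrow> bool" where
  "io_partition q B Out In \<longleftrightarrow>
     Out \<union> In = {..<q} \<and> Out \<inter> In = {} \<and>
     (\<exists>g. \<exists>A \<in> carrier_mat g q. full_row_rank A \<and> B = ker_ddt A \<and>
        square_mat (submatrix A UNIV Out) \<and> full_row_rank (submatrix A UNIV Out))"

subsection \<open>Plant, controllers and the control problem\<close>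

definition plant_full :: "real poly mat \<Rightarrow> real poly mat \<Rightarrow> real poly mat \<Rightarrow> signal set" where
  "plant_full R P Q = ker_ddt (R @\<^sub>c P @\<^sub>c Q)"

definition implements ::
  "real poly mat \<Rightarrow> real poly mat \<Rightarrow> real poly mat \<Rightarrow> signal set \<Rightarrow> signal set \<Rightarrow> bool" where
  "implements R P Q C S \<longleftrightarrow>
     {w \<in> signals (dim_col R). \<exists>u \<in> signals (dim_col P). \<exists>y \<in> signals (dim_col Q).
        u \<oplus>\<^sub>s y \<in> C \<and> w \<oplus>\<^sub>s u \<oplus>\<^sub>s y \<in> plant_full R P Q} = S"

definition regular_controller ::
  "real poly mat \<Rightarrow> real poly mat \<Rightarrow> real poly mat \<Rightarrow> signal set \<Rightarrow> bool" where
  "regular_controller R P Q C \<longleftrightarrow>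
     (\<exists>g. \<exists>C1 \<in> carrier_mat g (dim_col P). \<exists>C2 \<in> carrier_mat g (dim_col Q).
        full_row_rank (C1 @\<^sub>c C2) \<and> C = ker_ddt (C1 @\<^sub>c C2) \<and>
        poly_rank ((R @\<^sub>c P @\<^sub>c Q) @\<^sub>r (0\<^sub>m g (dim_col R) @\<^sub>c C1 @\<^sub>c C2)) =
          poly_rank (R @\<^sub>c P @\<^sub>c Q) + poly_rank (C1 @\<^sub>c C2))"

definition regularly_implementable ::
  "real poly mat \<Rightarrow> real poly mat \<Rightarrow> real poly mat \<Rightarrow> signal set \<Rightarrow> bool" where
  "regularly_implementable R P Q S \<longleftrightarrow>
     (\<exists>C. regular_controller R P Q C \<and> implements R P Q C S)"

text \<open>In a signal \<open>u \<oplus>\<^sub>s y\<close> the components of \<open>y\<close> have the indices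
  from \<open>dim_col P\<close> up to \<open>dim_col P + dim_col Q - 1\<close>.\<close>

definition solves_problem ::
  "real poly mat \<Rightarrow> real poly mat \<Rightarrow> real poly mat \<Rightarrow> signal set \<Rightarrow> signal set \<Rightarrow> bool" where
  "solves_problem R P Q S C \<longleftrightarrow>
     regular_controller R P Q C \<and> implements R P Q C S \<and>
     (\<exists>Out In. io_partition (dim_col P + dim_col Q) C Out In \<and>
        {dim_col P..<dim_col P + dim_col Q} \<subseteq> In)"

definition problem_solvable ::
  "real poly mat \<Rightarrow> real poly mat \<Rightarrow> real poly mat \<Rightarrow> signal set \<Rightarrow> bool" where
  "problem_solvable R P Q S \<longleftrightarrow> (\<exists>C. solves_problem R P Q S C)"

definition control_manifest ::
  "real poly mat \<Rightarrow> real poly mat \<Rightarrow> real poly mat \<Rightarrow> signal set" where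
  "control_manifest R P Q =
     {u \<oplus>\<^sub>s y | u y. u \<in> signals (dim_col P) \<and> y \<in> signals (dim_col Q) \<and>
        (\<exists>w \<in> signals (dim_col R). w \<oplus>\<^sub>s u \<oplus>\<^sub>s y \<in> plant_full R P Q)}"

definition canonical_controller ::
  "real poly mat \<Rightarrow> real poly mat \<Rightarrow> real poly mat \<Rightarrow> signal set \<Rightarrow> signal set" where
  "canonical_controller R P Q S =
     {u \<oplus>\<^sub>s y | u y. u \<in> signals (dim_col P) \<and> y \<in> signals (dim_col Q) \<and>
        (\<exists>w \<in> S. w \<oplus>\<^sub>s u \<oplus>\<^sub>s y \<in> plant_full R P Q)}"

definition can_reg ::
  "real poly mat \<Rightarrow> real poly mat \<Rightarrow> real poly mat \<Rightarrow> signal set \<Rightarrow> signal set set" where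
  "can_reg R P Q S =
     {C. regular_controller R P Q C \<and>
         C \<inter> control_manifest R P Q = canonical_controller R P Q S \<inter> control_manifest R P Q}"

end

theory Submission
  imports Defs "HOL-Analysis.Henstock_Kurzweil_Integration"
    "HOL-Computational_Algebra.Fundamental_Theorem_Algebra"
begin

text \<open>Everything reduces to linear algebra over the principal ideal domain \<open>D\<close> of real polynomials,
because the smooth functions, with \<open>D\<close> acting by differentiation, form an injective cogenerator:
a system \<open>K(d/dt) x = f\<close> is solvable as soon as no syzygy of the rows of \<open>K\<close> contradicts it
(\<open>fundamental_principle\<close>), and a row that annihilates all solutions of \<open>K(d/dt) x = 0\<close> is a
polynomial combination of the rows of \<open>K\<close> (\<open>row_span_if_annihilates_ker\<close>). Hence behaviors
correspond bijectively to row modules, with inclusions reversed and intersections of modules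
turned into sums of behaviors (\<open>ker_ddt_subset_iff\<close>, \<open>ker_ddt_sum\<close>). Divisibility and the
existence of nonzero solutions come from explicit solutions of equations with a linear or
irreducible quadratic characteristic polynomial; the step to systems is an induction over the
columns in which, as in Baer's criterion, only one principal ideal is treated at a time.

Ranks over the field of fractions enter through two facts. A matrix has full row rank iff its
rows are independent over \<open>D\<close> (\<open>full_row_rank_iff_indep_rows\<close>), and its rank is the size of any
basis of its row module (\<open>poly_rank_eq_if_row_basis\<close>). Let \<open>E\<close> be the module of the rows
\<open>w [P Q]\<close> with \<open>w R = 0\<close>. By elimination, \<open>E\<close> is the row module of every kernel representation
\<open>N = [P1 P2]\<close> of the control manifest behavior, and a controller with independent rows \<open>M\<close>
is regular iff the row module of \<open>M\<close> meets \<open>E\<close> only in zero (\<open>rank_regular_iff\<close>).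

Nonemptiness: if \<open>C0\<close> is regular and implements \<open>S\<close>, then enlarging \<open>C0\<close> by the control signals
that are compatible with \<open>w = 0\<close> preserves regularity, as its row module shrinks, and turns
\<open>C0 \<inter> P_c\<close> into the canonical controller (\<open>can_reg_nonempty\<close>).

Now let \<open>C\<close> with rows \<open>M = [C1 C2]\<close> be regular with \<open>C \<inter> P_c\<close> canonical. A solution \<open>C'\<close> of the
problem with rows \<open>A = [A1 A2]\<close> satisfies \<open>C' \<inter> P_c \<subseteq> C\<close>, so \<open>M = F A + V N\<close>. Regularity
of \<open>C\<close> makes \<open>F\<close> injective on row vectors, and the input-output partition does the same for \<open>A1\<close>;
therefore \<open>C1 - V P1 = F A1\<close> has \<open>c\<close> independent rows, which are combinations of the rows of
\<open>C1\<close> and \<open>P1\<close>, so the rank condition holds (\<open>rank_if_solvable\<close>). Conversely, the rank condition lets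
one build \<open>V\<close> row by row, adding to each row of \<open>C1\<close> either nothing or one row of \<open>P1\<close>
(\<open>exists_indep_rows_perturbation\<close>). Passing from \<open>M\<close> to \<open>M + V N\<close> changes neither regularity nor the
intersection with \<open>P_c\<close>, and \<open>c\<close> independent columns of \<open>C1 + V P1\<close> give the outputs
(\<open>solves_if_full_row_rank\<close>).\<close>

unbundle no vec_syntax

section \<open>Smooth functions as a module over the real polynomials\<close>

lemma smooth_coinduct:
  assumes "X f" and "\<And>h. X h \<Longrightarrow> (\<forall>t. h differentiable (at t)) \<and> X (deriv h)"
  shows "smooth f"
proof -
  have "X ((deriv ^^ k) f)" for k by (induction k) (use assms in auto)
  then show ?thesis using assms(2) by (simp add: smooth_def)
qed

lemma smooth_has_deriv: "smooth f \<Longrightarrow> (f has_real_derivative deriv f t) (at t)"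
  unfolding smooth_def by (metis DERIV_deriv_iff_real_differentiable funpow_0)

lemma smooth_deriv: "smooth f \<Longrightarrow> smooth (deriv f)"
  unfolding smooth_def by (metis comp_apply funpow_Suc_right)

lemma smooth_funpow_deriv: "smooth f \<Longrightarrow> smooth ((deriv ^^ k) f)"
  by (induction k) (auto intro: smooth_deriv)

lemma deriv_add_smooth:
  "smooth f \<Longrightarrow> smooth g \<Longrightarrow> deriv (\<lambda>t. f t + g t) = (\<lambda>t. deriv f t + deriv g t)"
  by (rule ext, rule DERIV_imp_deriv) (intro DERIV_add smooth_has_deriv)

lemma deriv_cmult_smooth: "smooth f \<Longrightarrow> deriv (\<lambda>t. a * f t) = (\<lambda>t. a * deriv f t)"
  by (rule ext, rule DERIV_imp_deriv) (intro DERIV_cmult smooth_has_deriv)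

lemma smooth_add: assumes "smooth f" "smooth g" shows "smooth (\<lambda>t. f t + g t)"
proof (rule smooth_coinduct[where X = "\<lambda>h. \<exists>f g. smooth f \<and> smooth g \<and> h = (\<lambda>t. f t + g t)"])
  fix h :: "real \<Rightarrow> real" assume "\<exists>f g. smooth f \<and> smooth g \<and> h = (\<lambda>t. f t + g t)"
  then obtain f g where fg: "smooth f" "smooth g" "h = (\<lambda>t. f t + g t)" by blast
  then show "(\<forall>t. h differentiable (at t)) \<and> (\<exists>f g. smooth f \<and> smooth g \<and> deriv h = (\<lambda>t. f t + g t))"
    using deriv_add_smooth[OF fg(1,2)] smooth_deriv smooth_has_deriv[OF fg(1)] smooth_has_deriv[OF fg(2)]
    by (metis DERIV_add real_differentiable_def)
qed (use assms in blast)

lemma smooth_cmult: assumes "smooth f" shows "smooth (\<lambda>t. a * f t)"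
proof (rule smooth_coinduct[where X = "\<lambda>h. \<exists>f. smooth f \<and> h = (\<lambda>t. a * f t)"])
  fix h :: "real \<Rightarrow> real" assume "\<exists>f. smooth f \<and> h = (\<lambda>t. a * f t)"
  then obtain f where f: "smooth f" "h = (\<lambda>t. a * f t)" by blast
  then show "(\<forall>t. h differentiable (at t)) \<and> (\<exists>f. smooth f \<and> deriv h = (\<lambda>t. a * f t))"
    using deriv_cmult_smooth[OF f(1)] smooth_deriv smooth_has_deriv[OF f(1)]
    by (metis DERIV_cmult real_differentiable_def)
qed (use assms in blast)

lemma smooth_zero: "smooth (\<lambda>t. 0)"
  by (rule smooth_coinduct[where X = "\<lambda>h. h = (\<lambda>t. 0)"]) auto

lemma smooth_uminus: "smooth f \<Longrightarrow> smooth (\<lambda>t. - f t)"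
  using smooth_cmult[of f "-1"] by simp

lemma smooth_diff: "smooth f \<Longrightarrow> smooth g \<Longrightarrow> smooth (\<lambda>t. f t - g t)"
  using smooth_add[of f "\<lambda>t. - g t"] smooth_uminus by simp

lemma smooth_sum: "(\<And>i. i \<in> I \<Longrightarrow> smooth (f i)) \<Longrightarrow> smooth (\<lambda>t. \<Sum>i\<in>I. f i t)"
  by (induction I rule: infinite_finite_induct) (auto intro: smooth_add smooth_zero)

lemma funpow_deriv_add:
  "smooth f \<Longrightarrow> smooth g \<Longrightarrow> (deriv ^^ k) (\<lambda>t. f t + g t) = (\<lambda>t. (deriv ^^ k) f t + (deriv ^^ k) g t)"
  by (induction k) (simp_all add: deriv_add_smooth smooth_funpow_deriv)

lemma funpow_deriv_cmult:
  "smooth f \<Longrightarrow> (deriv ^^ k) (\<lambda>t. a * f t) = (\<lambda>t. a * (deriv ^^ k) f t)"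
  by (induction k) (simp_all add: deriv_cmult_smooth smooth_funpow_deriv)

lemma poly_ddt_altdef:
  assumes "degree p \<le> n"
  shows "poly_ddt p f t = (\<Sum>i\<le>n. coeff p i * (deriv ^^ i) f t)"
  unfolding poly_ddt_def using assms by (intro sum.mono_neutral_left) (auto simp: coeff_eq_0)

lemma poly_ddt_0 [simp]: "poly_ddt 0 f = (\<lambda>t. 0)"
  by (simp add: poly_ddt_def fun_eq_iff)

text \<open>The Horner form of the operator: it lets properties of \<open>poly_ddt\<close> be proved by induction on
the polynomial instead of by manipulating sums over the degree.\<close>

lemma poly_ddt_pCons: "poly_ddt (pCons a p) f = (\<lambda>t. a * f t + poly_ddt p (deriv f) t)"
proof
  fix t
  have "poly_ddt (pCons a p) f t = (\<Sum>i\<le>Suc (degree p). coeff (pCons a p) i * (deriv ^^ i) f t)"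
    by (rule poly_ddt_altdef) (rule degree_pCons_le)
  also have "\<dots> = a * f t + poly_ddt p (deriv f) t"
    by (subst sum.atMost_Suc_shift) (simp add: poly_ddt_def funpow_swap1)
  finally show "poly_ddt (pCons a p) f t = a * f t + poly_ddt p (deriv f) t" .
qed

lemma poly_ddt_1 [simp]: "poly_ddt 1 f = f"
  by (simp add: one_pCons poly_ddt_pCons)

lemma smooth_poly_ddt: "smooth f \<Longrightarrow> smooth (poly_ddt p f)"
  by (induction p arbitrary: f)
    (auto simp: poly_ddt_pCons intro!: smooth_zero smooth_add smooth_cmult smooth_deriv)

lemma poly_ddt_add: "poly_ddt (p + q) f = (\<lambda>t. poly_ddt p f t + poly_ddt q f t)"
proof
  fix t
  let ?n = "max (degree p) (degree q)"
  show "poly_ddt (p + q) f t = poly_ddt p f t + poly_ddt q f t"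
    using poly_ddt_altdef[of p ?n f t] poly_ddt_altdef[of q ?n f t] poly_ddt_altdef[of "p + q" ?n f t]
    by (simp add: degree_add_le algebra_simps sum.distrib)
qed

lemma poly_ddt_smult: "poly_ddt (Polynomial.smult a p) f = (\<lambda>t. a * poly_ddt p f t)"
proof
  fix t show "poly_ddt (Polynomial.smult a p) f t = a * poly_ddt p f t"
    using poly_ddt_altdef[of "Polynomial.smult a p" "degree p" f t]
    by (simp add: poly_ddt_def degree_smult_le sum_distrib_left mult.assoc)
qed

lemma poly_ddt_sum: "poly_ddt (\<Sum>i\<in>I. p i) f = (\<lambda>t. \<Sum>i\<in>I. poly_ddt (p i) f t)"
  by (induction I rule: infinite_finite_induct) (auto simp: poly_ddt_add)

lemma poly_ddt_fun_add:
  "smooth f \<Longrightarrow> smooth g \<Longrightarrow> poly_ddt p (\<lambda>t. f t + g t) = (\<lambda>t. poly_ddt p f t + poly_ddt p g t)"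
  by (simp add: poly_ddt_def fun_eq_iff funpow_deriv_add algebra_simps sum.distrib)

lemma poly_ddt_fun_cmult:
  "smooth f \<Longrightarrow> poly_ddt p (\<lambda>t. a * f t) = (\<lambda>t. a * poly_ddt p f t)"
  by (simp add: poly_ddt_def fun_eq_iff funpow_deriv_cmult sum_distrib_left algebra_simps)

lemma poly_ddt_fun_zero [simp]: "poly_ddt p (\<lambda>t. 0) = (\<lambda>t. 0)"
  using poly_ddt_fun_cmult[OF smooth_zero, of p 0] by simp

lemma poly_ddt_fun_uminus: "smooth f \<Longrightarrow> poly_ddt p (\<lambda>t. - f t) = (\<lambda>t. - poly_ddt p f t)"
  using poly_ddt_fun_cmult[of f p "-1"] by simp

lemma poly_ddt_fun_sum:
  "(\<And>i. i \<in> I \<Longrightarrow> smooth (f i)) \<Longrightarrow> poly_ddt p (\<lambda>t. \<Sum>i\<in>I. f i t) = (\<lambda>t. \<Sum>i\<in>I. poly_ddt p (f i) t)"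
  by (induction I rule: infinite_finite_induct) (auto simp: poly_ddt_fun_add smooth_sum)

lemma deriv_poly_ddt: "smooth f \<Longrightarrow> deriv (poly_ddt p f) = poly_ddt p (deriv f)"
  by (induction p arbitrary: f)
    (simp_all add: poly_ddt_pCons deriv_add_smooth deriv_cmult_smooth smooth_cmult smooth_poly_ddt smooth_deriv)

text \<open>Together with additivity in both arguments, this makes the smooth functions a module over
the commutative ring of real polynomials.\<close>

lemma poly_ddt_mult: "smooth f \<Longrightarrow> poly_ddt (p * q) f = poly_ddt p (poly_ddt q f)"
  by (induction p arbitrary: f)
    (simp_all add: poly_ddt_pCons poly_ddt_add poly_ddt_smult deriv_poly_ddt smooth_deriv)

section \<open>Scalar differential equations\<close>

lemma antiderivative:
  fixes f :: "real \<Rightarrow> real"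
  assumes "\<And>t. isCont f t"
  obtains F where "\<And>t. (F has_real_derivative f t) (at t)"
proof -
  define F where "F x = (if x \<ge> 0 then integral {0..x} f else - integral {x..0} f)" for x
  have c: "continuous_on A f" for A using assms by (simp add: continuous_at_imp_continuous_on)
  have "(F has_real_derivative f t) (at t)" for t
  proof -
    define a where "a = - \<bar>t\<bar> - 1"
    define b where "b = \<bar>t\<bar> + 1"
    have ab: "a < t" "t < b" "a < 0" "0 < b" by (auto simp: a_def b_def)
    have i: "f integrable_on {x..y}" for x y by (rule integrable_continuous_real[OF c])
    have eq: "integral {a..x} f - integral {a..0} f = F x" if "x \<in> {a<..<b}" for x
    proof (cases "x \<ge> 0")
      case True
      then show ?thesis using Henstock_Kurzweil_Integration.integral_combine[of a 0 x f] ab i by (simp add: F_def)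
    next
      case False
      then show ?thesis using Henstock_Kurzweil_Integration.integral_combine[of a x 0 f] that i by (simp add: F_def)
    qed
    have "((\<lambda>x. integral {a..x} f) has_real_derivative f t) (at t within {a..b})"
      by (rule integral_has_real_derivative[OF c]) (use ab in auto)
    then have "((\<lambda>x. integral {a..x} f) has_real_derivative f t) (at t)"
      using at_within_Icc_at[OF ab(1,2)] by simp
    then have "((\<lambda>x. integral {a..x} f - integral {a..0} f) has_real_derivative f t) (at t)"
      by (auto intro!: derivative_eq_intros)
    then show ?thesis
      by (rule has_field_derivative_transform_within_open[of _ _ _ "{a<..<b}"]) (use ab eq in auto)
  qed
  then show ?thesis by (rule that)
qed

text \<open>The pair \<open>(x, z)\<close> is the real form of \<open>\<zeta>' = \<lambda> \<zeta> + i h\<close> with \<open>\<lambda> = a + i b\<close> and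
\<open>\<zeta> = x + i z\<close>. The functions \<open>\<alpha> x + \<beta> z + k\<close> with smooth \<open>k\<close> are closed under
differentiation, which gives smoothness. Case \<open>h = 0\<close> yields the homogeneous solutions, case
\<open>x = b = 0\<close> the first-order equation.\<close>

lemma rotation_smooth:
  assumes x: "\<And>t. (x has_real_derivative a * x t - b * z t) (at t)"
    and z: "\<And>t. (z has_real_derivative b * x t + a * z t + h t) (at t)"
    and h: "smooth h"
  shows "smooth x" and "smooth z"
    and "poly_ddt [: a\<^sup>2 + b\<^sup>2, - 2 * a, 1 :] x = (\<lambda>t. - b * h t)"
proof -
  let ?X = "\<lambda>k. \<exists>\<alpha> \<beta> h. smooth h \<and> k = (\<lambda>t. \<alpha> * x t + \<beta> * z t + h t)"
  have X: "smooth k" if "?X k" for k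
  proof (rule smooth_coinduct[where X = ?X])
    fix k :: "real \<Rightarrow> real" assume "?X k"
    then obtain \<alpha> \<beta> h' where k: "smooth h'" "k = (\<lambda>t. \<alpha> * x t + \<beta> * z t + h' t)" by blast
    have d: "(k has_real_derivative (\<alpha> * a + \<beta> * b) * x t + (\<beta> * a - \<alpha> * b) * z t + (\<beta> * h t + deriv h' t)) (at t)" for t
      unfolding k(2) using x[of t] z[of t] smooth_has_deriv[OF k(1), of t]
      by (auto intro!: derivative_eq_intros simp: algebra_simps)
    then have "deriv k = (\<lambda>t. (\<alpha> * a + \<beta> * b) * x t + (\<beta> * a - \<alpha> * b) * z t + (\<beta> * h t + deriv h' t))"
      by (intro ext DERIV_imp_deriv)
    moreover have "smooth (\<lambda>t. \<beta> * h t + deriv h' t)"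
      by (intro smooth_add smooth_cmult smooth_deriv h k(1))
    ultimately show "(\<forall>t. k differentiable (at t)) \<and> ?X (deriv k)"
      using d real_differentiable_def by blast
  qed (rule that)
  show "smooth x" by (rule X, rule exI[of _ 1], rule exI[of _ 0], rule exI[of _ "\<lambda>t. 0"]) (simp add: smooth_zero)
  show "smooth z" by (rule X, rule exI[of _ 0], rule exI[of _ 1], rule exI[of _ "\<lambda>t. 0"]) (simp add: smooth_zero)
  have d1: "deriv x = (\<lambda>t. a * x t - b * z t)" by (intro ext DERIV_imp_deriv x)
  have d2: "deriv (\<lambda>t. a * x t - b * z t) = (\<lambda>t. a * (a * x t - b * z t) - b * (b * x t + a * z t + h t))"
    by (intro ext DERIV_imp_deriv DERIV_diff DERIV_cmult x z)
  show "poly_ddt [: a\<^sup>2 + b\<^sup>2, - 2 * a, 1 :] x = (\<lambda>t. - b * h t)"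
    by (simp add: poly_ddt_pCons d1 d2 fun_eq_iff algebra_simps power2_eq_square)
qed

text \<open>Variation of constants for the complex equation \<open>\<zeta>' = (a + i b) \<zeta> + i h\<close>, written in real
and imaginary parts.\<close>

lemma quadratic_solvable:
  assumes b: "b \<noteq> 0" and f: "smooth f"
  shows "\<exists>x. smooth x \<and> poly_ddt [: a\<^sup>2 + b\<^sup>2, - 2 * a, 1 :] x = f"
proof -
  define h where "h t = - f t / b" for t
  have h: "smooth h" using smooth_cmult[OF f, of "-1 / b"] by (simp add: h_def[abs_def])
  have ch: "isCont h t" for t using smooth_has_deriv[OF h] DERIV_isCont by blast
  obtain I where I: "\<And>t. (I has_real_derivative exp (- a * t) * sin (b * t) * h t) (at t)"
    by (rule antiderivative[of "\<lambda>t. exp (- a * t) * sin (b * t) * h t"]) (intro continuous_intros ch, rule that)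
  obtain J where J: "\<And>t. (J has_real_derivative exp (- a * t) * cos (b * t) * h t) (at t)"
    by (rule antiderivative[of "\<lambda>t. exp (- a * t) * cos (b * t) * h t"]) (intro continuous_intros ch, rule that)
  define x where "x t = exp (a * t) * (cos (b * t) * I t - sin (b * t) * J t)" for t
  define z where "z t = exp (a * t) * (sin (b * t) * I t + cos (b * t) * J t)" for t
  have e: "exp (a * t) * exp (- (a * t)) = 1" for t by (simp flip: exp_add)
  have x': "(x has_real_derivative a * x t - b * z t) (at t)" for t
    unfolding x_def[abs_def] z_def using I[of t] J[of t]
    by (auto intro!: derivative_eq_intros simp: algebra_simps)
  have sc: "exp (a * t) * (sin (b * t) * (exp (- a * t) * sin (b * t) * h t)
      + cos (b * t) * (exp (- a * t) * cos (b * t) * h t)) = h t" (is "?H t = _") for t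
  proof -
    have "?H t = (exp (a * t) * exp (- a * t)) * ((sin (b * t))\<^sup>2 + (cos (b * t))\<^sup>2) * h t"
      by (simp only: power2_eq_square ring_distribs mult_ac)
    then show ?thesis by (simp add: e)
  qed
  have "(z has_real_derivative b * x t + a * z t + ?H t) (at t)" for t
    unfolding x_def z_def[abs_def] using I[of t] J[of t]
    by (auto intro!: derivative_eq_intros simp: algebra_simps)
  then have z': "(z has_real_derivative b * x t + a * z t + h t) (at t)" for t
    unfolding sc .
  from rotation_smooth[OF x' z' h] b show ?thesis
    by (auto simp: h_def fun_eq_iff)
qed

lemma linear_solvable:
  assumes f: "smooth f"
  shows "\<exists>x. smooth x \<and> poly_ddt [: - a, 1 :] x = f"
proof -
  have ch: "isCont f t" for t using smooth_has_deriv[OF f] DERIV_isCont by blast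
  obtain I where I: "\<And>t. (I has_real_derivative exp (- a * t) * f t) (at t)"
    by (rule antiderivative[of "\<lambda>t. exp (- a * t) * f t"]) (intro continuous_intros ch, rule that)
  define x where "x t = exp (a * t) * I t" for t
  have e: "exp (a * t) * (exp (- (a * t)) * f t) = f t" for t by (simp flip: exp_add mult.assoc)
  have x: "(x has_real_derivative a * x t + f t) (at t)" for t
    unfolding x_def[abs_def]
    apply (rule derivative_eq_intros I refl)+
    using e[of t] by (simp add: algebra_simps)
  have "smooth x"
    by (rule rotation_smooth(2)[of "\<lambda>t. 0" a 0 x f]) (use x f in auto)
  moreover have "deriv x = (\<lambda>t. a * x t + f t)" by (intro ext DERIV_imp_deriv x)
  ultimately show ?thesis by (intro exI[of _ x]) (simp add: poly_ddt_pCons)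
qed

text \<open>A complex root that is not real comes with its conjugate, so the quadratic with these two
roots has real coefficients and divides the polynomial.\<close>

lemma real_poly_factor:
  fixes p :: "real poly"
  assumes "degree p > 0"
  shows "(\<exists>a. [: - a, 1 :] dvd p) \<or> (\<exists>a b. b \<noteq> 0 \<and> [: a\<^sup>2 + b\<^sup>2, - 2 * a, 1 :] dvd p)"
proof -
  have "\<not> constant (poly (map_poly complex_of_real p))"
    using assms by (simp add: constant_degree degree_map_poly)
  then obtain w where w: "poly (map_poly complex_of_real p) w = 0"
    using fundamental_theorem_of_algebra by blast
  show ?thesis
  proof (cases "Im w = 0")
    case True
    then have "w = complex_of_real (Re w)" by (simp add: complex_eq_iff)
    moreover have "poly (map_poly complex_of_real p) (complex_of_real x) = complex_of_real (poly p x)" for x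
      by (induction p) (simp_all add: map_poly_pCons)
    ultimately have "complex_of_real (poly p (Re w)) = 0" using w by metis
    then show ?thesis by (auto simp: poly_eq_0_iff_dvd)
  next
    case False
    let ?q = "[: (Re w)\<^sup>2 + (Im w)\<^sup>2, - 2 * Re w, 1 :]"
    define r where "r = p mod ?q"
    have "degree r < 2" using degree_mod_less'[of ?q p] by (cases "r = 0") (auto simp: r_def)
    then have "r = [: coeff r 0, coeff r 1 :]"
      by (intro poly_eqI) (auto simp: coeff_pCons coeff_eq_0 split: nat.split)
    then obtain u v where r: "r = [: u, v :]" by blast
    define d where "d = p div ?q"
    have p: "p = d * ?q + r" unfolding d_def r_def by (rule div_mult_mod_eq[symmetric])
    have q0: "poly (map_poly complex_of_real ?q) w = 0"
      by (simp add: complex_eq_iff map_poly_pCons power2_eq_square algebra_simps)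
    have hom: "map_poly complex_of_real (f + g) = map_poly complex_of_real f + map_poly complex_of_real g"
      "map_poly complex_of_real (f * g) = map_poly complex_of_real f * map_poly complex_of_real g" for f g
      by (rule poly_eqI, simp add: coeff_map_poly coeff_mult)+
    have "0 = poly (map_poly complex_of_real (d * ?q + r)) w"
      unfolding p[symmetric] w ..
    also have "\<dots> = poly (map_poly complex_of_real r) w"
      by (simp only: hom poly_add poly_mult q0 mult_zero_right add_0)
    finally have "poly (map_poly complex_of_real r) w = 0" ..
    then have "complex_of_real u + w * complex_of_real v = 0"
      by (simp add: r map_poly_pCons)
    then have "v = 0" "u = 0" using False by (auto simp: complex_eq_iff)
    then have "r = 0" using r by simp
    then have "?q dvd p" unfolding r_def dvd_eq_mod_eq_0 .
    then show ?thesis using False by blast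
  qed
qed

text \<open>Divisibility of the module of smooth functions: the operator is a composition of operators of
the two solvable types.\<close>

lemma poly_ddt_surj:
  assumes "p \<noteq> 0" and "smooth f"
  shows "\<exists>x. smooth x \<and> poly_ddt p x = f"
  using assms
proof (induction "degree p" arbitrary: p f rule: less_induct)
  case less
  show ?case
  proof (cases "degree p = 0")
    case True
    then obtain a where a: "p = [:a:]" using degree_eq_zeroE by blast
    then have "a \<noteq> 0" using less.prems by simp
    then show ?thesis using smooth_cmult[OF less.prems(2), of "1 / a"] a
      by (intro exI[of _ "\<lambda>t. 1 / a * f t"]) (simp add: poly_ddt_pCons)
  next
    case False
    then obtain q p' where p: "p = q * p'" and q: "degree q > 0"
      and ex: "\<And>f. smooth f \<Longrightarrow> \<exists>x. smooth x \<and> poly_ddt q x = f"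
    proof -
      from False consider a where "[: - a, 1 :] dvd p"
        | a b where "b \<noteq> 0" "[: a\<^sup>2 + b\<^sup>2, - 2 * a, 1 :] dvd p"
        using real_poly_factor[of p] by blast
      then show thesis
      proof cases
        case 1
        then show thesis using linear_solvable by (auto elim!: dvdE intro!: that)
      next
        case 2
        then show thesis using quadratic_solvable[OF 2(1)] by (auto elim!: dvdE intro!: that)
      qed
    qed
    have p': "p' \<noteq> 0" "q \<noteq> 0" using p less.prems by auto
    then have "degree p' < degree p" using p q by (simp add: degree_mult_eq)
    obtain y where y: "smooth y" "poly_ddt q y = f" using ex[OF less.prems(2)] by blast
    obtain x where "smooth x" "poly_ddt p' x = y"
      using less.hyps[OF \<open>degree p' < degree p\<close> p'(1) y(1)] by blast
    then show ?thesis using y p by (auto simp: poly_ddt_mult)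
  qed
qed

text \<open>Every ideal of the polynomials other than the whole ring annihilates some nonzero smooth
function; this is what makes the smooth functions a cogenerator. The zero polynomial is included
because it generates the zero ideal.\<close>

lemma poly_ddt_nonzero_solution:
  assumes "degree p > 0 \<or> p = 0"
  shows "\<exists>x. smooth x \<and> x \<noteq> (\<lambda>t. 0) \<and> poly_ddt p x = (\<lambda>t. 0)"
proof -
  have base: "\<exists>x. smooth x \<and> x \<noteq> (\<lambda>t. 0) \<and> poly_ddt [: a\<^sup>2 + b\<^sup>2, - 2 * a, 1 :] x = (\<lambda>t. 0)
      \<and> (b = 0 \<longrightarrow> poly_ddt [: - a, 1 :] x = (\<lambda>t. 0))" for a b :: real
  proof -
    define x where "x t = exp (a * t) * cos (b * t)" for t
    define z where "z t = exp (a * t) * sin (b * t)" for t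
    have x: "(x has_real_derivative a * x t - b * z t) (at t)" for t
      unfolding x_def[abs_def] z_def by (auto intro!: derivative_eq_intros simp: algebra_simps)
    have z: "(z has_real_derivative b * x t + a * z t + 0) (at t)" for t
      unfolding x_def z_def[abs_def] by (auto intro!: derivative_eq_intros simp: algebra_simps)
    have "x 0 \<noteq> 0" by (simp add: x_def)
    moreover have "deriv x = (\<lambda>t. a * x t - b * z t)" by (intro ext DERIV_imp_deriv x)
    ultimately show ?thesis using rotation_smooth[OF x z smooth_zero]
      by (intro exI[of _ x]) (auto simp: poly_ddt_pCons fun_eq_iff)
  qed
  show ?thesis
  proof (cases "p = 0")
    case True
    then show ?thesis using base by auto
  next
    case False
    then have "degree p > 0" using assms by simp
    then obtain q x where "q dvd p" "smooth x" "x \<noteq> (\<lambda>t. 0)" "poly_ddt q x = (\<lambda>t. 0)"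
      using real_poly_factor[of p] base by blast
    then show ?thesis by (auto elim!: dvdE simp: poly_ddt_mult mult.commute)
  qed
qed

section \<open>Row vectors times matrices\<close>

text \<open>The product of a row vector with a matrix; the transpose only serves to reuse the
matrix-vector product.\<close>

definition row_mult :: "'a :: comm_ring_1 vec \<Rightarrow> 'a mat \<Rightarrow> 'a vec" (infixl "\<star>" 70) where
  "v \<star> A = transpose_mat A *\<^sub>v v"

definition row_span :: "'a :: comm_ring_1 mat \<Rightarrow> 'a vec set" where
  "row_span A = {v \<star> A | v. v \<in> carrier_vec (dim_row A)}"

definition indep_rows :: "'a :: comm_ring_1 mat \<Rightarrow> bool" where
  "indep_rows A \<longleftrightarrow>
     (\<forall>v \<in> carrier_vec (dim_row A). v \<star> A = 0\<^sub>v (dim_col A) \<longrightarrow> v = 0\<^sub>v (dim_row A))"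

lemma dim_row_mult [simp]: "dim_vec (v \<star> A) = dim_col A"
  by (simp add: row_mult_def)

lemma row_mult_carrier [simp, intro]: "A \<in> carrier_mat g q \<Longrightarrow> v \<star> A \<in> carrier_vec q"
  by (auto intro: carrier_vecI)

lemma row_mult_index:
  assumes "v \<in> carrier_vec g" "A \<in> carrier_mat g q" "j < q"
  shows "(v \<star> A) $ j = (\<Sum>i<g. v $ i * A $$ (i, j))"
  using assms by (simp add: row_mult_def scalar_prod_def lessThan_atLeast0 mult.commute)

lemma row_mult_add:
  "v \<in> carrier_vec g \<Longrightarrow> w \<in> carrier_vec g \<Longrightarrow> A \<in> carrier_mat g q \<Longrightarrow> (v + w) \<star> A = v \<star> A + w \<star> A"
  unfolding row_mult_def by (rule mult_add_distrib_mat_vec) auto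

lemma row_mult_smult:
  "v \<in> carrier_vec g \<Longrightarrow> A \<in> carrier_mat g q \<Longrightarrow> (a \<cdot>\<^sub>v v) \<star> A = a \<cdot>\<^sub>v (v \<star> A)"
  by (intro eq_vecI) (simp_all add: row_mult_index[of _ g A q] sum_distrib_left mult.assoc)

lemma row_mult_diff:
  "v \<in> carrier_vec g \<Longrightarrow> w \<in> carrier_vec g \<Longrightarrow> A \<in> carrier_mat g q \<Longrightarrow> (v - w) \<star> A = v \<star> A - w \<star> A"
  unfolding row_mult_def by (rule mult_minus_distrib_mat_vec) auto

lemma row_mult_uminus:
  "v \<in> carrier_vec g \<Longrightarrow> A \<in> carrier_mat g q \<Longrightarrow> (- v) \<star> A = - (v \<star> A)"
  by (intro eq_vecI) (simp_all add: row_mult_index[of _ g A q] sum_negf)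

lemma row_mult_assoc:
  "v \<in> carrier_vec g \<Longrightarrow> A \<in> carrier_mat g n \<Longrightarrow> B \<in> carrier_mat n q \<Longrightarrow> v \<star> (A * B) = v \<star> A \<star> B"
  unfolding row_mult_def by (subst transpose_mult) (auto intro!: assoc_mult_mat_vec)

lemma row_mult_add_mat:
  "v \<in> carrier_vec g \<Longrightarrow> A \<in> carrier_mat g q \<Longrightarrow> B \<in> carrier_mat g q \<Longrightarrow> v \<star> (A + B) = v \<star> A + v \<star> B"
  unfolding row_mult_def by (subst transpose_add) (auto intro!: add_mult_distrib_mat_vec)

lemma row_mult_zero [simp]: "A \<in> carrier_mat g q \<Longrightarrow> 0\<^sub>v g \<star> A = 0\<^sub>v q"
  by (intro eq_vecI) (auto simp: row_mult_def)

lemma row_mult_zero_mat [simp]: "v \<in> carrier_vec g \<Longrightarrow> v \<star> 0\<^sub>m g q = 0\<^sub>v q"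
  by (intro eq_vecI) (auto simp: row_mult_index[of _ g "0\<^sub>m g q" q])

lemma row_mult_one [simp]: "v \<in> carrier_vec g \<Longrightarrow> v \<star> 1\<^sub>m g = v"
  by (simp add: row_mult_def)

lemma row_mult_unit: "A \<in> carrier_mat g q \<Longrightarrow> i < g \<Longrightarrow> unit_vec g i \<star> A = row A i"
  by (intro eq_vecI) (auto simp: row_mult_def)

lemma append_rows_index:
  assumes "A \<in> carrier_mat n q" "B \<in> carrier_mat m q" "i < n + m" "j < q"
  shows "(A @\<^sub>r B) $$ (i, j) = (if i < n then A $$ (i, j) else B $$ (i - n, j))"
  using assms by (auto simp: append_rows_def)

lemma append_cols_index:
  assumes "A \<in> carrier_mat g n" "B \<in> carrier_mat g m" "i < g" "j < n + m"
  shows "(A @\<^sub>c B) $$ (i, j) = (if j < n then A $$ (i, j) else B $$ (i, j - n))"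
  using assms by (auto simp: append_cols_def)

lemma append_cols_carrier [simp, intro]:
  "A \<in> carrier_mat g n \<Longrightarrow> B \<in> carrier_mat g m \<Longrightarrow> A @\<^sub>c B \<in> carrier_mat g (n + m)"
  unfolding append_cols_def carrier_mat_def by auto

lemma row_mult_append_rows:
  assumes "A \<in> carrier_mat n q" "B \<in> carrier_mat m q" "v \<in> carrier_vec n" "w \<in> carrier_vec m"
  shows "(v @\<^sub>v w) \<star> (A @\<^sub>r B) = v \<star> A + w \<star> B"
proof (rule eq_vecI)
  have AB: "A @\<^sub>r B \<in> carrier_mat (n + m) q" using assms by auto
  show "dim_vec ((v @\<^sub>v w) \<star> (A @\<^sub>r B)) = dim_vec (v \<star> A + w \<star> B)" using assms carrier_matD(2)[OF AB] by simp
  fix j assume "j < dim_vec (v \<star> A + w \<star> B)"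
  then have j: "j < q" using assms by simp
  have "((v @\<^sub>v w) \<star> (A @\<^sub>r B)) $ j = (\<Sum>i<n + m. (v @\<^sub>v w) $ i * (A @\<^sub>r B) $$ (i, j))"
    by (rule row_mult_index[OF _ AB j]) (use assms in auto)
  also have "\<dots> = (\<Sum>i<n. v $ i * A $$ (i, j)) + (\<Sum>i<m. w $ i * B $$ (i, j))"
    unfolding lessThan_atLeast0
    by (subst sum.atLeastLessThan_concat[of 0 n "n + m", symmetric], simp, simp)
      (use assms j in \<open>simp add: append_rows_index sum.atLeastLessThan_shift_0[of _ n]
        atLeast0LessThan comp_def\<close>)
  finally show "((v @\<^sub>v w) \<star> (A @\<^sub>r B)) $ j = (v \<star> A + w \<star> B) $ j"
    using assms j row_mult_index[OF assms(3,1) j] row_mult_index[OF assms(4,2) j] by simp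
qed

lemma row_mult_append_cols:
  assumes "A \<in> carrier_mat g n" "B \<in> carrier_mat g m" "v \<in> carrier_vec g"
  shows "v \<star> (A @\<^sub>c B) = v \<star> A @\<^sub>v v \<star> B"
proof (rule eq_vecI)
  have AB: "A @\<^sub>c B \<in> carrier_mat g (n + m)" using assms by auto
  show "dim_vec (v \<star> (A @\<^sub>c B)) = dim_vec (v \<star> A @\<^sub>v v \<star> B)" using assms carrier_matD(2)[OF AB] by simp
  fix j assume "j < dim_vec (v \<star> A @\<^sub>v v \<star> B)"
  then have j: "j < n + m" using assms by simp
  show "(v \<star> (A @\<^sub>c B)) $ j = (v \<star> A @\<^sub>v v \<star> B) $ j"
    unfolding row_mult_index[OF assms(3) AB j]
    using assms j row_mult_index[OF assms(3,1)] row_mult_index[OF assms(3,2)]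
    by (auto simp: append_cols_index)
qed

lemma append_vec_zero_iff:
  assumes "v \<in> carrier_vec n"
  shows "v @\<^sub>v w = 0\<^sub>v (n + m) \<longleftrightarrow> v = 0\<^sub>v n \<and> w = 0\<^sub>v m"
proof -
  have "0\<^sub>v (n + m) = 0\<^sub>v n @\<^sub>v 0\<^sub>v m" by (intro eq_vecI) auto
  then show ?thesis using append_vec_eq[OF assms, of "0\<^sub>v n" w "0\<^sub>v m"] by auto
qed

lemma vec_split:
  assumes "v \<in> carrier_vec (n + m)"
  obtains v1 v2 where "v1 \<in> carrier_vec n" "v2 \<in> carrier_vec m" "v = v1 @\<^sub>v v2"
  by (rule that[of "vec_first v n" "vec_last v m"]) (use vec_first_last_append[OF assms] in auto)

lemma mat_of_row_carrier_mat [simp, intro]: "l \<in> carrier_vec q \<Longrightarrow> mat_of_row l \<in> carrier_mat 1 q"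
  by (auto simp: mat_of_row_def)

lemma row_mult_mat_of_row:
  assumes "l \<in> carrier_vec q" "w \<in> carrier_vec 1"
  shows "w \<star> mat_of_row l = w $ 0 \<cdot>\<^sub>v l"
  by (rule eq_vecI) (use assms row_mult_index[OF assms(2) mat_of_row_carrier_mat[OF assms(1)]] in
    \<open>auto simp: mat_of_row_def\<close>)

lemma row_spanI: "v \<in> carrier_vec g \<Longrightarrow> A \<in> carrier_mat g q \<Longrightarrow> v \<star> A \<in> row_span A"
  unfolding row_span_def by auto

lemma row_spanE:
  assumes "r \<in> row_span A" "A \<in> carrier_mat g q"
  obtains v where "v \<in> carrier_vec g" "r = v \<star> A"
  using assms unfolding row_span_def by auto

lemma indep_rowsD:
  "indep_rows A \<Longrightarrow> A \<in> carrier_mat g q \<Longrightarrow> v \<in> carrier_vec g \<Longrightarrow> v \<star> A = 0\<^sub>v q \<Longrightarrow> v = 0\<^sub>v g"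
  unfolding indep_rows_def by auto

lemma indep_rowsI:
  assumes "A \<in> carrier_mat g q" "\<And>v. v \<in> carrier_vec g \<Longrightarrow> v \<star> A = 0\<^sub>v q \<Longrightarrow> v = 0\<^sub>v g"
  shows "indep_rows A"
  using assms unfolding indep_rows_def by auto

lemma rows_in_span_factor:
  assumes "L \<in> carrier_mat r q" "K \<in> carrier_mat g q"
    and "\<And>i. i < r \<Longrightarrow> row L i \<in> row_span K"
  obtains F where "F \<in> carrier_mat r g" "L = F * K"
proof -
  have "\<exists>v. v \<in> carrier_vec g \<and> row L i = v \<star> K" if "i < r" for i
    using assms(3)[OF that] assms(2) by (elim row_spanE) auto
  then obtain f where f: "\<And>i. i < r \<Longrightarrow> f i \<in> carrier_vec g \<and> row L i = f i \<star> K" by metis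
  define F where "F = mat r g (\<lambda>(i, j). f i $ j)"
  have F: "F \<in> carrier_mat r g" by (simp add: F_def)
  moreover have "L = F * K"
  proof (rule eq_rowI)
    fix i assume "i < dim_row (F * K)"
    then have i: "i < r" using F by simp
    have "row F i = f i" using f[OF i] i by (intro eq_vecI) (auto simp: F_def)
    then have "unit_vec r i \<star> (F * K) = row L i"
      using f i F assms(2) by (simp add: row_mult_assoc[OF _ F assms(2)] row_mult_unit[OF F])
    then show "row L i = row (F * K) i"
      using row_mult_unit[of "F * K" r q i] F assms(2) i by simp
  qed (use F assms in auto)
  ultimately show ?thesis by (rule that)
qed

lemma row_in_row_span: "L \<in> carrier_mat r q \<Longrightarrow> i < r \<Longrightarrow> row L i \<in> row_span L"
  using row_spanI[of "unit_vec r i" r L q] by (simp add: row_mult_unit)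

lemma row_span_subset_factor:
  assumes "L \<in> carrier_mat r q" "K \<in> carrier_mat g q" "row_span L \<subseteq> row_span K"
  obtains F where "F \<in> carrier_mat r g" "L = F * K"
  using rows_in_span_factor[OF assms(1,2)] row_in_row_span[OF assms(1)] assms(3) by blast

section \<open>Submodules of free modules over the polynomials\<close>

definition submodule_of :: "nat \<Rightarrow> 'a :: comm_ring_1 vec set \<Rightarrow> bool" where
  "submodule_of q N \<longleftrightarrow> N \<subseteq> carrier_vec q \<and> 0\<^sub>v q \<in> N \<and>
     (\<forall>v\<in>N. \<forall>w\<in>N. v + w \<in> N) \<and> (\<forall>a. \<forall>v\<in>N. a \<cdot>\<^sub>v v \<in> N)"

lemma submodule_ofI:
  "N \<subseteq> carrier_vec q \<Longrightarrow> 0\<^sub>v q \<in> N \<Longrightarrow> (\<And>v w. v \<in> N \<Longrightarrow> w \<in> N \<Longrightarrow> v + w \<in> N) \<Longrightarrow>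
   (\<And>a v. v \<in> N \<Longrightarrow> a \<cdot>\<^sub>v v \<in> N) \<Longrightarrow> submodule_of q N"
  by (simp add: submodule_of_def)

lemma submodule_row_span:
  assumes A: "A \<in> carrier_mat g q"
  shows "submodule_of q (row_span A)"
proof (rule submodule_ofI)
  show "row_span A \<subseteq> carrier_vec q" using A by (auto simp: row_span_def)
  show "0\<^sub>v q \<in> row_span A" using row_spanI[of "0\<^sub>v g" g A q] A by simp
  fix v assume "v \<in> row_span A"
  then obtain v' where v: "v' \<in> carrier_vec g" "v = v' \<star> A" using A by (elim row_spanE)
  show "a \<cdot>\<^sub>v v \<in> row_span A" for a
    using row_spanI[of "a \<cdot>\<^sub>v v'" g A q] v A by (simp add: row_mult_smult[OF _ A])
  fix w assume "w \<in> row_span A"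
  then obtain w' where w: "w' \<in> carrier_vec g" "w = w' \<star> A" using A by (elim row_spanE)
  show "v + w \<in> row_span A"
    using row_spanI[of "v' + w'" g A q] v w A by (simp add: row_mult_add[OF _ _ A])
qed

lemma submodule_Int: "submodule_of q N \<Longrightarrow> submodule_of q N' \<Longrightarrow> submodule_of q (N \<inter> N')"
  by (auto simp: submodule_of_def)

lemma poly_ideal_generator:
  fixes I :: "real poly set"
  assumes "0 \<in> I" "\<And>a b. a \<in> I \<Longrightarrow> b \<in> I \<Longrightarrow> a + b \<in> I" "\<And>a c. a \<in> I \<Longrightarrow> c * a \<in> I"
  obtains d where "d \<in> I" "\<And>a. a \<in> I \<Longrightarrow> d dvd a"
proof (cases "I \<subseteq> {0}")
  case True
  then show ?thesis using that assms(1) by auto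
next
  case False
  then have "\<exists>d. d \<in> I - {0}" by auto
  then obtain d where d: "d \<in> I" "d \<noteq> 0" and m: "\<And>a. a \<in> I \<Longrightarrow> a \<noteq> 0 \<Longrightarrow> degree d \<le> degree a"
    using arg_min_nat_lemma[of "\<lambda>d. d \<in> I - {0}" _ degree] by (metis DiffD1 DiffD2 DiffI singletonD singletonI)
  have "d dvd a" if "a \<in> I" for a
  proof -
    have "a mod d = a + (- (a div d)) * d" by (simp add: minus_div_mult_eq_mod[symmetric])
    then have "a mod d \<in> I" using assms d that by metis
    then have "a mod d = 0" using m[of "a mod d"] degree_mod_less'[OF d(2), of a] by force
    then show ?thesis by (simp add: dvd_eq_mod_eq_0)
  qed
  then show ?thesis using that d by blast
qed

text \<open>The values of one coordinate on a submodule form an ideal, which is principal.\<close>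

lemma submodule_coordinate_generator:
  fixes N :: "real poly vec set"
  assumes N: "submodule_of q N" and k: "k < q"
  obtains v where "v \<in> N" "\<And>w. w \<in> N \<Longrightarrow> v $ k dvd w $ k"
proof -
  have sub: "N \<subseteq> carrier_vec q" using N by (simp add: submodule_of_def)
  have "\<exists>d. d \<in> (\<lambda>v. v $ k) ` N \<and> (\<forall>a \<in> (\<lambda>v. v $ k) ` N. d dvd a)"
  proof (rule poly_ideal_generator[of "(\<lambda>v. v $ k) ` N"])
    show "0 \<in> (\<lambda>v. v $ k) ` N" using N k by (intro image_eqI[of _ _ "0\<^sub>v q"]) (auto simp: submodule_of_def)
    fix a assume "a \<in> (\<lambda>v. v $ k) ` N"
    then obtain v where v: "v \<in> N" "a = v $ k" by blast
    show "c * a \<in> (\<lambda>v. v $ k) ` N" for c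
      by (rule image_eqI[of _ _ "c \<cdot>\<^sub>v v"]) (use N k v sub in \<open>auto simp: submodule_of_def\<close>)
    fix b assume "b \<in> (\<lambda>v. v $ k) ` N"
    then obtain w where w: "w \<in> N" "b = w $ k" by blast
    show "a + b \<in> (\<lambda>v. v $ k) ` N"
      by (rule image_eqI[of _ _ "v + w"]) (use N k v w sub in \<open>auto simp: submodule_of_def\<close>)
  qed blast
  then show ?thesis using that by blast
qed

text \<open>The hypothesis \<open>no\<close> is independence over the field of fractions, with denominators cleared.\<close>

lemma indep_rows_append_row:
  fixes L :: "'a :: idom mat"
  assumes L: "L \<in> carrier_mat r q" and l: "l \<in> carrier_vec q" and ind: "indep_rows L"
    and no: "\<And>a. a \<cdot>\<^sub>v l \<in> row_span L \<Longrightarrow> a = 0"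
  shows "indep_rows (L @\<^sub>r mat_of_row l)"
proof (rule indep_rowsI[of _ "r + 1" q])
  show "L @\<^sub>r mat_of_row l \<in> carrier_mat (r + 1) q"
    by (rule carrier_append_rows[OF L mat_of_row_carrier_mat[OF l]])
  fix v assume "v \<in> carrier_vec (r + 1)" and 0: "v \<star> (L @\<^sub>r mat_of_row l) = 0\<^sub>v q"
  then obtain v1 v2 where v: "v1 \<in> carrier_vec r" "v2 \<in> carrier_vec 1" "v = v1 @\<^sub>v v2"
    by (elim vec_split)
  have "v1 \<star> L + v2 $ 0 \<cdot>\<^sub>v l = 0\<^sub>v q"
    using 0 v L l by (simp add: row_mult_append_rows[of _ r q _ 1] row_mult_mat_of_row)
  then have "(v1 \<star> L + v2 $ 0 \<cdot>\<^sub>v l) $ j = 0" if "j < q" for j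
    using that by (simp only: index_zero_vec)
  then have e: "(v1 \<star> L) $ j + v2 $ 0 * l $ j = 0" if "j < q" for j
    using that l by simp
  have "v2 $ 0 \<cdot>\<^sub>v l = - (v1 \<star> L)"
    by (intro eq_vecI) (use e L l in \<open>simp_all add: eq_neg_iff_add_eq_0 add.commute\<close>)
  also have "\<dots> = (- v1) \<star> L" using L v by (simp add: row_mult_uminus)
  finally have z: "v2 $ 0 = 0" using no row_spanI[of "- v1" r L q] L v by simp
  then have "v2 = 0\<^sub>v 1" using v(2) by (intro eq_vecI) auto
  moreover have "v1 \<star> L = 0\<^sub>v q" by (intro eq_vecI) (use e z L in auto)
  then have "v1 = 0\<^sub>v r" by (rule indep_rowsD[OF ind L v(1)])
  ultimately show "v = 0\<^sub>v (r + 1)" using v append_vec_zero_iff[OF v(1), of v2 1] by blast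
qed

lemma row_span_append_row_iff:
  assumes L: "L \<in> carrier_mat r q" and l: "l \<in> carrier_vec q"
  shows "v \<in> row_span (L @\<^sub>r mat_of_row l) \<longleftrightarrow> (\<exists>u\<in>row_span L. \<exists>a. v = u + a \<cdot>\<^sub>v l)"
proof
  have LL: "L @\<^sub>r mat_of_row l \<in> carrier_mat (r + 1) q"
    by (rule carrier_append_rows[OF L mat_of_row_carrier_mat[OF l]])
  assume "v \<in> row_span (L @\<^sub>r mat_of_row l)"
  then obtain w where w: "w \<in> carrier_vec (r + 1)" "v = w \<star> (L @\<^sub>r mat_of_row l)"
    using LL by (elim row_spanE)
  from w(1) obtain w1 w2 where "w1 \<in> carrier_vec r" "w2 \<in> carrier_vec 1" "w = w1 @\<^sub>v w2"
    by (elim vec_split)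
  then show "\<exists>u\<in>row_span L. \<exists>a. v = u + a \<cdot>\<^sub>v l"
    using w L l by (auto simp: row_mult_append_rows[of _ r q _ 1] row_mult_mat_of_row intro!: bexI[of _ "w1 \<star> L"] row_spanI)
next
  have LL: "L @\<^sub>r mat_of_row l \<in> carrier_mat (r + 1) q"
    by (rule carrier_append_rows[OF L mat_of_row_carrier_mat[OF l]])
  assume "\<exists>u\<in>row_span L. \<exists>a. v = u + a \<cdot>\<^sub>v l"
  then obtain w a where w: "w \<in> carrier_vec r" "v = w \<star> L + a \<cdot>\<^sub>v l"
    using L by (auto elim!: row_spanE)
  then have "v = (w @\<^sub>v vec 1 (\<lambda>_. a)) \<star> (L @\<^sub>r mat_of_row l)"
    using L l by (simp add: row_mult_append_rows[of _ r q _ 1] row_mult_mat_of_row)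
  then show "v \<in> row_span (L @\<^sub>r mat_of_row l)"
    using row_spanI[OF append_carrier_vec[OF w(1), of "vec 1 (\<lambda>_. a)" 1] LL] by simp
qed

text \<open>Echelon form by induction on the number \<open>k\<close> of coordinates that may be nonzero: the submodule
for \<open>k + 1\<close> is spanned by the one for \<open>k\<close> and a single vector whose coordinate \<open>k\<close> generates the
ideal of all coordinates \<open>k\<close>.\<close>

theorem submodule_has_basis:
  fixes N :: "real poly vec set"
  assumes N: "submodule_of q N"
  obtains r L where "L \<in> carrier_mat r q" "indep_rows L" "row_span L = N"
proof -
  have sub: "N \<subseteq> carrier_vec q" using N by (simp add: submodule_of_def)
  define Nk where "Nk k = {v \<in> N. \<forall>j. k \<le> j \<and> j < q \<longrightarrow> v $ j = 0}" for k
  have Nk: "submodule_of q (Nk k)" for k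
    using N sub unfolding submodule_of_def Nk_def by (auto simp: subset_iff)
  have "\<exists>r L. L \<in> carrier_mat r q \<and> indep_rows L \<and> row_span L = Nk k" if "k \<le> q" for k
    using that
  proof (induction k)
    case 0
    have "Nk 0 = {0\<^sub>v q}"
    proof (intro equalityI subsetI)
      fix v assume "v \<in> Nk 0"
      then show "v \<in> {0\<^sub>v q}" using sub by (auto simp: Nk_def intro!: eq_vecI)
    qed (use N in \<open>auto simp: Nk_def submodule_of_def\<close>)
    moreover have "row_span (0\<^sub>m 0 q :: real poly mat) = {0\<^sub>v q}"
      by (auto simp: row_span_def intro!: exI[of _ "0\<^sub>v 0"])
    moreover have "indep_rows (0\<^sub>m 0 q :: real poly mat)"
      by (rule indep_rowsI[of _ 0 q]) (auto intro: eq_vecI)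
    ultimately show ?case by (intro exI[of _ 0] exI[of _ "0\<^sub>m 0 q"]) simp
  next
    case (Suc k)
    then obtain r L where L: "L \<in> carrier_mat r q" "indep_rows L" "row_span L = Nk k" by auto
    obtain v where v: "v \<in> Nk (Suc k)" and gen: "\<And>w. w \<in> Nk (Suc k) \<Longrightarrow> v $ k dvd w $ k"
      using submodule_coordinate_generator[OF Nk] Suc.prems by (metis Suc_le_lessD)
    have vq: "v \<in> carrier_vec q" using v sub by (auto simp: Nk_def)
    have step: "w \<in> Nk k" if "w \<in> Nk (Suc k)" "w $ k = 0" for w
      using that by (auto simp: Nk_def) (metis le_neq_implies_less Suc_leI)
    show ?case
    proof (cases "v $ k = 0")
      case True
      then have "Nk (Suc k) = Nk k" using gen step by (auto simp: Nk_def)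
      then show ?thesis using L by blast
    next
      case False
      have "indep_rows (L @\<^sub>r mat_of_row v)"
      proof (rule indep_rows_append_row[OF L(1) vq L(2)])
        fix a assume "a \<cdot>\<^sub>v v \<in> row_span L"
        then have "(a \<cdot>\<^sub>v v) $ k = 0" using L(3) Suc.prems by (simp add: Nk_def)
        then show "a = 0" using False vq Suc.prems by simp
      qed
      moreover have "row_span (L @\<^sub>r mat_of_row v) = Nk (Suc k)"
      proof (intro equalityI subsetI)
        fix w assume "w \<in> row_span (L @\<^sub>r mat_of_row v)"
        then obtain u a where u: "u \<in> Nk k" "w = u + a \<cdot>\<^sub>v v"
          using row_span_append_row_iff[OF L(1) vq] L(3) by blast
        have "u \<in> Nk (Suc k)" using u by (auto simp: Nk_def)
        then show "w \<in> Nk (Suc k)" using u v Nk[of "Suc k"] by (auto simp: submodule_of_def)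
      next
        fix w assume w: "w \<in> Nk (Suc k)"
        then have wq: "w \<in> carrier_vec q" using sub by (auto simp: Nk_def)
        obtain b where b: "w $ k = v $ k * b" using gen[OF w] by (elim dvdE)
        have "w + (- b) \<cdot>\<^sub>v v \<in> Nk (Suc k)"
          using v w Nk[of "Suc k"] unfolding submodule_of_def by blast
        moreover have "(w + (- b) \<cdot>\<^sub>v v) $ k = 0" using b wq vq Suc.prems by simp
        ultimately have "w + (- b) \<cdot>\<^sub>v v \<in> row_span L" using step L(3) by blast
        moreover have "w = (w + (- b) \<cdot>\<^sub>v v) + b \<cdot>\<^sub>v v"
          by (rule eq_vecI) (use wq vq in auto)
        ultimately show "w \<in> row_span (L @\<^sub>r mat_of_row v)"
          using row_span_append_row_iff[OF L(1) vq] by blast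
      qed
      moreover have "L @\<^sub>r mat_of_row v \<in> carrier_mat (r + 1) q"
        by (rule carrier_append_rows[OF L(1) mat_of_row_carrier_mat[OF vq]])
      ultimately show ?thesis by blast
    qed
  qed
  from this[of q] show ?thesis using that by (auto simp: Nk_def)
qed

section \<open>Differential operators acting on signals\<close>

lemma signalsD:
  assumes "x \<in> signals q"
  shows "x t \<in> carrier_vec q" "dim_vec (x t) = q" "j < q \<Longrightarrow> smooth (\<lambda>t. x t $ j)"
  using assms by (auto simp: signals_def carrier_vecD)

lemma signalsI:
  "(\<And>t. x t \<in> carrier_vec q) \<Longrightarrow> (\<And>j. j < q \<Longrightarrow> smooth (\<lambda>t. x t $ j)) \<Longrightarrow> x \<in> signals q"
  by (simp add: signals_def)

lemma zero_signal: "(\<lambda>t. 0\<^sub>v q) \<in> signals q"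
  by (rule signalsI) (simp_all add: smooth_zero)

lemma add_signals:
  assumes "x \<in> signals q" "z \<in> signals q" shows "(\<lambda>t. x t + z t) \<in> signals q"
proof (rule signalsI)
  fix j assume "j < q"
  then show "smooth (\<lambda>t. (x t + z t) $ j)"
    using smooth_add[of "\<lambda>t. x t $ j" "\<lambda>t. z t $ j"] assms by (simp add: signalsD)
qed (intro add_carrier_vec signalsD(1)[OF assms(1)] signalsD(1)[OF assms(2)])

lemma uminus_signals:
  assumes "x \<in> signals q" shows "(\<lambda>t. - x t) \<in> signals q"
proof (rule signalsI)
  fix j assume "j < q"
  then show "smooth (\<lambda>t. (- x t) $ j)"
    using smooth_uminus[of "\<lambda>t. x t $ j"] assms by (simp add: signalsD)
qed (use assms in \<open>auto dest: signalsD\<close>)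

lemma diff_signals:
  assumes "x \<in> signals q" "z \<in> signals q" shows "(\<lambda>t. x t - z t) \<in> signals q"
proof -
  have "(\<lambda>t. x t - z t) = (\<lambda>t. x t + - z t)" using assms
    by (intro ext eq_vecI) (auto simp: signalsD)
  then show ?thesis using add_signals[OF assms(1) uminus_signals[OF assms(2)]] by simp
qed

lemma stack_signals:
  assumes "x \<in> signals n" "z \<in> signals m" shows "x \<oplus>\<^sub>s z \<in> signals (n + m)"
proof (rule signalsI)
  fix j assume "j < n + m"
  then show "smooth (\<lambda>t. (x \<oplus>\<^sub>s z) t $ j)"
    using assms signalsD(3)[OF assms(1), of j] signalsD(3)[OF assms(2), of "j - n"]
    by (cases "j < n") (simp_all add: stack_def signalsD)
qed (use assms in \<open>auto simp: stack_def dest: signalsD\<close>)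

lemma signals_split:
  assumes "x \<in> signals (n + m)"
  obtains u v where "u \<in> signals n" "v \<in> signals m" "x = u \<oplus>\<^sub>s v"
proof (rule that[of "\<lambda>t. vec n (\<lambda>j. x t $ j)" "\<lambda>t. vec m (\<lambda>j. x t $ (n + j))"])
  show "(\<lambda>t. vec n (\<lambda>j. x t $ j)) \<in> signals n" "(\<lambda>t. vec m (\<lambda>j. x t $ (n + j))) \<in> signals m"
    using assms by (auto simp: signals_def)
  show "x = (\<lambda>t. vec n (\<lambda>j. x t $ j)) \<oplus>\<^sub>s (\<lambda>t. vec m (\<lambda>j. x t $ (n + j)))"
    using assms by (intro ext eq_vecI) (auto simp: stack_def signalsD)
qed

text \<open>The pairing of a row vector with a signal, that is, the scalar equation given by one row.\<close>

definition row_ddt :: "real poly vec \<Rightarrow> signal \<Rightarrow> real \<Rightarrow> real" where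
  "row_ddt r x t = (\<Sum>j<dim_vec r. poly_ddt (r $ j) (\<lambda>s. x s $ j) t)"

lemma smooth_row_ddt: "r \<in> carrier_vec q \<Longrightarrow> x \<in> signals q \<Longrightarrow> smooth (row_ddt r x)"
  unfolding row_ddt_def[abs_def] by (intro smooth_sum smooth_poly_ddt) (auto simp: signalsD)

lemma row_ddt_add:
  "r \<in> carrier_vec q \<Longrightarrow> r' \<in> carrier_vec q \<Longrightarrow> row_ddt (r + r') x = (\<lambda>t. row_ddt r x t + row_ddt r' x t)"
  by (simp add: row_ddt_def fun_eq_iff poly_ddt_add sum.distrib)

lemma row_ddt_smult:
  "r \<in> carrier_vec q \<Longrightarrow> x \<in> signals q \<Longrightarrow> row_ddt (a \<cdot>\<^sub>v r) x = poly_ddt a (row_ddt r x)"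
  unfolding row_ddt_def[abs_def]
  by (subst poly_ddt_fun_sum) (simp_all add: poly_ddt_mult signalsD smooth_poly_ddt)

lemma row_ddt_zero [simp]: "row_ddt (0\<^sub>v q) x = (\<lambda>t. 0)"
  by (simp add: row_ddt_def fun_eq_iff)

lemma row_ddt_zero_signal [simp]: "r \<in> carrier_vec q \<Longrightarrow> row_ddt r (\<lambda>t. 0\<^sub>v q) = (\<lambda>t. 0)"
  by (simp add: row_ddt_def fun_eq_iff)

lemma row_ddt_add_signal:
  assumes "r \<in> carrier_vec q" "x \<in> signals q" "z \<in> signals q"
  shows "row_ddt r (\<lambda>t. x t + z t) = (\<lambda>t. row_ddt r x t + row_ddt r z t)"
  using assms by (simp add: row_ddt_def fun_eq_iff signalsD poly_ddt_fun_add sum.distrib)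

lemma row_ddt_uminus_signal:
  assumes "r \<in> carrier_vec q" "x \<in> signals q"
  shows "row_ddt r (\<lambda>t. - x t) = (\<lambda>t. - row_ddt r x t)"
  using assms by (simp add: row_ddt_def fun_eq_iff signalsD poly_ddt_fun_uminus sum_negf)

lemma row_ddt_diff_signal:
  assumes "r \<in> carrier_vec q" "x \<in> signals q" "z \<in> signals q"
  shows "row_ddt r (\<lambda>t. x t - z t) = (\<lambda>t. row_ddt r x t - row_ddt r z t)"
proof -
  have "(\<lambda>t. x t - z t) = (\<lambda>t. x t + - z t)" using assms
    by (intro ext eq_vecI) (auto simp: signalsD)
  then show ?thesis using assms uminus_signals[of z q]
    by (simp add: row_ddt_add_signal row_ddt_uminus_signal)
qed

lemma row_ddt_stack:
  assumes "r \<in> carrier_vec n" "r' \<in> carrier_vec m" "x \<in> signals n" "z \<in> signals m"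
  shows "row_ddt (r @\<^sub>v r') (x \<oplus>\<^sub>s z) = (\<lambda>t. row_ddt r x t + row_ddt r' z t)"
proof
  fix t
  have "row_ddt (r @\<^sub>v r') (x \<oplus>\<^sub>s z) t
      = (\<Sum>j<n + m. poly_ddt ((r @\<^sub>v r') $ j) (\<lambda>s. (x \<oplus>\<^sub>s z) s $ j) t)"
    using assms by (simp add: row_ddt_def)
  also have "\<dots> = (\<Sum>j<n. poly_ddt (r $ j) (\<lambda>s. x s $ j) t) + (\<Sum>j<m. poly_ddt (r' $ j) (\<lambda>s. z s $ j) t)"
    unfolding lessThan_atLeast0
    by (subst sum.atLeastLessThan_concat[of 0 n "n + m", symmetric], simp, simp)
      (use assms in \<open>simp add: sum.atLeastLessThan_shift_0[of _ n] atLeast0LessThan comp_def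
        stack_def signalsD\<close>)
  finally show "row_ddt (r @\<^sub>v r') (x \<oplus>\<^sub>s z) t = row_ddt r x t + row_ddt r' z t"
    using assms by (simp add: row_ddt_def)
qed

lemma unit_signal:
  assumes "smooth z" "k < q"
  shows "(\<lambda>t. z t \<cdot>\<^sub>v unit_vec q k) \<in> signals q"
    and "r \<in> carrier_vec q \<Longrightarrow> row_ddt r (\<lambda>t. z t \<cdot>\<^sub>v unit_vec q k) = poly_ddt (r $ k) z"
proof -
  have c: "(\<lambda>t. (z t \<cdot>\<^sub>v unit_vec q k) $ j) = (if j = k then z else (\<lambda>t. 0))" if "j < q" for j
    using that assms(2) by (auto simp: fun_eq_iff)
  then show "(\<lambda>t. z t \<cdot>\<^sub>v unit_vec q k) \<in> signals q"
    using assms by (intro signalsI) (auto simp: smooth_zero)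
  assume r: "r \<in> carrier_vec q"
  show "row_ddt r (\<lambda>t. z t \<cdot>\<^sub>v unit_vec q k) = poly_ddt (r $ k) z"
  proof
    fix t
    have "row_ddt r (\<lambda>t. z t \<cdot>\<^sub>v unit_vec q k) t = (\<Sum>j<q. if j = k then poly_ddt (r $ k) z t else 0)"
      unfolding row_ddt_def carrier_vecD[OF r] by (rule sum.cong) (simp_all only: lessThan_iff, auto simp only: c poly_ddt_fun_zero split: if_splits)
    then show "row_ddt r (\<lambda>t. z t \<cdot>\<^sub>v unit_vec q k) t = poly_ddt (r $ k) z t" using assms(2) by simp
  qed
qed

lemma row_ddt_unit: "i < q \<Longrightarrow> row_ddt (unit_vec q i) x = (\<lambda>t. x t $ i)"
proof
  fix t assume i: "i < q"
  have "row_ddt (unit_vec q i) x t = (\<Sum>j<q. if j = i then x t $ i else 0)"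
    unfolding row_ddt_def using i by (intro sum.cong) auto
  then show "row_ddt (unit_vec q i) x t = x t $ i" using i by simp
qed

lemma mat_ddt_index: "i < dim_row A \<Longrightarrow> mat_ddt A x t $ i = row_ddt (row A i) x t"
  by (simp add: mat_ddt_def row_ddt_def)

lemma mat_ddt_signals:
  assumes "A \<in> carrier_mat g q" "x \<in> signals q"
  shows "mat_ddt A x \<in> signals g"
proof (rule signalsI)
  fix j assume "j < g"
  then show "smooth (\<lambda>t. mat_ddt A x t $ j)"
    using assms smooth_row_ddt[of "row A j" q x] by (simp add: mat_ddt_index)
qed (use assms in \<open>simp add: mat_ddt_def carrier_vecI\<close>)

lemma row_ddt_lincomb:
  assumes "finite I" "\<And>i. i \<in> I \<Longrightarrow> r i \<in> carrier_vec q" "x \<in> signals q" "l \<in> carrier_vec q"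
    and "\<And>j. j < q \<Longrightarrow> l $ j = (\<Sum>i\<in>I. w i * r i $ j)"
  shows "row_ddt l x = (\<lambda>t. \<Sum>i\<in>I. poly_ddt (w i) (row_ddt (r i) x) t)"
proof
  fix t
  have "poly_ddt (w i) (row_ddt (r i) x) t = (\<Sum>j<q. poly_ddt (w i * r i $ j) (\<lambda>s. x s $ j) t)"
    if "i \<in> I" for i
    using assms(2)[OF that] assms(3) row_ddt_smult[of "r i" q x "w i"]
    by (simp add: row_ddt_def fun_eq_iff)
  then have "(\<Sum>i\<in>I. poly_ddt (w i) (row_ddt (r i) x) t)
      = (\<Sum>j<q. \<Sum>i\<in>I. poly_ddt (w i * r i $ j) (\<lambda>s. x s $ j) t)"
    by (subst sum.swap) simp
  also have "\<dots> = row_ddt l x t"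
    using assms(4,5) by (simp add: row_ddt_def poly_ddt_sum)
  finally show "row_ddt l x t = (\<Sum>i\<in>I. poly_ddt (w i) (row_ddt (r i) x) t)" ..
qed

lemma row_ddt_mat_ddt:
  assumes "A \<in> carrier_mat g q" "x \<in> signals q" "w \<in> carrier_vec g"
  shows "row_ddt w (mat_ddt A x) = row_ddt (w \<star> A) x"
proof -
  have "row_ddt (w \<star> A) x = (\<lambda>t. \<Sum>i<g. poly_ddt (w $ i) (row_ddt (row A i) x) t)"
    by (rule row_ddt_lincomb) (use assms in \<open>auto simp: row_mult_index[of _ g A q]\<close>)
  moreover have e: "(\<lambda>s. mat_ddt A x s $ i) = row_ddt (row A i) x" if "i < g" for i
    using that assms by (simp add: mat_ddt_index)
  have "row_ddt w (mat_ddt A x) = (\<lambda>t. \<Sum>i<g. poly_ddt (w $ i) (row_ddt (row A i) x) t)"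
    unfolding row_ddt_def[of w, abs_def] carrier_vecD[OF assms(3)]
    by (intro ext sum.cong) (simp_all only: e lessThan_iff)
  ultimately show ?thesis by simp
qed

lemma signal_eqI:
  assumes "x \<in> signals q" "z \<in> signals q"
    and "\<And>i. i < q \<Longrightarrow> row_ddt (unit_vec q i) x = row_ddt (unit_vec q i) z"
  shows "x = z"
proof (intro ext eq_vecI)
  fix t i assume "i < dim_vec (z t)"
  then have "i < q" using assms by (simp add: signalsD)
  then show "x t $ i = z t $ i" using fun_cong[OF assms(3), of i t] by (simp add: row_ddt_unit)
qed (use assms in \<open>simp add: signalsD\<close>)

text \<open>The kernel depends on the row module only; this is why behaviors can be studied through
submodules of the free module of rows.\<close>

lemma mem_ker_ddt:
  assumes A: "A \<in> carrier_mat g q"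
  shows "x \<in> ker_ddt A \<longleftrightarrow> x \<in> signals q \<and> (\<forall>r\<in>row_span A. row_ddt r x = (\<lambda>t. 0))"
proof
  assume "x \<in> ker_ddt A"
  then have x: "x \<in> signals q" "mat_ddt A x = (\<lambda>t. 0\<^sub>v g)" using A by (auto simp: ker_ddt_def)
  then show "x \<in> signals q \<and> (\<forall>r\<in>row_span A. row_ddt r x = (\<lambda>t. 0))"
    using row_ddt_mat_ddt[OF A x(1)] A by (auto elim!: row_spanE)
next
  assume x: "x \<in> signals q \<and> (\<forall>r\<in>row_span A. row_ddt r x = (\<lambda>t. 0))"
  have "mat_ddt A x t = 0\<^sub>v g" for t
  proof (rule eq_vecI)
    fix i assume "i < dim_vec (0\<^sub>v g :: real vec)"
    then have i: "i < g" by simp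
    then have "row_ddt (row A i) x = (\<lambda>t. 0)" using x row_in_row_span[OF A i] by blast
    then show "mat_ddt A x t $ i = 0\<^sub>v g $ i" using i A by (simp add: mat_ddt_index)
  qed (use A in \<open>simp add: mat_ddt_def\<close>)
  then show "x \<in> ker_ddt A" using x A by (simp add: ker_ddt_def)
qed

lemma ker_ddt_signals: "x \<in> ker_ddt A \<Longrightarrow> x \<in> signals (dim_col A)"
  by (simp add: ker_ddt_def)

lemma ker_ddt_antimono:
  assumes "A \<in> carrier_mat g q" "B \<in> carrier_mat h q" "row_span B \<subseteq> row_span A"
  shows "ker_ddt A \<subseteq> ker_ddt B"
  using mem_ker_ddt[OF assms(1)] mem_ker_ddt[OF assms(2)] assms(3) by blast

lemma ker_ddt_row:
  assumes "A \<in> carrier_mat g q" "x \<in> ker_ddt A" "w \<in> carrier_vec g"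
  shows "row_ddt (w \<star> A) x = (\<lambda>t. 0)"
  using assms mem_ker_ddt[OF assms(1)] row_spanI[OF assms(3,1)] by blast

lemma ker_ddt_rowI:
  assumes "A \<in> carrier_mat g q" "x \<in> signals q"
    and "\<And>w. w \<in> carrier_vec g \<Longrightarrow> row_ddt (w \<star> A) x = (\<lambda>t. 0)"
  shows "x \<in> ker_ddt A"
  using assms mem_ker_ddt[OF assms(1)] by (auto elim!: row_spanE)

lemma ker_ddt_zero: "(\<lambda>t. 0\<^sub>v (dim_col A)) \<in> ker_ddt A"
  by (rule ker_ddt_rowI[of _ "dim_row A" "dim_col A"]) (auto simp: zero_signal intro!: row_ddt_zero_signal carrier_vecI)

lemma ker_ddt_add:
  assumes "x \<in> ker_ddt A" "z \<in> ker_ddt A"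
  shows "(\<lambda>t. x t + z t) \<in> ker_ddt A"
proof -
  have A: "A \<in> carrier_mat (dim_row A) (dim_col A)" by simp
  have s: "x \<in> signals (dim_col A)" "z \<in> signals (dim_col A)" using assms ker_ddt_signals by auto
  show ?thesis
    by (rule ker_ddt_rowI[OF A add_signals[OF s]])
      (simp add: row_ddt_add_signal[OF row_mult_carrier[OF A] s]
        ker_ddt_row[OF A assms(1)] ker_ddt_row[OF A assms(2)])
qed

lemma ker_ddt_diff:
  assumes "x \<in> ker_ddt A" "z \<in> ker_ddt A"
  shows "(\<lambda>t. x t - z t) \<in> ker_ddt A"
proof -
  have A: "A \<in> carrier_mat (dim_row A) (dim_col A)" by simp
  have s: "x \<in> signals (dim_col A)" "z \<in> signals (dim_col A)" using assms ker_ddt_signals by auto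
  show ?thesis
    by (rule ker_ddt_rowI[OF A diff_signals[OF s]])
      (simp add: row_ddt_diff_signal[OF row_mult_carrier[OF A] s]
        ker_ddt_row[OF A assms(1)] ker_ddt_row[OF A assms(2)])
qed

lemma ker_ddt_append_rows:
  assumes "A \<in> carrier_mat g q" "B \<in> carrier_mat h q"
  shows "ker_ddt (A @\<^sub>r B) = ker_ddt A \<inter> ker_ddt B"
proof (intro equalityI subsetI)
  have AB: "A @\<^sub>r B \<in> carrier_mat (g + h) q" using assms by auto
  fix x
  {
    assume x: "x \<in> ker_ddt (A @\<^sub>r B)"
    then have s: "x \<in> signals q" using AB mem_ker_ddt by blast
    have "row_ddt (v \<star> A + w \<star> B) x = (\<lambda>t. 0)" if "v \<in> carrier_vec g" "w \<in> carrier_vec h" for v w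
      using ker_ddt_row[OF AB x append_carrier_vec[OF that]]
      by (simp add: row_mult_append_rows[OF assms that])
    from this[of _ "0\<^sub>v h"] this[of "0\<^sub>v g"]
    show "x \<in> ker_ddt A \<inter> ker_ddt B"
      using assms by (auto intro!: ker_ddt_rowI[OF _ s])
  next
    assume x: "x \<in> ker_ddt A \<inter> ker_ddt B"
    then have s: "x \<in> signals q" using assms(1) mem_ker_ddt by blast
    show "x \<in> ker_ddt (A @\<^sub>r B)"
    proof (rule ker_ddt_rowI[OF AB s])
      fix w :: "real poly vec" assume "w \<in> carrier_vec (g + h)"
      then obtain w1 w2 where w: "w1 \<in> carrier_vec g" "w2 \<in> carrier_vec h" "w = w1 @\<^sub>v w2"
        by (elim vec_split)
      then show "row_ddt (w \<star> (A @\<^sub>r B)) x = (\<lambda>t. 0)"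
        using x ker_ddt_row[OF assms(1) _ w(1)] ker_ddt_row[OF assms(2) _ w(2)] assms
        by (simp add: row_mult_append_rows[OF assms w(1,2)] row_ddt_add[of _ q])
    qed
  }
qed

lemma mem_ker_ddt_append_cols:
  assumes "A \<in> carrier_mat g n" "B \<in> carrier_mat g m" "x \<in> signals n" "z \<in> signals m"
  shows "x \<oplus>\<^sub>s z \<in> ker_ddt (A @\<^sub>c B) \<longleftrightarrow>
    (\<forall>w\<in>carrier_vec g. \<forall>t. row_ddt (w \<star> A) x t + row_ddt (w \<star> B) z t = 0)"
proof -
  have AB: "A @\<^sub>c B \<in> carrier_mat g (n + m)" using assms by auto
  have "row_ddt (w \<star> (A @\<^sub>c B)) (x \<oplus>\<^sub>s z) = (\<lambda>t. row_ddt (w \<star> A) x t + row_ddt (w \<star> B) z t)"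
    if "w \<in> carrier_vec g" for w
    unfolding row_mult_append_cols[OF assms(1,2) that]
    by (rule row_ddt_stack) (use assms in auto)
  then show ?thesis
    using ker_ddt_row[OF AB, of "x \<oplus>\<^sub>s z"] ker_ddt_rowI[OF AB stack_signals[OF assms(3,4)]]
    by (auto simp: fun_eq_iff)
qed

section \<open>Solvability of linear differential equations\<close>

text \<open>Necessity of the compatibility condition is clear; sufficiency says that smooth functions form
an injective module. Let \<open>W k\<close> be the module of those \<open>w\<close> for which \<open>w K\<close> vanishes from
coordinate \<open>k\<close> on. A signal satisfying all equations from \<open>W k\<close> is corrected in its component
\<open>k\<close>, so that it also satisfies the one equation from \<open>W (k + 1)\<close> whose coefficient in column \<open>k\<close>
generates the ideal of all such coefficients. The correction solves a scalar equation, and it is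
invisible to \<open>W k\<close>.\<close>

theorem fundamental_principle:
  assumes K: "K \<in> carrier_mat g n" and f: "f \<in> signals g"
    and compat: "\<And>w. w \<in> carrier_vec g \<Longrightarrow> w \<star> K = 0\<^sub>v n \<Longrightarrow> row_ddt w f = (\<lambda>t. 0)"
  obtains x where "x \<in> signals n" "mat_ddt K x = f"
proof -
  define W where "W k = {w \<in> carrier_vec g. \<forall>j. k \<le> j \<and> j < n \<longrightarrow> (w \<star> K) $ j = 0}" for k
  have "\<exists>x\<in>signals n. \<forall>w\<in>W k. row_ddt (w \<star> K) x = row_ddt w f" if "k \<le> n" for k
    using that
  proof (induction k)
    case 0
    have "w \<star> K = 0\<^sub>v n" if "w \<in> W 0" for w
      using that K by (intro eq_vecI) (auto simp: W_def)
    then show ?case using compat K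
      by (intro bexI[of _ "\<lambda>t. 0\<^sub>v n"]) (auto simp: W_def zero_signal)
  next
    case (Suc k)
    then obtain x where x: "x \<in> signals n" "\<And>w. w \<in> W k \<Longrightarrow> row_ddt (w \<star> K) x = row_ddt w f"
      by auto
    let ?I = "(\<lambda>w. (w \<star> K) $ k) ` W (Suc k)"
    have k: "k < n" using Suc.prems by simp
    have sub: "submodule_of g (W (Suc k))"
      using K by (intro submodule_ofI)
        (auto simp: W_def row_mult_add[OF _ _ K] row_mult_smult[OF _ K])
    have "\<exists>d. d \<in> ?I \<and> (\<forall>a\<in>?I. d dvd a)"
    proof (rule poly_ideal_generator[of ?I])
      show "0 \<in> ?I" using sub K k
        by (intro image_eqI[of _ _ "0\<^sub>v g"]) (auto simp: submodule_of_def)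
      fix a assume "a \<in> ?I"
      then obtain v where v: "v \<in> W (Suc k)" "a = (v \<star> K) $ k" by blast
      have vc: "v \<in> carrier_vec g" using v by (simp add: W_def)
      show "c * a \<in> ?I" for c
        by (rule image_eqI[of _ _ "c \<cdot>\<^sub>v v"])
          (use sub K k v vc in \<open>auto simp: row_mult_smult[OF _ K] submodule_of_def\<close>)
      fix b assume "b \<in> ?I"
      then obtain w where w: "w \<in> W (Suc k)" "b = (w \<star> K) $ k" by blast
      have wc: "w \<in> carrier_vec g" using w by (simp add: W_def)
      show "a + b \<in> ?I"
        by (rule image_eqI[of _ _ "v + w"])
          (use sub K k v w vc wc in \<open>auto simp: row_mult_add[OF _ _ K] submodule_of_def\<close>)
    qed blast
    then obtain w0 where w0: "w0 \<in> W (Suc k)"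
      and gen: "\<And>w. w \<in> W (Suc k) \<Longrightarrow> (w0 \<star> K) $ k dvd (w \<star> K) $ k" by auto
    have w0c: "w0 \<in> carrier_vec g" using w0 by (simp add: W_def)
    let ?d = "(w0 \<star> K) $ k"
    have step: "w \<in> W k" if "w \<in> W (Suc k)" "(w \<star> K) $ k = 0" for w
      using that by (auto simp: W_def) (metis le_neq_implies_less Suc_leI)
    show ?case
    proof (cases "?d = 0")
      case True
      then have "w \<in> W k" if "w \<in> W (Suc k)" for w using gen[OF that] step[OF that] by simp
      then show ?thesis using x by blast
    next
      case False
      have "smooth (\<lambda>t. row_ddt w0 f t - row_ddt (w0 \<star> K) x t)"
        using w0c K f x by (intro smooth_diff smooth_row_ddt) auto
      then obtain z where z: "smooth z" "poly_ddt ?d z = (\<lambda>t. row_ddt w0 f t - row_ddt (w0 \<star> K) x t)"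
        using poly_ddt_surj[OF False] by blast
      \<comment> \<open>Only component \<open>k\<close> is changed, hence the equations from \<open>W k\<close> stay valid.\<close>
      define x' where "x' t = x t + z t \<cdot>\<^sub>v unit_vec n k" for t
      have x': "x' \<in> signals n" unfolding x'_def
        by (intro add_signals x unit_signal(1) z k)
      have rx': "row_ddt r x' = (\<lambda>t. row_ddt r x t + poly_ddt (r $ k) z t)" if "r \<in> carrier_vec n" for r
        unfolding x'_def[abs_def]
        by (simp add: row_ddt_add_signal[OF that x(1) unit_signal(1)[OF z(1) k]] unit_signal(2)[OF z(1) k that])
      have 0: "row_ddt (w0 \<star> K) x' = row_ddt w0 f"
        using rx'[of "w0 \<star> K"] K z by (simp add: row_mult_carrier)
      have "row_ddt (w \<star> K) x' = row_ddt w f" if w: "w \<in> W (Suc k)" for w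
      proof -
        have wc: "w \<in> carrier_vec g" using w by (simp add: W_def)
        obtain b where b: "(w \<star> K) $ k = ?d * b" using gen[OF w] by (elim dvdE)
        \<comment> \<open>Subtracting the multiple of \<open>w0\<close> moves \<open>w\<close> into \<open>W k\<close>, where \<open>x\<close> is already correct.\<close>
        define w1 where "w1 = w + (- b) \<cdot>\<^sub>v w0"
        have w1: "w1 \<in> W (Suc k)" using sub w w0 by (auto simp: w1_def submodule_of_def)
        have w1c: "w1 \<in> carrier_vec g" using w1 by (simp add: W_def)
        have z1: "(w1 \<star> K) $ k = 0" using b wc w0c K k
          by (simp add: w1_def row_mult_add[OF _ _ K] row_mult_smult[OF _ K])
        have "row_ddt (w1 \<star> K) x' = row_ddt w1 f"
          using rx'[of "w1 \<star> K"] K z1 x(2)[OF step[OF w1 z1]] by (simp add: row_mult_carrier)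
        moreover have weq: "w = w1 + b \<cdot>\<^sub>v w0"
          by (rule eq_vecI) (use wc w0c in \<open>auto simp: w1_def\<close>)
        have "w \<star> K = w1 \<star> K + b \<cdot>\<^sub>v (w0 \<star> K)"
          unfolding weq using w1c w0c by (simp add: row_mult_add[OF _ _ K] row_mult_smult[OF _ K])
        ultimately have "row_ddt (w \<star> K) x' = (\<lambda>t. row_ddt w1 f t + poly_ddt b (row_ddt w0 f) t)"
          using K x' 0 by (simp add: row_ddt_add[of _ n] row_ddt_smult[of _ n] row_mult_carrier)
        also have "\<dots> = row_ddt w f"
          unfolding weq using w1c w0c f by (simp add: row_ddt_add[of _ g] row_ddt_smult[of _ g])
        finally show ?thesis .
      qed
      then show ?thesis using x' by blast
    qed
  qed
  from this[of n] obtain x where x: "x \<in> signals n"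
    "\<And>w. w \<in> carrier_vec g \<Longrightarrow> row_ddt (w \<star> K) x = row_ddt w f"
    by (auto simp: W_def)
  have "mat_ddt K x = f"
    by (rule signal_eqI[OF mat_ddt_signals[OF K x(1)] f]) (simp add: row_ddt_mat_ddt[OF K x(1)] x(2))
  then show ?thesis using x(1) that by blast
qed

text \<open>If \<open>l\<close> is outside the row module, the polynomials \<open>b\<close> with \<open>b l\<close> inside form a proper ideal
\<open>(e)\<close>. With \<open>z \<noteq> 0\<close> and \<open>e(d/dt) z = 0\<close>, prescribing \<open>K(d/dt) x = 0\<close> and \<open>l(d/dt) x = z\<close> is
compatible, so some \<open>x\<close> in the kernel is not annihilated by \<open>l\<close>.\<close>

theorem row_span_if_annihilates_ker:
  assumes K: "K \<in> carrier_mat g q" and l: "l \<in> carrier_vec q"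
    and ann: "\<And>x. x \<in> ker_ddt K \<Longrightarrow> row_ddt l x = (\<lambda>t. 0)"
  shows "l \<in> row_span K"
proof (rule ccontr)
  assume nl: "l \<notin> row_span K"
  have sub: "submodule_of q (row_span K)" by (rule submodule_row_span[OF K])
  let ?I = "{b. b \<cdot>\<^sub>v l \<in> row_span K}"
  have "\<exists>e. e \<in> ?I \<and> (\<forall>a\<in>?I. e dvd a)"
  proof (rule poly_ideal_generator[of ?I])
    have "0 \<cdot>\<^sub>v l = 0\<^sub>v q" using l by (intro eq_vecI) auto
    then show "0 \<in> ?I" using sub by (simp add: submodule_of_def)
    show "a + b \<in> ?I" if "a \<in> ?I" "b \<in> ?I" for a b
      using sub that by (simp add: submodule_of_def add_smult_distrib_vec)
    show "c * a \<in> ?I" if "a \<in> ?I" for a c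
      using sub that by (auto simp: submodule_of_def smult_smult_assoc[symmetric])
  qed blast
  then obtain e where e: "e \<cdot>\<^sub>v l \<in> row_span K" "\<And>b. b \<cdot>\<^sub>v l \<in> row_span K \<Longrightarrow> e dvd b" by blast
  have "\<not> e dvd 1"
  proof
    assume "e dvd 1"
    then obtain c where "1 = c * e" by (metis dvdE mult.commute)
    moreover have "(c * e) \<cdot>\<^sub>v l \<in> row_span K"
      using sub e(1) by (auto simp: submodule_of_def smult_smult_assoc[symmetric])
    ultimately show False using nl by simp
  qed
  then have "degree e > 0 \<or> e = 0" using is_unit_iff_degree by blast
  then obtain z where z: "smooth z" "z \<noteq> (\<lambda>t. 0)" "poly_ddt e z = (\<lambda>t. 0)"
    using poly_ddt_nonzero_solution by blast
  let ?K = "K @\<^sub>r mat_of_row l"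
  have K': "?K \<in> carrier_mat (g + 1) q"
    by (rule carrier_append_rows[OF K mat_of_row_carrier_mat[OF l]])
  define f where "f t = z t \<cdot>\<^sub>v unit_vec (g + 1) g" for t
  have f: "f \<in> signals (g + 1)"
    and rf: "\<And>w. w \<in> carrier_vec (g + 1) \<Longrightarrow> row_ddt w f = poly_ddt (w $ g) z"
    unfolding f_def[abs_def] using unit_signal[OF z(1), of g "g + 1"] by auto
  obtain x where x: "x \<in> signals q" "mat_ddt ?K x = f"
  proof (rule fundamental_principle[OF K' f])
    fix w assume w: "w \<in> carrier_vec (g + 1)" "w \<star> ?K = 0\<^sub>v q"
    from w(1) obtain w1 w2 where w12: "w1 \<in> carrier_vec g" "w2 \<in> carrier_vec 1" "w = w1 @\<^sub>v w2"
      by (elim vec_split)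
    have eq: "w1 \<star> K + w2 $ 0 \<cdot>\<^sub>v l = 0\<^sub>v q"
      using w w12 by (simp add: row_mult_append_rows[OF K mat_of_row_carrier_mat[OF l] w12(1,2)]
          row_mult_mat_of_row[OF l w12(2)])
    have "w2 $ 0 \<cdot>\<^sub>v l = (-1) \<cdot>\<^sub>v (w1 \<star> K)"
    proof (rule eq_vecI)
      fix j assume "j < dim_vec ((-1) \<cdot>\<^sub>v (w1 \<star> K))"
      then have j: "j < q" using K by simp
      then have "(w1 \<star> K + w2 $ 0 \<cdot>\<^sub>v l) $ j = 0" by (simp only: eq index_zero_vec)
      then show "(w2 $ 0 \<cdot>\<^sub>v l) $ j = ((-1) \<cdot>\<^sub>v (w1 \<star> K)) $ j"
        using j l K by (simp add: eq_neg_iff_add_eq_0 add.commute)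
    qed (use l K in auto)
    also have "\<dots> \<in> row_span K"
      using sub row_spanI[OF w12(1) K] by (simp add: submodule_of_def)
    finally have "e dvd w2 $ 0" by (rule e(2))
    moreover have "w $ g = w2 $ 0" using w12 by simp
    ultimately show "row_ddt w f = (\<lambda>t. 0)"
      unfolding rf[OF w(1)] using z by (auto elim!: dvdE simp: mult.commute[of e] poly_ddt_mult)
  qed blast
  have rx: "row_ddt (w \<star> ?K) x = poly_ddt (w $ g) z" if "w \<in> carrier_vec (g + 1)" for w
    using row_ddt_mat_ddt[OF K' x(1) that] x(2) rf[OF that] by simp
  have "x \<in> ker_ddt K"
  proof (rule ker_ddt_rowI[OF K x(1)])
    fix w :: "real poly vec" assume w: "w \<in> carrier_vec g"
    have "(w @\<^sub>v 0\<^sub>v 1) \<star> ?K = w \<star> K"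
      using row_mult_append_rows[OF K mat_of_row_carrier_mat[OF l] w, of "0\<^sub>v 1"] K l w
      by (simp add: row_mult_zero[OF mat_of_row_carrier_mat[OF l], simplified])
    then show "row_ddt (w \<star> K) x = (\<lambda>t. 0)"
      using rx[OF append_carrier_vec[OF w, of "0\<^sub>v 1" 1]] w by simp
  qed
  moreover have "row_ddt l x = z"
  proof -
    have "(0\<^sub>v g @\<^sub>v unit_vec 1 0) \<star> ?K = l"
      using row_mult_append_rows[OF K mat_of_row_carrier_mat[OF l], of "0\<^sub>v g" "unit_vec 1 0"] K l
      by (simp add: row_mult_mat_of_row[OF l])
    then show ?thesis
      using rx[OF append_carrier_vec[of "0\<^sub>v g" g "unit_vec 1 0" 1]] by simp
  qed
  ultimately show False using ann z(2) by auto
qed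

corollary ker_ddt_subset_iff:
  assumes "K \<in> carrier_mat g q" "L \<in> carrier_mat r q"
  shows "ker_ddt K \<subseteq> ker_ddt L \<longleftrightarrow> row_span L \<subseteq> row_span K"
proof
  assume sub: "ker_ddt K \<subseteq> ker_ddt L"
  show "row_span L \<subseteq> row_span K"
  proof
    fix l assume l: "l \<in> row_span L"
    show "l \<in> row_span K"
    proof (rule row_span_if_annihilates_ker[OF assms(1)])
      show "l \<in> carrier_vec q" using l assms(2) by (auto elim: row_spanE)
      show "row_ddt l x = (\<lambda>t. 0)" if "x \<in> ker_ddt K" for x
        using sub that l mem_ker_ddt[OF assms(2)] by blast
    qed
  qed
qed (rule ker_ddt_antimono[OF assms])

corollary ker_ddt_eq_iff:
  assumes "K \<in> carrier_mat g q" "L \<in> carrier_mat r q"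
  shows "ker_ddt K = ker_ddt L \<longleftrightarrow> row_span K = row_span L"
  using ker_ddt_subset_iff[OF assms] ker_ddt_subset_iff[OF assms(2,1)] by auto

text \<open>The latent signal \<open>x\<close> solves \<open>W(d/dt) x = - T(d/dt) c\<close>, whose compatibility conditions are
exactly the equations obtained by eliminating \<open>x\<close> algebraically.\<close>

theorem elimination:
  assumes W: "W \<in> carrier_mat g n" and T: "T \<in> carrier_mat g q" and c: "c \<in> signals q"
  shows "(\<exists>x\<in>signals n. x \<oplus>\<^sub>s c \<in> ker_ddt (W @\<^sub>c T)) \<longleftrightarrow>
    (\<forall>w\<in>carrier_vec g. w \<star> W = 0\<^sub>v n \<longrightarrow> row_ddt (w \<star> T) c = (\<lambda>t. 0))"
proof
  assume "\<exists>x\<in>signals n. x \<oplus>\<^sub>s c \<in> ker_ddt (W @\<^sub>c T)"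
  then show "\<forall>w\<in>carrier_vec g. w \<star> W = 0\<^sub>v n \<longrightarrow> row_ddt (w \<star> T) c = (\<lambda>t. 0)"
    using mem_ker_ddt_append_cols[OF W T _ c] by fastforce
next
  assume compat: "\<forall>w\<in>carrier_vec g. w \<star> W = 0\<^sub>v n \<longrightarrow> row_ddt (w \<star> T) c = (\<lambda>t. 0)"
  have Tc: "mat_ddt T c \<in> signals g" by (rule mat_ddt_signals[OF T c])
  have rT: "row_ddt w (\<lambda>t. - mat_ddt T c t) = (\<lambda>t. - row_ddt (w \<star> T) c t)" if "w \<in> carrier_vec g" for w
    using row_ddt_uminus_signal[OF that Tc] row_ddt_mat_ddt[OF T c that] by simp
  obtain x where x: "x \<in> signals n" "mat_ddt W x = (\<lambda>t. - mat_ddt T c t)"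
    by (rule fundamental_principle[OF W uminus_signals[OF Tc]]) (use compat rT in auto)
  have "row_ddt (w \<star> W) x = (\<lambda>t. - row_ddt (w \<star> T) c t)" if "w \<in> carrier_vec g" for w
    using row_ddt_mat_ddt[OF W x(1) that] rT[OF that] x(2) by simp
  then have "row_ddt (w \<star> W) x t + row_ddt (w \<star> T) c t = 0" if "w \<in> carrier_vec g" for w t
    using that by simp
  then show "\<exists>x\<in>signals n. x \<oplus>\<^sub>s c \<in> ker_ddt (W @\<^sub>c T)"
    using x(1) mem_ker_ddt_append_cols[OF W T x(1) c] by blast
qed

text \<open>The first summand solves \<open>M(d/dt) x1 = 0\<close>, \<open>K(d/dt) x1 = K(d/dt) x\<close>. A syzygy between the rows
of \<open>M\<close> and \<open>K\<close> produces a row in the intersection of the two row modules, and these rows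
annihilate \<open>x\<close>; so the system is compatible.\<close>

theorem ker_ddt_sum:
  assumes M: "M \<in> carrier_mat g q" and K: "K \<in> carrier_mat h q" and L: "L \<in> carrier_mat r q"
    and LMK: "row_span L = row_span M \<inter> row_span K" and x: "x \<in> ker_ddt L"
  obtains x1 x2 where "x1 \<in> ker_ddt M" "x2 \<in> ker_ddt K" "x = (\<lambda>t. x1 t + x2 t)"
proof -
  have s: "x \<in> signals q" using x L mem_ker_ddt by blast
  define f where "f = (\<lambda>t. 0\<^sub>v g) \<oplus>\<^sub>s mat_ddt K x"
  have Kx: "mat_ddt K x \<in> signals h" by (rule mat_ddt_signals[OF K s])
  have f: "f \<in> signals (g + h)" unfolding f_def by (intro stack_signals zero_signal Kx)
  have MK: "M @\<^sub>r K \<in> carrier_mat (g + h) q" using M K by auto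
  have rf: "row_ddt (w1 @\<^sub>v w2) f = row_ddt (w2 \<star> K) x" if "w1 \<in> carrier_vec g" "w2 \<in> carrier_vec h" for w1 w2
    unfolding f_def row_ddt_stack[OF that zero_signal Kx]
    using that by (simp add: row_ddt_mat_ddt[OF K s])
  obtain x1 where x1: "x1 \<in> signals q" "mat_ddt (M @\<^sub>r K) x1 = f"
  proof (rule fundamental_principle[OF MK f])
    fix w assume w: "w \<in> carrier_vec (g + h)" "w \<star> (M @\<^sub>r K) = 0\<^sub>v q"
    from w(1) obtain w1 w2 where w12: "w1 \<in> carrier_vec g" "w2 \<in> carrier_vec h" "w = w1 @\<^sub>v w2"
      by (elim vec_split)
    have eq: "w1 \<star> M + w2 \<star> K = 0\<^sub>v q"
      using w w12 by (simp add: row_mult_append_rows[OF M K w12(1,2)])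
    have "w2 \<star> K = (- w1) \<star> M"
    proof (rule eq_vecI)
      fix j assume "j < dim_vec ((- w1) \<star> M)"
      then have j: "j < q" using M by simp
      then have "(w1 \<star> M + w2 \<star> K) $ j = 0" by (simp only: eq index_zero_vec)
      then show "(w2 \<star> K) $ j = ((- w1) \<star> M) $ j"
        using j K M by (simp add: row_mult_uminus[OF w12(1) M] eq_neg_iff_add_eq_0 add.commute)
    qed (use M K in auto)
    then have "w2 \<star> K \<in> row_span L"
      unfolding LMK using row_spanI[OF w12(2) K] row_spanI[of "- w1" g M q] w12 M by simp
    then show "row_ddt w f = (\<lambda>t. 0)"
      using x mem_ker_ddt[OF L] by (simp add: w12(3) rf[OF w12(1,2)])
  qed blast
  have rx: "row_ddt (w1 \<star> M + w2 \<star> K) x1 = row_ddt (w2 \<star> K) x"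
    if "w1 \<in> carrier_vec g" "w2 \<in> carrier_vec h" for w1 w2
    using row_ddt_mat_ddt[OF MK x1(1) append_carrier_vec[OF that]] rf[OF that] x1(2)
    by (simp add: row_mult_append_rows[OF M K that])
  have "x1 \<in> ker_ddt M"
    by (rule ker_ddt_rowI[OF M x1(1)]) (use rx[of _ "0\<^sub>v h"] M K in auto)
  moreover have "(\<lambda>t. x t - x1 t) \<in> ker_ddt K"
    by (rule ker_ddt_rowI[OF K diff_signals[OF s x1(1)]])
      (use rx[of "0\<^sub>v g"] M K in \<open>auto simp: row_ddt_diff_signal[OF _ s x1(1)]\<close>)
  moreover have "x = (\<lambda>t. x1 t + (x t - x1 t))"
    using s x1(1) by (intro ext eq_vecI) (auto simp: signalsD)
  ultimately show ?thesis by (rule that)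
qed

section \<open>Ranks of polynomial matrices\<close>

text \<open>Zero rows complete the matrix to a square one, whose determinant vanishes. The kernel vector
exists over the domain itself, with no passage to fractions.\<close>

lemma wide_matrix_kernel:
  fixes A :: "'a :: idom mat"
  assumes A: "A \<in> carrier_mat s r" and "s < r"
  obtains v where "v \<in> carrier_vec r" "v \<noteq> 0\<^sub>v r" "A *\<^sub>v v = 0\<^sub>v s"
proof -
  define B where "B = mat r r (\<lambda>(i, j). if i < s then A $$ (i, j) else 0)"
  have B: "B \<in> carrier_mat r r" by (simp add: B_def)
  have "transpose_mat B *\<^sub>v unit_vec r (r - 1) = 0\<^sub>v r"
    using assms by (intro eq_vecI) (auto simp: B_def scalar_prod_def)
  moreover have "unit_vec r (r - 1) \<noteq> (0\<^sub>v r :: 'a vec)" using assms(2) by simp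
  ultimately have "det (transpose_mat B) = 0"
    using det_0_iff_vec_prod_zero[of "transpose_mat B" r] B unit_vec_carrier[of r "r - 1"]
    by (meson transpose_carrier_mat)
  then obtain v where v: "v \<in> carrier_vec r" "v \<noteq> 0\<^sub>v r" "B *\<^sub>v v = 0\<^sub>v r"
    using det_0_iff_vec_prod_zero[OF B] det_transpose[OF B] by auto
  have "(A *\<^sub>v v) $ i = (B *\<^sub>v v) $ i" if "i < s" for i
    using that A assms(2) v(1) by (simp add: B_def scalar_prod_def)
  then have "A *\<^sub>v v = 0\<^sub>v s" using v(3) A assms(2) by (intro eq_vecI) auto
  then show ?thesis using v that by blast
qed

lemma tall_matrix_left_kernel:
  fixes K :: "'a :: idom mat"
  assumes K: "K \<in> carrier_mat g q" and "q < g"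
  obtains v where "v \<in> carrier_vec g" "v \<noteq> 0\<^sub>v g" "v \<star> K = 0\<^sub>v q"
  using wide_matrix_kernel[of "transpose_mat K" q g] assms unfolding row_mult_def by auto

context vec_space
begin

text \<open>A maximal independent set of columns expresses all columns. Inner dimensions of factorizations
make the rank accessible from rows as well as from columns.\<close>

lemma rank_factorization:
  assumes A: "A \<in> carrier_mat n nc"
  obtains B Z where "B \<in> carrier_mat n (rank A)" "Z \<in> carrier_mat (rank A) nc" "A = B * Z"
    "set (cols B) \<subseteq> set (cols A)" "distinct (cols B)" "lin_indpt (set (cols B))"
proof -
  let ?P = "\<lambda>T. T \<subseteq> set (cols A) \<and> lin_indpt T"
  have colsA: "set (cols A) \<subseteq> carrier_vec n" using A cols_dim by blast
  have "?P {}" by (simp add: lin_dep_def)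
  then obtain S where S: "finite S" "maximal S ?P"
    using maximal_exists_superset[of "set (cols A)" ?P "{}"] by auto
  have r: "rank A = card S" by (rule rank_card_indpt[OF A S(2)])
  have Ssub: "S \<subseteq> set (cols A)" "lin_indpt S" using S(2) by (auto simp: maximal_def)
  have Sc: "S \<subseteq> carrier_vec n" using Ssub colsA by blast
  have span: "x \<in> span S" if "x \<in> set (cols A)" for x
  proof (rule ccontr)
    assume x: "x \<notin> span S"
    have xc: "x \<in> carrier_vec n" using that colsA by blast
    have "x \<notin> S" using x Sc span_mem by auto
    moreover have "lin_indpt (S \<union> {x})"
      using lin_dep_iff_in_span[of S x] x xc Sc Ssub(2) \<open>x \<notin> S\<close> by auto
    ultimately show False using S(2) Ssub that unfolding maximal_def by blast
  qed
  obtain xs where xs: "set xs = S" "distinct xs" using finite_distinct_list[OF S(1)] by blast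
  define B where "B = mat_of_cols n xs"
  have len: "length xs = rank A" using xs r distinct_card by metis
  have B: "B \<in> carrier_mat n (rank A)" unfolding B_def len[symmetric] by (rule mat_of_cols_carrier)
  have colsB: "cols B = xs" unfolding B_def using xs(1) Sc by (intro cols_mat_of_cols) auto
  have "\<exists>v. v \<in> carrier_vec (rank A) \<and> col A j = B *\<^sub>v v" if "j < nc" for j
  proof -
    have "col A j \<in> set (cols A)" using that A by (auto simp: cols_def)
    then obtain a where "lincomb a S = col A j"
      using finite_in_span[OF S(1) _ span] Sc by auto
    then have "B *\<^sub>v vec (rank A) (\<lambda>i. a (col B i)) = col A j"
      using mat_mult_eq_lincomb[OF B] colsB xs by simp
    then show ?thesis by (intro exI[of _ "vec (rank A) (\<lambda>i. a (col B i))"]) simp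
  qed
  then obtain f where f: "\<And>j. j < nc \<Longrightarrow> f j \<in> carrier_vec (rank A) \<and> col A j = B *\<^sub>v f j" by metis
  define Z where "Z = mat (rank A) nc (\<lambda>(i, j). f j $ i)"
  have Z: "Z \<in> carrier_mat (rank A) nc" by (simp add: Z_def)
  have "A = B * Z"
  proof (rule mat_col_eqI)
    fix j assume "j < dim_col (B * Z)"
    then have j: "j < nc" using Z by simp
    have "col Z j = f j" using f[OF j] j by (intro eq_vecI) (auto simp: Z_def)
    then show "col A j = col (B * Z) j" using f[OF j] col_mult2[OF B Z j] by simp
  qed (use A B Z in auto)
  then show ?thesis using that B Z colsB xs Ssub by simp
qed

lemma rank_le_inner_dimension:
  assumes B: "B \<in> carrier_mat n s" and Z: "Z \<in> carrier_mat s nc"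
  shows "rank (B * Z) \<le> s"
proof (rule ccontr)
  assume "\<not> rank (B * Z) \<le> s"
  then have lt: "s < rank (B * Z)" by simp
  have BZ: "B * Z \<in> carrier_mat n nc" using B Z by auto
  obtain U where U: "U \<in> carrier_mat n (rank (B * Z))" "set (cols U) \<subseteq> set (cols (B * Z))"
    "distinct (cols U)" "lin_indpt (set (cols U))"
    by (rule rank_factorization[OF BZ])
  let ?r = "rank (B * Z)"
  have "\<exists>k<nc. col U j = col (B * Z) k" if "j < ?r" for j
  proof -
    have "col U j \<in> set (cols U)" using that U(1) by (auto simp: cols_def)
    then have "col U j \<in> set (cols (B * Z))" using U(2) by blast
    then show ?thesis using Z by (auto simp: cols_def)
  qed
  then obtain h where h: "\<And>j. j < ?r \<Longrightarrow> h j < nc \<and> col U j = col (B * Z) (h j)" by metis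
  define Z' where "Z' = mat s ?r (\<lambda>(i, j). Z $$ (i, h j))"
  have Z': "Z' \<in> carrier_mat s ?r" by (simp add: Z'_def)
  have "U = B * Z'"
  proof (rule mat_col_eqI)
    fix j assume "j < dim_col (B * Z')"
    then have j: "j < ?r" using Z' by simp
    have "col Z' j = col Z (h j)" using h[OF j] j Z by (intro eq_vecI) (auto simp: Z'_def)
    then show "col U j = col (B * Z') j"
      using h[OF j] col_mult2[OF B Z' j] col_mult2[OF B Z, of "h j"] by simp
  qed (use U B Z' in auto)
  moreover obtain v where v: "v \<in> carrier_vec ?r" "v \<noteq> 0\<^sub>v ?r" "Z' *\<^sub>v v = 0\<^sub>v s"
    by (rule wide_matrix_kernel[OF Z' lt])
  moreover have "B *\<^sub>v 0\<^sub>v s = 0\<^sub>v n" using B by (intro eq_vecI) auto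
  ultimately have "U *\<^sub>v v = 0\<^sub>v n" using B Z' by simp
  then show False using lin_depI[OF U(1) v(1,2) _ U(3)] U(4) by blast
qed

end

lemma clear_denominators:
  fixes v :: "'a :: idom fract vec"
  assumes "v \<in> carrier_vec n"
  obtains m w where "m \<noteq> 0" "w \<in> carrier_vec n" "map_vec to_fract w = to_fract m \<cdot>\<^sub>v v"
proof -
  have "\<exists>a b. v $ i = Fraction_Field.Fract a b \<and> b \<noteq> 0" for i by (metis Fract_cases)
  then obtain a b where ab: "\<And>i. v $ i = Fraction_Field.Fract (a i) (b i) \<and> b i \<noteq> 0" by metis
  let ?w = "vec n (\<lambda>i. a i * prod b ({..<n} - {i}))"
  show ?thesis
  proof (rule that[of "prod b {..<n}" ?w])
    show "map_vec to_fract ?w = to_fract (prod b {..<n}) \<cdot>\<^sub>v v"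
    proof (rule eq_vecI)
      fix i assume "i < dim_vec (to_fract (prod b {..<n}) \<cdot>\<^sub>v v)"
      then have i: "i < n" using assms by simp
      then have "prod b {..<n} = b i * prod b ({..<n} - {i})" by (simp add: prod.remove)
      then show "map_vec to_fract ?w $ i = (to_fract (prod b {..<n}) \<cdot>\<^sub>v v) $ i"
        using i assms ab[of i] by (simp add: to_fract_def eq_fract)
    qed (use assms in auto)
  qed (use ab in auto)
qed

interpretation to_fract: inj_comm_ring_hom "to_fract :: 'a :: idom \<Rightarrow> 'a fract"
  by unfold_locales auto

lemma poly_rank_le_inner_dimension:
  assumes X: "X \<in> carrier_mat g r" and L: "L \<in> carrier_mat r q"
  shows "poly_rank (X * L) \<le> r"
proof -
  have "map_mat to_fract (X * L) = map_mat to_fract X * map_mat to_fract L"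
    by (rule to_fract.mat_hom_mult[OF X L])
  then show ?thesis
    using vec_space.rank_le_inner_dimension[of "map_mat to_fract X" g r "map_mat to_fract L" q] X L
    by (simp add: poly_rank_def)
qed

text \<open>If the rank were smaller, \<open>Y K\<close> would factor over the field of fractions through fewer than \<open>r\<close>
dimensions, and a vector in the left kernel of the first factor, with denominators cleared, would
contradict independence.\<close>

lemma indep_rows_left_multiple_le_poly_rank:
  assumes Y: "Y \<in> carrier_mat r g" and K: "K \<in> carrier_mat g q" and ind: "indep_rows (Y * K)"
  shows "r \<le> poly_rank K"
proof (rule ccontr)
  assume "\<not> r \<le> poly_rank K"
  then have lt: "poly_rank K < r" by simp
  let ?h = "to_fract :: real poly \<Rightarrow> real poly fract"
  have hK: "map_mat ?h K \<in> carrier_mat g q" using K by simp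
  obtain B Z where BZ: "B \<in> carrier_mat g (poly_rank K)" "Z \<in> carrier_mat (poly_rank K) q"
    "map_mat ?h K = B * Z"
    by (rule vec_space.rank_factorization[OF hK]) (use K in \<open>auto simp: poly_rank_def\<close>)
  have hY: "map_mat ?h Y \<in> carrier_mat r g" using Y by simp
  obtain v where v: "v \<in> carrier_vec r" "v \<noteq> 0\<^sub>v r" "v \<star> (map_mat ?h Y * B) = 0\<^sub>v (poly_rank K)"
    by (rule tall_matrix_left_kernel[of "map_mat ?h Y * B" r "poly_rank K"]) (use hY BZ lt in auto)
  obtain m w where w: "m \<noteq> 0" "w \<in> carrier_vec r" "map_vec ?h w = ?h m \<cdot>\<^sub>v v"
    by (rule clear_denominators[OF v(1)])
  have YB: "map_mat ?h Y * B \<in> carrier_mat r (poly_rank K)" using hY BZ by auto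
  have YK: "Y * K \<in> carrier_mat r q" using Y K by auto
  have "map_mat ?h (Y * K) = (map_mat ?h Y * B) * Z"
    using to_fract.mat_hom_mult[OF Y K] BZ hY by (simp add: assoc_mult_mat[of _ r g _ "poly_rank K" _ q])
  then have "v \<star> map_mat ?h (Y * K) = 0\<^sub>v q"
    using v BZ by (simp add: row_mult_assoc[OF v(1) YB BZ(2)])
  moreover have "?h m \<cdot>\<^sub>v 0\<^sub>v q = 0\<^sub>v q" by (intro eq_vecI) auto
  ultimately have "(?h m \<cdot>\<^sub>v v) \<star> map_mat ?h (Y * K) = 0\<^sub>v q"
    using row_mult_smult[of v r "map_mat ?h (Y * K)" q] v(1) YK by simp
  moreover have "map_vec ?h (w \<star> (Y * K)) = map_vec ?h w \<star> map_mat ?h (Y * K)"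
    unfolding row_mult_def map_mat_transpose
    by (rule to_fract.mult_mat_vec_hom[of _ q r]) (use YK w in auto)
  ultimately have "map_vec ?h (w \<star> (Y * K)) = 0\<^sub>v q" using w(3) by simp
  then have "w \<star> (Y * K) = 0\<^sub>v q" by simp
  then have "w = 0\<^sub>v r" by (rule indep_rowsD[OF ind YK w(2)])
  then have "?h m \<cdot>\<^sub>v v = 0\<^sub>v r" using w(3) to_fract.vec_hom_zero by metis
  then have "v = 0\<^sub>v r"
  proof -
    assume z: "?h m \<cdot>\<^sub>v v = 0\<^sub>v r"
    show "v = 0\<^sub>v r"
    proof (rule eq_vecI)
      fix i assume "i < dim_vec (0\<^sub>v r :: real poly fract vec)"
      then have i: "i < r" by simp
      then have "(?h m \<cdot>\<^sub>v v) $ i = 0" by (simp only: z index_zero_vec)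
      then show "v $ i = 0\<^sub>v r $ i" using i v(1) w(1) by simp
    qed (use v in auto)
  qed
  then show False using v(2) by simp
qed

lemma indep_rows_cancel:
  assumes ind: "indep_rows L" and L: "L \<in> carrier_mat r q"
    and "u \<in> carrier_vec r" "v \<in> carrier_vec r" "u \<star> L = v \<star> L"
  shows "u = v"
proof -
  have "(u - v) \<star> L = 0\<^sub>v q" using assms by (simp add: row_mult_diff[OF _ _ L])
  then have z: "u - v = 0\<^sub>v r" using indep_rowsD[OF ind L, of "u - v"] assms by simp
  show ?thesis
  proof (rule eq_vecI)
    fix i assume "i < dim_vec v"
    then have i: "i < r" using assms by simp
    then have "(u - v) $ i = 0" by (simp only: z index_zero_vec)
    then show "u $ i = v $ i" using i assms by simp
  qed (use assms in auto)
qed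

text \<open>The rank is the rank of the row module as a free module: each of \<open>K\<close> and \<open>L\<close> is a left multiple
of the other, so both bounds apply.\<close>

lemma poly_rank_eq_if_row_basis:
  assumes K: "K \<in> carrier_mat g q" and L: "L \<in> carrier_mat r q"
    and ind: "indep_rows L" and span: "row_span L = row_span K"
  shows "poly_rank K = r"
proof (rule antisym)
  obtain X where "X \<in> carrier_mat g r" "K = X * L"
    using row_span_subset_factor[OF K L] span by blast
  then show "poly_rank K \<le> r" using poly_rank_le_inner_dimension[OF _ L] by blast
  obtain Y where "Y \<in> carrier_mat r g" "L = Y * K"
    using row_span_subset_factor[OF L K] span by blast
  then show "r \<le> poly_rank K" using indep_rows_left_multiple_le_poly_rank[OF _ K] ind by blast
qed

lemma row_basis:
  assumes K: "K \<in> carrier_mat g q"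
  obtains L where "L \<in> carrier_mat (poly_rank K) q" "indep_rows L" "row_span L = row_span K"
proof -
  obtain r L where L: "L \<in> carrier_mat r q" "indep_rows L" "row_span L = row_span K"
    by (rule submodule_has_basis[OF submodule_row_span[OF K]])
  have "poly_rank K = r" by (rule poly_rank_eq_if_row_basis[OF K L])
  with L show ?thesis by (intro that[of L]) simp_all
qed

lemma poly_rank_row_span_cong:
  assumes "K \<in> carrier_mat g q" "L \<in> carrier_mat r q" "row_span K = row_span L"
  shows "poly_rank K = poly_rank L"
proof -
  obtain B where B: "B \<in> carrier_mat (poly_rank L) q" "indep_rows B" "row_span B = row_span L"
    by (rule row_basis[OF assms(2)])
  show ?thesis by (rule poly_rank_eq_if_row_basis[OF assms(1) B(1,2)]) (simp add: B(3) assms(3))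
qed

text \<open>For the direction from full row rank, a basis \<open>L\<close> of the row module has as many rows as \<open>K\<close>.
The transition matrices between \<open>K\<close> and \<open>L\<close> are then square and inverse to each other, and
independence carries over from \<open>L\<close> to \<open>K\<close>.\<close>

lemma full_row_rank_iff_indep_rows:
  assumes K: "K \<in> carrier_mat g q"
  shows "full_row_rank K \<longleftrightarrow> indep_rows K"
proof
  assume "indep_rows K"
  then show "full_row_rank K"
    using poly_rank_eq_if_row_basis[OF K K] K by (simp add: full_row_rank_def)
next
  assume "full_row_rank K"
  then have r: "poly_rank K = g" using K by (simp add: full_row_rank_def)
  obtain L where L: "L \<in> carrier_mat g q" "indep_rows L" "row_span L = row_span K"
    by (rule row_basis[OF K, unfolded r])
  obtain X where X: "X \<in> carrier_mat g g" "K = X * L"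
    using row_span_subset_factor[OF K L(1)] L(3) by blast
  obtain Y where Y: "Y \<in> carrier_mat g g" "L = Y * K"
    using row_span_subset_factor[OF L(1) K] L(3) by blast
  have YX: "Y * X \<in> carrier_mat g g" using X Y by auto
  have "u \<star> (Y * X) = u" if "u \<in> carrier_vec g" for u
  proof (rule indep_rows_cancel[OF L(2,1) row_mult_carrier[OF YX] that])
    have "Y * X * L = L" using X Y L(1) by (metis assoc_mult_mat)
    then show "u \<star> (Y * X) \<star> L = u \<star> L" using row_mult_assoc[OF that YX L(1)] by simp
  qed
  then have "row (Y * X) i = row (1\<^sub>m g) i" if "i < g" for i
    using row_mult_unit[OF YX that] row_mult_unit[OF one_carrier_mat that] that by simp
  then have "Y * X = 1\<^sub>m g" using YX by (intro eq_rowI) auto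
  then have "det Y * det X = 1" using det_mult[OF Y(1) X(1)] by simp
  then have "det (transpose_mat X) \<noteq> 0" using det_transpose[OF X(1)] by auto
  then have Xinj: "v = 0\<^sub>v g" if "v \<in> carrier_vec g" "v \<star> X = 0\<^sub>v g" for v
    using that det_0_iff_vec_prod_zero[of "transpose_mat X" g] X(1) by (auto simp: row_mult_def)
  show "indep_rows K"
  proof (rule indep_rowsI[OF K])
    fix v assume v: "v \<in> carrier_vec g" "v \<star> K = 0\<^sub>v q"
    then have "v \<star> X \<star> L = 0\<^sub>v q" using X L by (simp add: row_mult_assoc[OF _ X(1) L(1)])
    then have "v \<star> X = 0\<^sub>v g" using indep_rowsD[OF L(2,1)] X by blast
    then show "v = 0\<^sub>v g" using Xinj v by blast
  qed
qed

lemma num_outputs_eq: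
  assumes A: "A \<in> carrier_mat g q" and full: "full_row_rank A"
  shows "num_outputs q (ker_ddt A) = g"
  unfolding num_outputs_def
proof (rule the_equality)
  show "\<exists>A'\<in>carrier_mat g q. full_row_rank A' \<and> ker_ddt A = ker_ddt A'" using assms by blast
  fix h assume "\<exists>A'\<in>carrier_mat h q. full_row_rank A' \<and> ker_ddt A = ker_ddt A'"
  then obtain B where B: "B \<in> carrier_mat h q" "full_row_rank B" "ker_ddt A = ker_ddt B" by blast
  then have "poly_rank A = poly_rank B"
    using poly_rank_row_span_cong[OF A B(1)] ker_ddt_eq_iff[OF A B(1)] by blast
  then show "h = g" using full B A by (simp add: full_row_rank_def)
qed

lemma row_span_subset_submodule:
  assumes A: "A \<in> carrier_mat g q" and N: "submodule_of q N" and rows: "\<And>i. i < g \<Longrightarrow> row A i \<in> N"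
  shows "row_span A \<subseteq> N"
proof
  fix l assume "l \<in> row_span A"
  then obtain v where v: "v \<in> carrier_vec g" "l = v \<star> A" using A by (elim row_spanE)
  have "vec g (\<lambda>i. if i < k then v $ i else 0) \<star> A \<in> N" if "k \<le> g" for k
    using that
  proof (induction k)
    case 0
    have "vec g (\<lambda>i. if i < 0 then v $ i else 0) = 0\<^sub>v g" by (intro eq_vecI) auto
    then show ?case using A N by (simp add: submodule_of_def)
  next
    case (Suc k)
    let ?u = "\<lambda>k. vec g (\<lambda>i. if i < k then v $ i else 0)"
    have "?u (Suc k) = ?u k + v $ k \<cdot>\<^sub>v unit_vec g k"
      using Suc.prems by (intro eq_vecI) (auto simp: less_Suc_eq)
    then have "?u (Suc k) \<star> A = ?u k \<star> A + v $ k \<cdot>\<^sub>v row A k"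
      using Suc.prems A by (simp add: row_mult_add[OF _ _ A] row_mult_smult[OF _ A] row_mult_unit[OF A])
    then show ?case using Suc N rows[of k] by (simp add: submodule_of_def)
  qed
  from this[of g] have "vec g (\<lambda>i. if i < g then v $ i else 0) \<star> A \<in> N" by simp
  moreover have "vec g (\<lambda>i. if i < g then v $ i else 0) = v" using v by (intro eq_vecI) auto
  ultimately show "l \<in> N" using v by simp
qed

text \<open>The polynomial vectors in the span of the rows over the field of fractions.\<close>

definition saturation :: "real poly mat \<Rightarrow> real poly vec set" where
  "saturation L = {v \<in> carrier_vec (dim_col L). \<exists>d. d \<noteq> 0 \<and> d \<cdot>\<^sub>v v \<in> row_span L}"

lemma submodule_saturation:
  assumes L: "L \<in> carrier_mat r q"
  shows "submodule_of q (saturation L)"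
proof (rule submodule_ofI)
  have sub: "submodule_of q (row_span L)" by (rule submodule_row_span[OF L])
  show "saturation L \<subseteq> carrier_vec q" using L by (auto simp: saturation_def)
  show "0\<^sub>v q \<in> saturation L"
    using sub L by (auto simp: saturation_def submodule_of_def intro!: exI[of _ 1])
  fix v assume "v \<in> saturation L"
  then obtain d where v: "v \<in> carrier_vec q" "d \<noteq> 0" "d \<cdot>\<^sub>v v \<in> row_span L"
    using L by (auto simp: saturation_def)
  have "d \<cdot>\<^sub>v (a \<cdot>\<^sub>v v) = a \<cdot>\<^sub>v (d \<cdot>\<^sub>v v)" for a by (simp add: smult_smult_assoc mult.commute)
  then have "d \<cdot>\<^sub>v (a \<cdot>\<^sub>v v) \<in> row_span L" for a using sub v by (simp add: submodule_of_def)
  then show "a \<cdot>\<^sub>v v \<in> saturation L" for a using v L by (auto simp: saturation_def)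
  fix w assume "w \<in> saturation L"
  then obtain e where w: "w \<in> carrier_vec q" "e \<noteq> 0" "e \<cdot>\<^sub>v w \<in> row_span L"
    using L by (auto simp: saturation_def)
  have "(d * e) \<cdot>\<^sub>v (v + w) = e \<cdot>\<^sub>v (d \<cdot>\<^sub>v v) + d \<cdot>\<^sub>v (e \<cdot>\<^sub>v w)"
    using v w by (intro eq_vecI) (auto simp: algebra_simps)
  also have "\<dots> \<in> row_span L" using sub v w by (simp add: submodule_of_def)
  finally show "v + w \<in> saturation L" using v w L by (auto simp: saturation_def intro!: exI[of _ "d * e"])
qed

lemma row_span_subset_saturation: "L \<in> carrier_mat r q \<Longrightarrow> row_span L \<subseteq> saturation L"
  using submodule_row_span[of L r q] by (auto simp: saturation_def submodule_of_def intro!: exI[of _ 1])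

lemma saturation_cancel:
  assumes "a \<noteq> 0" "a \<cdot>\<^sub>v v \<in> row_span L" "v \<in> carrier_vec (dim_col L)"
  shows "v \<in> saturation L"
  using assms by (auto simp: saturation_def)

text \<open>After multiplication by suitable nonzero polynomials, a basis of the row module of \<open>K\<close> factors
through the \<open>l\<close> rows of \<open>L\<close>; with more than \<open>l\<close> basis vectors this would give a dependence.\<close>

lemma poly_rank_le_if_saturated:
  assumes K: "K \<in> carrier_mat g q" and L: "L \<in> carrier_mat l q"
    and sat: "\<And>i. i < g \<Longrightarrow> row K i \<in> saturation L"
  shows "poly_rank K \<le> l"
proof (rule ccontr)
  assume "\<not> poly_rank K \<le> l"
  then have lt: "l < poly_rank K" by simp
  let ?r = "poly_rank K"
  obtain B where B: "B \<in> carrier_mat ?r q" "indep_rows B" "row_span B = row_span K"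
    by (rule row_basis[OF K])
  have "row_span K \<subseteq> saturation L"
    by (rule row_span_subset_submodule[OF K submodule_saturation[OF L] sat])
  then have "row B i \<in> saturation L" if "i < ?r" for i using row_in_row_span[OF B(1) that] B(3) by blast
  then have "\<exists>d. d \<noteq> 0 \<and> d \<cdot>\<^sub>v row B i \<in> row_span L" if "i < ?r" for i
    using that by (auto simp: saturation_def)
  then obtain d where d: "\<And>i. i < ?r \<Longrightarrow> d i \<noteq> 0 \<and> d i \<cdot>\<^sub>v row B i \<in> row_span L" by metis
  define E where "E = mat ?r q (\<lambda>(i, j). d i * B $$ (i, j))"
  have E: "E \<in> carrier_mat ?r q" by (simp add: E_def)
  have "row E i = d i \<cdot>\<^sub>v row B i" if "i < ?r" for i
    using that B by (intro eq_vecI) (auto simp: E_def)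
  then have "row E i \<in> row_span L" if "i < ?r" for i using d that by simp
  then obtain F where F: "F \<in> carrier_mat ?r l" "E = F * L"
    using rows_in_span_factor[OF E L] by blast
  obtain v where v: "v \<in> carrier_vec ?r" "v \<noteq> 0\<^sub>v ?r" "v \<star> F = 0\<^sub>v l"
    by (rule tall_matrix_left_kernel[OF F(1) lt])
  have "v \<star> E = 0\<^sub>v q" using v L by (simp add: F(2) row_mult_assoc[OF v(1) F(1) L])
  define u where "u = vec ?r (\<lambda>i. d i * v $ i)"
  have u: "u \<in> carrier_vec ?r" by (simp add: u_def)
  have "u \<star> B = v \<star> E"
    by (rule eq_vecI) (use E B v u in \<open>auto simp: row_mult_index[of _ ?r _ q] u_def E_def algebra_simps\<close>)
  then have "u = 0\<^sub>v ?r" using indep_rowsD[OF B(2,1) u] \<open>v \<star> E = 0\<^sub>v q\<close> by simp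
  then have "d i * v $ i = 0" if "i < ?r" for i using that by (metis u_def index_vec index_zero_vec(1))
  then have "v = 0\<^sub>v ?r" using d v(1) by (intro eq_vecI) auto
  then show False using v(2) by simp
qed

section \<open>Completing matrices to full row rank and selecting columns\<close>

text \<open>Greedy choice. Suppose the first \<open>c\<close> rows are already modified into an independent \<open>M\<close>, and let
\<open>l\<close> be the next row of \<open>C\<close>. If neither \<open>l\<close> nor any sum of \<open>l\<close> with a row of \<open>P\<close> is independent
of \<open>M\<close>, then \<open>l\<close>, all rows of \<open>P\<close>, and hence also the unmodified earlier rows lie in the span
of the \<open>c\<close> rows of \<open>M\<close> over the field of fractions, and the rank of the stacked matrix is at most
\<open>c\<close>. In the induction, removing a row of \<open>C\<close> lowers the rank by at most one.\<close>

lemma exists_indep_rows_perturbation: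
  fixes C P :: "real poly mat"
  assumes "C \<in> carrier_mat c n" "P \<in> carrier_mat p n" "c \<le> poly_rank (C @\<^sub>r P)"
  shows "\<exists>V\<in>carrier_mat c p. indep_rows (C + V * P)"
  using assms(1,3)
proof (induction c arbitrary: C)
  case 0
  have "indep_rows (C + 0\<^sub>m 0 p * P)"
    by (rule indep_rowsI[of _ 0 n]) (use 0 assms(2) in \<open>auto intro: eq_vecI\<close>)
  then show ?case by (intro bexI[of _ "0\<^sub>m 0 p"]) auto
next
  case (Suc c)
  note C = Suc.prems(1) and P = assms(2)
  define D where "D = mat c n (\<lambda>(i, j). C $$ (i, j))"
  define l where "l = row C c"
  have D: "D \<in> carrier_mat c n" by (simp add: D_def)
  have l: "l \<in> carrier_vec n" using carrier_matD(2)[OF C] by (intro carrier_vecI) (simp add: l_def)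
  have DP: "D @\<^sub>r P \<in> carrier_mat (c + p) n" using D P by auto
  have CP: "C @\<^sub>r P \<in> carrier_mat (Suc c + p) n" using C P by (rule carrier_append_rows)
  have rowC: "row C i = (if i < c then row D i else l)" if "i < Suc c" for i
    using that C by (cases "i < c") (auto intro!: eq_vecI simp: D_def l_def less_Suc_eq)
  have row_top: "row (A @\<^sub>r P) i = row A i" if "A \<in> carrier_mat a n" "i < a" for A a i
    using that P carrier_matD[OF carrier_append_rows[OF that(1) P]]
    by (intro eq_vecI) (auto simp: append_rows_index[OF that(1) P])
  have row_bot: "row (A @\<^sub>r P) (a + i) = row P i" if "A \<in> carrier_mat a n" "i < p" for A a i
    using that P carrier_matD[OF carrier_append_rows[OF that(1) P]]
    by (intro eq_vecI) (auto simp: append_rows_index[OF that(1) P])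
  have rows_CP: "row (C @\<^sub>r P) i \<in> N"
    if "i < Suc c + p" "\<And>i. i < c \<Longrightarrow> row D i \<in> N" "l \<in> N" "\<And>i. i < p \<Longrightarrow> row P i \<in> N" for i N
  proof (cases "i < Suc c")
    case True
    then show ?thesis using that(2)[of i] that(3) rowC[OF True] row_top[OF C True] by (cases "i < c") auto
  next
    case False
    then have "i = Suc c + (i - Suc c)" "i - Suc c < p" using that(1) by simp_all
    then show ?thesis using row_bot[OF C, of "i - Suc c"] that(4) by metis
  qed
  have "c \<le> poly_rank (D @\<^sub>r P)"
  proof (rule ccontr)
    assume "\<not> c \<le> poly_rank (D @\<^sub>r P)"
    then have lt: "poly_rank (D @\<^sub>r P) < c" by simp
    obtain L where L: "L \<in> carrier_mat (poly_rank (D @\<^sub>r P)) n" "row_span L = row_span (D @\<^sub>r P)"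
      by (rule row_basis[OF DP])
    let ?L = "L @\<^sub>r mat_of_row l"
    have L': "?L \<in> carrier_mat (poly_rank (D @\<^sub>r P) + 1) n"
      by (rule carrier_append_rows[OF L(1) mat_of_row_carrier_mat[OF l]])
    have "u + a \<cdot>\<^sub>v l \<in> row_span ?L" if "u \<in> row_span (D @\<^sub>r P)" for u a
      using row_span_append_row_iff[OF L(1) l] L(2) that by blast
    note in_span = this
    have DP_in: "u \<in> row_span ?L" if "u \<in> row_span (D @\<^sub>r P)" for u
    proof -
      have "u \<in> carrier_vec n" using that DP by (elim row_spanE[of _ _ "c + p" n]) auto
      then have "u + 0 \<cdot>\<^sub>v l = u" using l by (intro eq_vecI) auto
      then show ?thesis using in_span[OF that, of 0] by simp
    qed
    have l_in: "l \<in> row_span ?L"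
    proof -
      have "0\<^sub>v n \<in> row_span (D @\<^sub>r P)" using submodule_row_span[OF DP] by (simp add: submodule_of_def)
      moreover have "0\<^sub>v n + 1 \<cdot>\<^sub>v l = l" using l by simp
      ultimately show ?thesis using in_span[of "0\<^sub>v n" 1] by simp
    qed
    have "row (C @\<^sub>r P) i \<in> saturation ?L" if "i < Suc c + p" for i
    proof (rule rows_CP[OF that])
      show "row D k \<in> saturation ?L" if "k < c" for k
        using DP_in row_in_row_span[OF DP, of k] row_top[OF D that] that row_span_subset_saturation[OF L'] by auto
      show "row P k \<in> saturation ?L" if "k < p" for k
        using DP_in row_in_row_span[OF DP, of "c + k"] row_bot[OF D that] that row_span_subset_saturation[OF L'] by auto
      show "l \<in> saturation ?L" using l_in row_span_subset_saturation[OF L'] by blast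
    qed
    then have "poly_rank (C @\<^sub>r P) \<le> poly_rank (D @\<^sub>r P) + 1"
      by (rule poly_rank_le_if_saturated[OF CP L'])
    then show False using lt Suc.prems(2) by simp
  qed
  then obtain V where V: "V \<in> carrier_mat c p" "indep_rows (D + V * P)" using Suc.IH[OF D] by blast
  define M where "M = D + V * P"
  have M: "M \<in> carrier_mat c n" using D V P by (auto simp: M_def)
  have indM: "indep_rows M" using V by (simp add: M_def)
  have extend: ?case
    if w: "w \<in> carrier_vec p" and no: "\<And>a. a \<cdot>\<^sub>v (l + w \<star> P) \<in> row_span M \<Longrightarrow> a = 0" for w
  proof -
    define V' where "V' = mat (Suc c) p (\<lambda>(i, k). if i < c then V $$ (i, k) else w $ k)"
    have V': "V' \<in> carrier_mat (Suc c) p" by (simp add: V'_def)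
    have lw: "l + w \<star> P \<in> carrier_vec n" using l P by auto
    have R: "M @\<^sub>r mat_of_row (l + w \<star> P) \<in> carrier_mat (c + 1) n"
      by (rule carrier_append_rows[OF M mat_of_row_carrier_mat[OF lw]])
    have "C + V' * P = M @\<^sub>r mat_of_row (l + w \<star> P)"
    proof (rule eq_matI)
      fix i j assume "i < dim_row (M @\<^sub>r mat_of_row (l + w \<star> P))" "j < dim_col (M @\<^sub>r mat_of_row (l + w \<star> P))"
      then have ij: "i < c + 1" "j < n" using R by auto
      then have "(C + V' * P) $$ (i, j) = C $$ (i, j) + (\<Sum>k<p. V' $$ (i, k) * P $$ (k, j))"
        using C V' P by (simp add: scalar_prod_def lessThan_atLeast0)
      also have "\<dots> = (M @\<^sub>r mat_of_row (l + w \<star> P)) $$ (i, j)"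
        unfolding append_rows_index[OF M mat_of_row_carrier_mat[OF lw] ij]
        using ij V(1) D P C l row_mult_index[OF w P, of j]
        by (cases "i < c") (auto simp: V'_def M_def D_def l_def mat_of_row_def scalar_prod_def
            lessThan_atLeast0 less_Suc_eq)
      finally show "(C + V' * P) $$ (i, j) = (M @\<^sub>r mat_of_row (l + w \<star> P)) $$ (i, j)" .
    qed (use C V' P R in auto)
    moreover have "indep_rows (M @\<^sub>r mat_of_row (l + w \<star> P))"
      by (rule indep_rows_append_row[OF M lw indM no])
    ultimately show ?case using V' by (intro bexI[of _ V']) auto
  qed
  show ?case
  proof (rule ccontr)
    assume contra: "\<not> ?case"
    have sat: "l + w \<star> P \<in> saturation M" if w: "w \<in> carrier_vec p" for w
    proof -
      obtain a where "a \<cdot>\<^sub>v (l + w \<star> P) \<in> row_span M" "a \<noteq> 0" using contra extend[OF w] by blast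
      then show ?thesis using l P M by (intro saturation_cancel) auto
    qed
    have sub: "submodule_of n (saturation M)" by (rule submodule_saturation[OF M])
    have diff: "v - w \<in> saturation M" if "v \<in> saturation M" "w \<in> saturation M" for v w
    proof -
      have "v \<in> carrier_vec n" "w \<in> carrier_vec n" using that sub by (auto simp: submodule_of_def)
      then have "v - w = v + (-1) \<cdot>\<^sub>v w" by (intro eq_vecI) auto
      then show ?thesis using that sub by (simp add: submodule_of_def)
    qed
    have lsat: "l \<in> saturation M" using sat[of "0\<^sub>v p"] l P by simp
    have Psat: "row P k \<in> saturation M" if "k < p" for k
    proof -
      have "l + row P k \<in> saturation M" using sat[of "unit_vec p k"] row_mult_unit[OF P that] by simp
      then have "(l + row P k) - l \<in> saturation M" using diff lsat by blast
      moreover have "(l + row P k) - l = row P k" using l P that by (intro eq_vecI) auto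
      ultimately show ?thesis by simp
    qed
    have Dsat: "row D i \<in> saturation M" if "i < c" for i
    proof -
      have "row V i \<star> P \<in> saturation M"
        using row_span_subset_submodule[OF P sub Psat] row_spanI[of "row V i" p P n] V(1) P that by auto
      moreover have "row M i \<in> saturation M"
        using row_in_row_span[OF M that] row_span_subset_saturation[OF M] by blast
      moreover have "row M i - row V i \<star> P = row D i"
        using that V(1) D P by (intro eq_vecI)
          (auto simp: M_def row_mult_index[of _ p P n] scalar_prod_def lessThan_atLeast0)
      ultimately show ?thesis using diff by metis
    qed
    have "poly_rank (C @\<^sub>r P) \<le> c"
      by (rule poly_rank_le_if_saturated[OF CP M]) (rule rows_CP[OF _ Dsat lsat Psat])
    then show False using Suc.prems(2) by simp
  qed
qed

text \<open>A minimal set \<open>J\<close> of columns on which the rows stay independent has exactly \<open>c\<close> elements. Fewer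
columns leave a nonzero row vector in the kernel. By minimality, each column in \<open>J\<close> has a row
vector detected by this column alone; these vectors are independent in a module of rank \<open>c\<close>.\<close>

lemma indep_rows_column_selection:
  fixes M :: "'a :: idom mat"
  assumes M: "M \<in> carrier_mat c n" and ind: "indep_rows M"
  obtains J where "J \<subseteq> {..<n}" "card J = c"
    "\<And>v. v \<in> carrier_vec c \<Longrightarrow> (\<And>j. j \<in> J \<Longrightarrow> (v \<star> M) $ j = 0) \<Longrightarrow> v = 0\<^sub>v c"
proof -
  define good where "good J \<longleftrightarrow> J \<subseteq> {..<n} \<and>
    (\<forall>v\<in>carrier_vec c. (\<forall>j\<in>J. (v \<star> M) $ j = 0) \<longrightarrow> v = 0\<^sub>v c)" for J
  have "good {..<n}"
    unfolding good_def
  proof (intro conjI ballI impI subset_refl)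
    fix v assume v: "v \<in> carrier_vec c" "\<forall>j\<in>{..<n}. (v \<star> M) $ j = 0"
    then have "v \<star> M = 0\<^sub>v n" using M by (intro eq_vecI) auto
    then show "v = 0\<^sub>v c" by (rule indep_rowsD[OF ind M v(1)])
  qed
  from ex_has_least_nat[of good, OF this, of card]
  obtain J where "good J \<and> (\<forall>J'. good J' \<longrightarrow> card J \<le> card J')" ..
  then have J: "good J" and min: "\<And>J'. good J' \<Longrightarrow> card J \<le> card J'" by simp_all
  have sub: "J \<subseteq> {..<n}" and inj: "\<And>v. v \<in> carrier_vec c \<Longrightarrow> (\<And>j. j \<in> J \<Longrightarrow> (v \<star> M) $ j = 0) \<Longrightarrow> v = 0\<^sub>v c"
    using J by (auto simp: good_def)
  have fin: "finite J" using sub finite_subset by blast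
  obtain e where e: "bij_betw e {..<card J} J"
    using ex_bij_betw_nat_finite[OF fin] by (auto simp: lessThan_atLeast0)
  have eJ: "e i \<in> J" "e i < n" if "i < card J" for i
    using e that sub by (auto simp: bij_betw_def)
  have "c \<le> card J"
  proof (rule ccontr)
    assume "\<not> c \<le> card J"
    then have lt: "card J < c" by simp
    define N where "N = mat c (card J) (\<lambda>(i, k). M $$ (i, e k))"
    have N: "N \<in> carrier_mat c (card J)" by (simp add: N_def)
    obtain v where v: "v \<in> carrier_vec c" "v \<noteq> 0\<^sub>v c" "v \<star> N = 0\<^sub>v (card J)"
      by (rule tall_matrix_left_kernel[OF N lt])
    have "(v \<star> M) $ e k = (v \<star> N) $ k" if "k < card J" for k
      unfolding row_mult_index[OF v(1) M eJ(2)[OF that]] row_mult_index[OF v(1) N that]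
      using that by (simp add: N_def)
    then have "(v \<star> M) $ e k = 0" if "k < card J" for k using that v(3) by simp
    moreover have "\<exists>k<card J. j = e k" if "j \<in> J" for j
      using bij_betw_imp_surj_on[OF e] that by blast
    ultimately have "(v \<star> M) $ j = 0" if "j \<in> J" for j using that by metis
    then show False using inj[OF v(1)] v(2) by blast
  qed
  moreover have "card J \<le> c"
  proof (rule ccontr)
    assume "\<not> card J \<le> c"
    then have lt: "c < card J" by simp
    have "\<exists>v. v \<in> carrier_vec c \<and> (\<forall>k\<in>J - {j}. (v \<star> M) $ k = 0) \<and> (v \<star> M) $ j \<noteq> 0" if "j \<in> J" for j
    proof -
      have "card (J - {j}) < card J" using that fin by (meson card_Diff1_less)
      then have "\<not> good (J - {j})" using min not_less by blast
      then obtain v where "v \<in> carrier_vec c" "\<forall>k\<in>J - {j}. (v \<star> M) $ k = 0" "v \<noteq> 0\<^sub>v c"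
        using sub by (auto simp: good_def)
      then show ?thesis using inj[of v] by blast
    qed
    then obtain f where f: "\<And>j. j \<in> J \<Longrightarrow>
      f j \<in> carrier_vec c \<and> (\<forall>k\<in>J - {j}. (f j \<star> M) $ k = 0) \<and> (f j \<star> M) $ j \<noteq> 0" by metis
    define F where "F = mat (card J) c (\<lambda>(i, k). f (e i) $ k)"
    have F: "F \<in> carrier_mat (card J) c" by (simp add: F_def)
    obtain a where a: "a \<in> carrier_vec (card J)" "a \<noteq> 0\<^sub>v (card J)" "a \<star> F = 0\<^sub>v c"
      by (rule tall_matrix_left_kernel[OF F lt])
    have FM: "F * M \<in> carrier_mat (card J) n" using F M by auto
    have zero: "a \<star> (F * M) = 0\<^sub>v n" using a M by (simp add: row_mult_assoc[OF a(1) F M])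
    have entry: "(F * M) $$ (k, j) = (f (e k) \<star> M) $ j" if "k < card J" "j < n" for k j
    proof -
      have fc: "f (e k) \<in> carrier_vec c" using f[OF eJ(1)[OF that(1)]] by blast
      show ?thesis
        unfolding row_mult_index[OF fc M that(2)]
        using that F M by (simp add: scalar_prod_def lessThan_atLeast0 F_def)
    qed
    have "a $ i = 0" if i: "i < card J" for i
    proof -
      have other: "(F * M) $$ (k, e i) = 0" if "k < card J" "k \<noteq> i" for k
      proof -
        have "e k \<noteq> e i" using e that i by (auto simp: bij_betw_def inj_on_def)
        then show ?thesis using entry[OF that(1) eJ(2)[OF i]] f[OF eJ(1)[OF that(1)]] eJ(1)[OF i] by auto
      qed
      have "0 = (a \<star> (F * M)) $ e i" using zero eJ(2)[OF i] by simp
      also have "\<dots> = (\<Sum>k<card J. a $ k * (F * M) $$ (k, e i))"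
        by (rule row_mult_index[OF a(1) FM eJ(2)[OF i]])
      also have "\<dots> = (\<Sum>k<card J. if k = i then a $ i * (F * M) $$ (i, e i) else 0)"
        by (intro sum.cong) (auto simp: other)
      also have "\<dots> = a $ i * (f (e i) \<star> M) $ e i" using i entry[OF i eJ(2)[OF i]] by simp
      finally show ?thesis using f[OF eJ(1)[OF i]] by auto
    qed
    then have "a = 0\<^sub>v (card J)" using a(1) by (intro eq_vecI) simp_all
    then show False using a(2) by blast
  qed
  ultimately have "card J = c" by simp
  from that[OF sub this inj] show ?thesis by blast
qed

lemma indep_rows_submatrix_iff:
  assumes A: "A \<in> carrier_mat g q" and J: "J \<subseteq> {..<q}"
  shows "submatrix A UNIV J \<in> carrier_mat g (card J)"
    and "indep_rows (submatrix A UNIV J) \<longleftrightarrow>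
      (\<forall>v\<in>carrier_vec g. (\<forall>j\<in>J. (v \<star> A) $ j = 0) \<longrightarrow> v = 0\<^sub>v g)"
proof -
  have fin: "finite J" using J finite_subset by blast
  have J': "{j. j < q \<and> j \<in> J} = J" using J by auto
  show sub: "submatrix A UNIV J \<in> carrier_mat g (card J)"
    using carrier_matD[OF A] by (intro carrier_matI) (simp_all add: dim_submatrix J')
  have pick: "pick J k \<in> J" if "k < card J" for k using that by (rule pick_in_set_le)
  have idx: "(v \<star> submatrix A UNIV J) $ k = (v \<star> A) $ pick J k"
    if "v \<in> carrier_vec g" "k < card J" for v k
  proof -
    have "pick J k < q" using pick[OF that(2)] J by auto
    moreover have "submatrix A UNIV J $$ (i, k) = A $$ (i, pick J k)" if "i < g" for i
      using submatrix_index[of i A UNIV k J] that \<open>k < card J\<close> carrier_matD[OF A]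
      by (simp add: pick_UNIV J')
    ultimately show ?thesis
      using that by (simp add: row_mult_index[OF _ A] row_mult_index[OF _ sub])
  qed
  have "v \<star> submatrix A UNIV J = 0\<^sub>v (card J) \<longleftrightarrow> (\<forall>j\<in>J. (v \<star> A) $ j = 0)" if v: "v \<in> carrier_vec g" for v
  proof
    assume z: "v \<star> submatrix A UNIV J = 0\<^sub>v (card J)"
    show "\<forall>j\<in>J. (v \<star> A) $ j = 0"
    proof
      fix j assume j: "j \<in> J"
      let ?k = "card {a\<in>J. a < j}"
      have "{a\<in>J. a < j} \<subset> J" using j by auto
      then have "?k < card J" using fin by (rule psubset_card_mono[rotated])
      then show "(v \<star> A) $ j = 0" using idx[OF v, of ?k] pick_card_in_set[OF j] z by simp
    qed
  next
    assume "\<forall>j\<in>J. (v \<star> A) $ j = 0"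
    then show "v \<star> submatrix A UNIV J = 0\<^sub>v (card J)"
      using idx[OF v] pick sub by (intro eq_vecI) auto
  qed
  then show "indep_rows (submatrix A UNIV J) \<longleftrightarrow>
      (\<forall>v\<in>carrier_vec g. (\<forall>j\<in>J. (v \<star> A) $ j = 0) \<longrightarrow> v = 0\<^sub>v g)"
    using sub by (auto simp: indep_rows_def)
qed

section \<open>Plants and controllers\<close>

lemma mat_split_cols:
  assumes "M \<in> carrier_mat c (n + m)"
  obtains M1 M2 where "M1 \<in> carrier_mat c n" "M2 \<in> carrier_mat c m" "M = M1 @\<^sub>c M2"
proof (rule that[of "mat c n (\<lambda>(i, j). M $$ (i, j))" "mat c m (\<lambda>(i, j). M $$ (i, n + j))"])
  let ?M = "mat c n (\<lambda>(i, j). M $$ (i, j)) @\<^sub>c mat c m (\<lambda>(i, j). M $$ (i, n + j))"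
  have M': "?M \<in> carrier_mat c (n + m)" by (rule append_cols_carrier) auto
  show "M = ?M"
  proof (rule eq_matI)
    fix i j assume "i < dim_row ?M" "j < dim_col ?M"
    then have ij: "i < c" "j < n + m" using carrier_matD[OF M'] by simp_all
    then show "M $$ (i, j) = ?M $$ (i, j)"
      by (subst append_cols_index[of _ c n _ m]) auto
  qed (use assms carrier_matD[OF M'] in auto)
qed auto

lemma row_span_append_rows_iff:
  assumes A: "A \<in> carrier_mat g n" and B: "B \<in> carrier_mat h n"
  shows "l \<in> row_span (A @\<^sub>r B) \<longleftrightarrow> (\<exists>u\<in>row_span A. \<exists>v\<in>row_span B. l = u + v)"
proof
  have AB: "A @\<^sub>r B \<in> carrier_mat (g + h) n" using A B by auto
  {
    assume "l \<in> row_span (A @\<^sub>r B)"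
    then obtain w where w: "w \<in> carrier_vec (g + h)" "l = w \<star> (A @\<^sub>r B)" using AB by (elim row_spanE)
    from w(1) obtain w1 w2 where w12: "w1 \<in> carrier_vec g" "w2 \<in> carrier_vec h" "w = w1 @\<^sub>v w2"
      by (elim vec_split)
    then show "\<exists>u\<in>row_span A. \<exists>v\<in>row_span B. l = u + v"
      using w row_mult_append_rows[OF A B w12(1,2)] row_spanI[OF w12(1) A] row_spanI[OF w12(2) B] by auto
  next
    assume "\<exists>u\<in>row_span A. \<exists>v\<in>row_span B. l = u + v"
    then obtain w1 w2 where w12: "w1 \<in> carrier_vec g" "w2 \<in> carrier_vec h" "l = w1 \<star> A + w2 \<star> B"
      using A B by (auto elim!: row_spanE)
    then show "l \<in> row_span (A @\<^sub>r B)"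
      using row_spanI[OF append_carrier_vec[OF w12(1,2)] AB] row_mult_append_rows[OF A B w12(1,2)] by simp
  }
qed

lemma vec_add_eq_zeroD:
  fixes u v :: "'a :: comm_ring_1 vec"
  assumes "u + v = 0\<^sub>v n" "u \<in> carrier_vec n" "v \<in> carrier_vec n"
  shows "v = - u"
proof (rule eq_vecI)
  fix j assume "j < dim_vec (- u)"
  then have j: "j < n" using assms by simp
  then have "(u + v) $ j = 0" by (simp only: assms(1) index_zero_vec)
  then show "v $ j = (- u) $ j" using j assms(2,3) by (simp add: eq_neg_iff_add_eq_0 add.commute)
qed (use assms in auto)

text \<open>With \<open>F\<close> replaced by a basis of its row module, rank additivity says that the stacked matrix has
full row rank, that is, that the two row modules meet only in zero.\<close>

lemma poly_rank_append_rows_iff: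
  assumes F: "F \<in> carrier_mat a n" and G: "G \<in> carrier_mat c n" and ind: "indep_rows G"
  shows "poly_rank (F @\<^sub>r G) = poly_rank F + c \<longleftrightarrow>
    (\<forall>v\<in>carrier_vec c. v \<star> G \<in> row_span F \<longrightarrow> v = 0\<^sub>v c)"
proof -
  let ?r = "poly_rank F"
  obtain L where L: "L \<in> carrier_mat ?r n" "indep_rows L" "row_span L = row_span F"
    by (rule row_basis[OF F])
  have FG: "F @\<^sub>r G \<in> carrier_mat (a + c) n" using F G by auto
  have LG: "L @\<^sub>r G \<in> carrier_mat (?r + c) n" using L(1) G by auto
  have "row_span (F @\<^sub>r G) = row_span (L @\<^sub>r G)"
    using row_span_append_rows_iff[OF F G] row_span_append_rows_iff[OF L(1) G] L(3) by blast
  then have "poly_rank (F @\<^sub>r G) = poly_rank (L @\<^sub>r G)" by (rule poly_rank_row_span_cong[OF FG LG])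
  then have "poly_rank (F @\<^sub>r G) = ?r + c \<longleftrightarrow> indep_rows (L @\<^sub>r G)"
    using full_row_rank_iff_indep_rows[OF LG] carrier_matD(1)[OF LG] by (simp add: full_row_rank_def)
  also have "\<dots> \<longleftrightarrow> (\<forall>v\<in>carrier_vec c. v \<star> G \<in> row_span F \<longrightarrow> v = 0\<^sub>v c)"
  proof (intro iffI ballI impI)
    fix v assume i: "indep_rows (L @\<^sub>r G)" and v: "v \<in> carrier_vec c" "v \<star> G \<in> row_span F"
    then have "v \<star> G \<in> row_span L" using L(3) by simp
    then obtain x where x: "x \<in> carrier_vec ?r" "v \<star> G = x \<star> L" using L(1) by (elim row_spanE)
    have "((- x) @\<^sub>v v) \<star> (L @\<^sub>r G) = (- x) \<star> L + v \<star> G"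
      by (rule row_mult_append_rows[OF L(1) G]) (use x v in auto)
    also have "\<dots> = 0\<^sub>v n" using x L(1) by (simp add: row_mult_uminus[OF x(1) L(1)])
    finally have "(- x) @\<^sub>v v = 0\<^sub>v (?r + c)"
      using x v by (intro indep_rowsD[OF i LG]) auto
    then show "v = 0\<^sub>v c" using append_vec_zero_iff[of "- x" ?r v c] x by simp
  next
    assume inj: "\<forall>v\<in>carrier_vec c. v \<star> G \<in> row_span F \<longrightarrow> v = 0\<^sub>v c"
    show "indep_rows (L @\<^sub>r G)"
    proof (rule indep_rowsI[OF LG])
      fix w assume w: "w \<in> carrier_vec (?r + c)" "w \<star> (L @\<^sub>r G) = 0\<^sub>v n"
      from w(1) obtain x v where xv: "x \<in> carrier_vec ?r" "v \<in> carrier_vec c" "w = x @\<^sub>v v"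
        by (elim vec_split)
      have eq: "x \<star> L + v \<star> G = 0\<^sub>v n" using w row_mult_append_rows[OF L(1) G xv(1,2)] xv(3) by simp
      have "v \<star> G = - (x \<star> L)" by (rule vec_add_eq_zeroD[OF eq]) (use L G in auto)
      also have "\<dots> = (- x) \<star> L" using row_mult_uminus[OF xv(1) L(1)] by simp
      finally have "v \<star> G \<in> row_span F" using row_spanI[of "- x" ?r L n] xv L by simp
      then have v: "v = 0\<^sub>v c" using inj xv(2) by blast
      then have "x \<star> L = 0\<^sub>v n" using eq G L(1) by simp
      then have "x = 0\<^sub>v ?r" by (rule indep_rowsD[OF L(2,1) xv(1)])
      then show "w = 0\<^sub>v (?r + c)" using v xv append_vec_zero_iff[OF xv(1), of v c] by blast
    qed
  qed
  finally show ?thesis .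
qed

lemma stack_diff:
  assumes "x \<in> signals n" "x' \<in> signals n" "z \<in> signals m" "z' \<in> signals m"
  shows "(\<lambda>t. (x \<oplus>\<^sub>s z) t - (x' \<oplus>\<^sub>s z') t) = (\<lambda>t. x t - x' t) \<oplus>\<^sub>s (\<lambda>t. z t - z' t)"
  using assms by (intro ext eq_vecI) (auto simp: stack_def signalsD)

locale plant =
  fixes R P Q :: "real poly mat" and g nw nu ny :: nat
  assumes R: "R \<in> carrier_mat g nw" and P: "P \<in> carrier_mat g nu" and Q: "Q \<in> carrier_mat g ny"
begin

abbreviation "q \<equiv> nu + ny"
abbreviation "T \<equiv> P @\<^sub>c Q"
abbreviation "full \<equiv> plant_full R P Q"
abbreviation "manifest \<equiv> control_manifest R P Q"
abbreviation "can S \<equiv> canonical_controller R P Q S"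

text \<open>The equations on the control variables implied by the plant after elimination of \<open>w\<close>.\<close>

definition manifest_rows :: "real poly vec set" where
  "manifest_rows = {w \<star> T | w. w \<in> carrier_vec g \<and> w \<star> R = 0\<^sub>v nw}"

text \<open>Regularity in terms of row modules: the controller imposes no equation that the plant already
imposes on the control variables.\<close>

definition regular_rows :: "real poly mat \<Rightarrow> bool" where
  "regular_rows M \<longleftrightarrow> indep_rows M \<and> row_span M \<inter> manifest_rows \<subseteq> {0\<^sub>v q}"

lemma T: "T \<in> carrier_mat g q" using P Q by auto
lemma dims: "dim_col R = nw" "dim_col P = nu" "dim_col Q = ny" using R P Q by auto
lemma RT: "R @\<^sub>c T \<in> carrier_mat g (nw + q)" using R T by auto
lemma full_eq: "full = ker_ddt (R @\<^sub>c T)" by (simp add: plant_full_def)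

lemma full_diff:
  assumes "w \<in> signals nw" "w' \<in> signals nw" "c \<in> signals q" "c' \<in> signals q"
    and "w \<oplus>\<^sub>s c \<in> full" "w' \<oplus>\<^sub>s c' \<in> full"
  shows "(\<lambda>t. w t - w' t) \<oplus>\<^sub>s (\<lambda>t. c t - c' t) \<in> full"
  using ker_ddt_diff[OF assms(5,6)[unfolded full_eq]] stack_diff[OF assms(1-4)] full_eq by simp

lemma full_zero: "(\<lambda>t. 0\<^sub>v nw) \<oplus>\<^sub>s c \<in> full \<longleftrightarrow> c \<in> ker_ddt T" if "c \<in> signals q"
proof -
  have "(\<lambda>t. 0\<^sub>v nw) \<oplus>\<^sub>s c \<in> full \<longleftrightarrow> (\<forall>w\<in>carrier_vec g. row_ddt (w \<star> T) c = (\<lambda>t. 0))"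
    unfolding full_eq mem_ker_ddt_append_cols[OF R T zero_signal that]
    using R by (simp add: fun_eq_iff row_ddt_zero_signal[OF row_mult_carrier[OF R]])
  then show ?thesis using ker_ddt_row[OF T, of c] ker_ddt_rowI[OF T that] by auto
qed

lemma pairs: "(\<exists>u y. c = u \<oplus>\<^sub>s y \<and> u \<in> signals nu \<and> y \<in> signals ny) \<longleftrightarrow> c \<in> signals q"
proof
  assume "c \<in> signals q"
  then show "\<exists>u y. c = u \<oplus>\<^sub>s y \<and> u \<in> signals nu \<and> y \<in> signals ny"
    by (elim signals_split) auto
qed (auto intro: stack_signals)

lemma mem_manifest: "c \<in> manifest \<longleftrightarrow> c \<in> signals q \<and> (\<exists>w\<in>signals nw. w \<oplus>\<^sub>s c \<in> full)"
  unfolding control_manifest_def dims pairs[of c, symmetric] by auto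

lemma mem_can: "c \<in> can S \<longleftrightarrow> c \<in> signals q \<and> (\<exists>w\<in>S. w \<oplus>\<^sub>s c \<in> full)"
  unfolding canonical_controller_def dims pairs[of c, symmetric] by auto

lemma implements_iff:
  assumes "C \<subseteq> signals q"
  shows "implements R P Q C S \<longleftrightarrow> {w \<in> signals nw. \<exists>c\<in>C. w \<oplus>\<^sub>s c \<in> full} = S"
proof -
  have "(\<exists>u\<in>signals nu. \<exists>y\<in>signals ny. u \<oplus>\<^sub>s y \<in> C \<and> w \<oplus>\<^sub>s u \<oplus>\<^sub>s y \<in> full)
      \<longleftrightarrow> (\<exists>c\<in>C. w \<oplus>\<^sub>s c \<in> full)" for w
  proof
    assume "\<exists>c\<in>C. w \<oplus>\<^sub>s c \<in> full"
    then obtain c where c: "c \<in> C" "w \<oplus>\<^sub>s c \<in> full" by blast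
    then have "c \<in> signals q" using assms by blast
    then obtain u y where "u \<in> signals nu" "y \<in> signals ny" "c = u \<oplus>\<^sub>s y" by (elim signals_split)
    then show "\<exists>u\<in>signals nu. \<exists>y\<in>signals ny. u \<oplus>\<^sub>s y \<in> C \<and> w \<oplus>\<^sub>s u \<oplus>\<^sub>s y \<in> full" using c by blast
  qed blast
  then show ?thesis unfolding implements_def dims by simp
qed

lemma manifest_rowsI: "w \<in> carrier_vec g \<Longrightarrow> w \<star> R = 0\<^sub>v nw \<Longrightarrow> w \<star> T \<in> manifest_rows"
  unfolding manifest_rows_def by blast

lemma submodule_manifest_rows: "submodule_of q manifest_rows"
proof (rule submodule_ofI)
  show "manifest_rows \<subseteq> carrier_vec q" using T by (auto simp: manifest_rows_def)
  show "0\<^sub>v q \<in> manifest_rows" using manifest_rowsI[of "0\<^sub>v g"] R T by simp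
  fix v assume "v \<in> manifest_rows"
  then obtain x where x: "x \<in> carrier_vec g" "x \<star> R = 0\<^sub>v nw" "v = x \<star> T"
    unfolding manifest_rows_def by blast
  have "(a \<cdot>\<^sub>v x) \<star> R = 0\<^sub>v nw" for a
    unfolding row_mult_smult[OF x(1) R] x(2) by (intro eq_vecI) auto
  then show "a \<cdot>\<^sub>v v \<in> manifest_rows" for a
    using manifest_rowsI[of "a \<cdot>\<^sub>v x"] x(1) by (simp add: x(3) row_mult_smult[OF x(1) T])
  fix v' assume "v' \<in> manifest_rows"
  then obtain x' where x': "x' \<in> carrier_vec g" "x' \<star> R = 0\<^sub>v nw" "v' = x' \<star> T"
    unfolding manifest_rows_def by blast
  have "(x + x') \<star> R = 0\<^sub>v nw" unfolding row_mult_add[OF x(1) x'(1) R] x(2) x'(2) by simp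
  then show "v + v' \<in> manifest_rows"
    using manifest_rowsI[of "x + x'"] x(1) x'(1) by (simp add: x(3) x'(3) row_mult_add[OF x(1) x'(1) T])
qed

lemma mem_manifest_rows:
  "c \<in> manifest \<longleftrightarrow> c \<in> signals q \<and> (\<forall>l\<in>manifest_rows. row_ddt l c = (\<lambda>t. 0))"
proof (cases "c \<in> signals q")
  case True
  have "c \<in> manifest \<longleftrightarrow> (\<forall>w\<in>carrier_vec g. w \<star> R = 0\<^sub>v nw \<longrightarrow> row_ddt (w \<star> T) c = (\<lambda>t. 0))"
    unfolding mem_manifest full_eq using elimination[OF R T True] True by simp
  then show ?thesis using True unfolding manifest_rows_def by blast
qed (simp add: mem_manifest)

lemma row_span_manifest:
  assumes N: "N \<in> carrier_mat p q" and eq: "manifest = ker_ddt N"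
  shows "row_span N = manifest_rows"
proof -
  obtain r L where L: "L \<in> carrier_mat r q" "row_span L = manifest_rows"
    by (rule submodule_has_basis[OF submodule_manifest_rows])
  have "c \<in> ker_ddt L \<longleftrightarrow> c \<in> manifest" for c
    unfolding mem_ker_ddt[OF L(1)] mem_manifest_rows L(2) ..
  then have "ker_ddt N = ker_ddt L" using eq by blast
  then show ?thesis using ker_ddt_eq_iff[OF N L(1)] L(2) by simp
qed

text \<open>A combination of the rows \<open>[0 M]\<close> that is also one of the rows \<open>[R P Q]\<close> is an element of the
row module of \<open>M\<close> that arises from the plant by eliminating \<open>w\<close>.\<close>

lemma rank_regular_iff:
  assumes M: "M \<in> carrier_mat c q" and ind: "indep_rows M"
  shows "poly_rank ((R @\<^sub>c T) @\<^sub>r (0\<^sub>m c nw @\<^sub>c M)) = poly_rank (R @\<^sub>c T) + poly_rank M \<longleftrightarrow> regular_rows M"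
proof -
  let ?G = "0\<^sub>m c nw @\<^sub>c M"
  have G: "?G \<in> carrier_mat c (nw + q)" using M by auto
  have vG: "v \<star> ?G = 0\<^sub>v nw @\<^sub>v v \<star> M" if "v \<in> carrier_vec c" for v
    using row_mult_append_cols[OF zero_carrier_mat M that] that by simp
  have "indep_rows ?G"
  proof (rule indep_rowsI[OF G])
    fix v assume v: "v \<in> carrier_vec c" "v \<star> ?G = 0\<^sub>v (nw + q)"
    then have "v \<star> M = 0\<^sub>v q" using append_vec_zero_iff[of "0\<^sub>v nw" nw "v \<star> M" q] by (simp add: vG)
    then show "v = 0\<^sub>v c" by (rule indep_rowsD[OF ind M v(1)])
  qed
  then have "poly_rank ((R @\<^sub>c T) @\<^sub>r ?G) = poly_rank (R @\<^sub>c T) + c \<longleftrightarrow>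
      (\<forall>v\<in>carrier_vec c. v \<star> ?G \<in> row_span (R @\<^sub>c T) \<longrightarrow> v = 0\<^sub>v c)"
    by (rule poly_rank_append_rows_iff[OF RT G])
  also have "\<dots> \<longleftrightarrow> (\<forall>v\<in>carrier_vec c. v \<star> M \<in> manifest_rows \<longrightarrow> v = 0\<^sub>v c)"
  proof -
    have "v \<star> ?G \<in> row_span (R @\<^sub>c T) \<longleftrightarrow> v \<star> M \<in> manifest_rows" if v: "v \<in> carrier_vec c" for v
    proof -
      have "v \<star> ?G = w \<star> (R @\<^sub>c T) \<longleftrightarrow> w \<star> R = 0\<^sub>v nw \<and> v \<star> M = w \<star> T" if "w \<in> carrier_vec g" for w
        unfolding vG[OF v] row_mult_append_cols[OF R T that]
        using append_vec_eq[of "0\<^sub>v nw" nw "w \<star> R"] R by auto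
      then show ?thesis unfolding row_span_def manifest_rows_def using carrier_matD(1)[OF RT] by auto
    qed
    then show ?thesis by blast
  qed
  also have "\<dots> \<longleftrightarrow> regular_rows M"
  proof
    assume inj: "\<forall>v\<in>carrier_vec c. v \<star> M \<in> manifest_rows \<longrightarrow> v = 0\<^sub>v c"
    have "l = 0\<^sub>v q" if "l \<in> row_span M" "l \<in> manifest_rows" for l
      using that inj M by (auto elim!: row_spanE)
    then show "regular_rows M" using ind by (auto simp: regular_rows_def)
  next
    assume reg: "regular_rows M"
    show "\<forall>v\<in>carrier_vec c. v \<star> M \<in> manifest_rows \<longrightarrow> v = 0\<^sub>v c"
    proof (intro ballI impI)
      fix v assume v: "v \<in> carrier_vec c" "v \<star> M \<in> manifest_rows"
      then have "v \<star> M = 0\<^sub>v q" using reg row_spanI[OF v(1) M] by (auto simp: regular_rows_def)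
      then show "v = 0\<^sub>v c" by (rule indep_rowsD[OF ind M v(1)])
    qed
  qed
  finally show ?thesis
    using full_row_rank_iff_indep_rows[OF M] ind carrier_matD(1)[OF M] by (simp add: full_row_rank_def)
qed

lemma regular_controller_if_rows:
  assumes M: "M \<in> carrier_mat c q" and reg: "regular_rows M"
  shows "regular_controller R P Q (ker_ddt M)"
proof -
  have ind: "indep_rows M" using reg by (simp add: regular_rows_def)
  obtain C1 C2 where C: "C1 \<in> carrier_mat c nu" "C2 \<in> carrier_mat c ny" "M = C1 @\<^sub>c C2"
    by (rule mat_split_cols[OF M])
  show ?thesis
    unfolding regular_controller_def dims
    using C rank_regular_iff[OF M ind] reg full_row_rank_iff_indep_rows[OF M] ind by blast
qed

lemma regular_controllerE:
  assumes "regular_controller R P Q C"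
  obtains c M where "M \<in> carrier_mat c q" "C = ker_ddt M" "regular_rows M"
proof -
  obtain c C1 C2 where C: "C1 \<in> carrier_mat c nu" "C2 \<in> carrier_mat c ny"
    "full_row_rank (C1 @\<^sub>c C2)" "C = ker_ddt (C1 @\<^sub>c C2)"
    "poly_rank ((R @\<^sub>c T) @\<^sub>r (0\<^sub>m c nw @\<^sub>c C1 @\<^sub>c C2)) = poly_rank (R @\<^sub>c T) + poly_rank (C1 @\<^sub>c C2)"
    using assms unfolding regular_controller_def dims by blast
  have M: "C1 @\<^sub>c C2 \<in> carrier_mat c q" using C by auto
  show ?thesis
    using that[OF M C(4)] rank_regular_iff[OF M] C(3,5) full_row_rank_iff_indep_rows[OF M] by blast
qed

lemma regular_controller_rows:
  assumes M: "M \<in> carrier_mat c q" and full: "full_row_rank M"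
    and reg: "regular_controller R P Q (ker_ddt M)"
  shows "regular_rows M"
proof -
  obtain c' M' where M': "M' \<in> carrier_mat c' q" "ker_ddt M = ker_ddt M'" "regular_rows M'"
    by (rule regular_controllerE[OF reg])
  then have "row_span M = row_span M'" using ker_ddt_eq_iff[OF M M'(1)] by blast
  then show ?thesis
    using M'(3) full full_row_rank_iff_indep_rows[OF M] by (simp add: regular_rows_def)
qed

lemma implemented_subset_can:
  assumes C: "C \<subseteq> signals q" and "implements R P Q C S"
  shows "C \<inter> manifest \<subseteq> can S"
proof
  fix c assume c: "c \<in> C \<inter> manifest"
  then obtain w where w: "c \<in> signals q" "w \<in> signals nw" "w \<oplus>\<^sub>s c \<in> full"
    using mem_manifest by auto
  then have "w \<in> S" using assms(2) c unfolding implements_iff[OF C] by blast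
  then show "c \<in> can S" using w mem_can by blast
qed

text \<open>What a controller implements depends only on its intersection with the manifest behavior. For the
canonical controller this is \<open>S\<close> itself: if \<open>(w, c)\<close> and \<open>(w', c)\<close> are both in the plant with
\<open>w' \<in> S\<close>, then \<open>w - w'\<close> occurs with \<open>c = 0\<close>. As \<open>S\<close> is implemented by the linear controller \<open>C0\<close>,
it contains all such signals, and so \<open>w \<in> S\<close> by linearity.\<close>

lemma implements_if_can:
  assumes S: "behavior nw S" and C0: "C0 = ker_ddt M0" "M0 \<in> carrier_mat c0 q" "implements R P Q C0 S"
    and C: "C \<subseteq> signals q" "C \<inter> manifest = can S \<inter> manifest"
  shows "implements R P Q C S"
  unfolding implements_iff[OF C(1)]
proof (intro equalityI subsetI)
  have C0q: "C0 \<subseteq> signals q" using C0 mem_ker_ddt by blast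
  have S0: "S = {w \<in> signals nw. \<exists>c\<in>C0. w \<oplus>\<^sub>s c \<in> full}" using C0(3) implements_iff[OF C0q] by simp
  obtain h A where A: "A \<in> carrier_mat h nw" "S = ker_ddt A" using S unfolding behavior_def by blast
  fix w
  {
    assume "w \<in> {w \<in> signals nw. \<exists>c\<in>C. w \<oplus>\<^sub>s c \<in> full}"
    then obtain c where wc: "w \<in> signals nw" "c \<in> C" "w \<oplus>\<^sub>s c \<in> full" by blast
    have cq: "c \<in> signals q" using wc C by blast
    then have "c \<in> can S" using wc C(2) mem_manifest by blast
    then obtain w' where w': "w' \<in> S" "w' \<oplus>\<^sub>s c \<in> full" using mem_can by blast
    have w's: "w' \<in> signals nw" using w' S0 by blast
    have "(\<lambda>t. w t - w' t) \<oplus>\<^sub>s (\<lambda>t. c t - c t) \<in> full" by (rule full_diff[OF wc(1) w's cq cq wc(3) w'(2)])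
    moreover have "(\<lambda>t. c t - c t) = (\<lambda>t. 0\<^sub>v q)" using signalsD(1)[OF cq] by auto
    moreover have "(\<lambda>t. 0\<^sub>v q) \<in> C0" using ker_ddt_zero[of M0] C0 by simp
    ultimately have "(\<lambda>t. w t - w' t) \<in> S"
      unfolding S0 using diff_signals[OF wc(1) w's] by auto
    then have "(\<lambda>t. (w t - w' t) + w' t) \<in> S" using ker_ddt_add[of _ A w'] w'(1) A(2) by auto
    moreover have "(\<lambda>t. (w t - w' t) + w' t) = w"
      by (intro ext eq_vecI) (simp_all add: signalsD(2)[OF wc(1)] signalsD(2)[OF w's])
    ultimately show "w \<in> S" by simp
  next
    assume w: "w \<in> S"
    then obtain c where c: "w \<in> signals nw" "c \<in> C0" "w \<oplus>\<^sub>s c \<in> full" using S0 by blast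
    then have "c \<in> can S \<inter> manifest" using w C0q mem_can mem_manifest by blast
    then have "c \<in> C" using C(2) by blast
    then show "w \<in> {w \<in> signals nw. \<exists>c\<in>C. w \<oplus>\<^sub>s c \<in> full}" using c by blast
  }
qed

section \<open>Solvability of the control problem\<close>

text \<open>A regular \<open>C0\<close> that implements \<open>S\<close> may be strictly smaller on the manifest behavior than the
canonical controller, which also contains every control signal that the plant cannot distinguish
from one in \<open>C0\<close>. The sum of \<open>C0\<close> and the kernel of \<open>T = [P Q]\<close> repairs this. Its rows form
the intersection of the two row modules; as a part of the row module of \<open>C0\<close> it remains regular.\<close>

lemma can_reg_nonempty:
  assumes impl: "regularly_implementable R P Q S"
  shows "can_reg R P Q S \<noteq> {}"
proof -
  obtain C0 where C0: "regular_controller R P Q C0" "implements R P Q C0 S"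
    using impl unfolding regularly_implementable_def by blast
  obtain c0 M0 where M0: "M0 \<in> carrier_mat c0 q" "C0 = ker_ddt M0" "regular_rows M0"
    by (rule regular_controllerE[OF C0(1)])
  have C0q: "C0 \<subseteq> signals q" using M0 mem_ker_ddt by blast
  have S0: "S = {w \<in> signals nw. \<exists>c\<in>C0. w \<oplus>\<^sub>s c \<in> full}" using C0(2) implements_iff[OF C0q] by simp
  obtain r L where L: "L \<in> carrier_mat r q" "indep_rows L" "row_span L = row_span M0 \<inter> row_span T"
    by (rule submodule_has_basis[OF submodule_Int[OF submodule_row_span[OF M0(1)] submodule_row_span[OF T]]])
  have "regular_rows L" using M0(3) L(2,3) unfolding regular_rows_def by blast
  then have reg: "regular_controller R P Q (ker_ddt L)" by (rule regular_controller_if_rows[OF L(1)])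
  have "ker_ddt L \<inter> manifest = can S \<inter> manifest"
  proof (intro equalityI subsetI)
    fix c assume "c \<in> ker_ddt L \<inter> manifest"
    then obtain w where w: "c \<in> signals q" "c \<in> ker_ddt L" "w \<in> signals nw" "w \<oplus>\<^sub>s c \<in> full"
      using mem_manifest by auto
    obtain x n where xn: "x \<in> ker_ddt M0" "n \<in> ker_ddt T" "c = (\<lambda>t. x t + n t)"
      by (rule ker_ddt_sum[OF M0(1) T L(1,3) w(2)])
    have s: "x \<in> signals q" "n \<in> signals q" using xn M0(1) T mem_ker_ddt by blast+
    have n0: "(\<lambda>t. 0\<^sub>v nw) \<oplus>\<^sub>s n \<in> full" using full_zero[OF s(2)] xn(2) by blast
    have "(\<lambda>t. w t - 0\<^sub>v nw) \<oplus>\<^sub>s (\<lambda>t. c t - n t) \<in> full"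
      by (rule full_diff[OF w(3) zero_signal w(1) s(2) w(4) n0])
    moreover have "(\<lambda>t. w t - 0\<^sub>v nw) = w" by (intro ext eq_vecI) (simp_all add: signalsD(2)[OF w(3)])
    moreover have "(\<lambda>t. c t - n t) = x"
      unfolding xn(3) using signalsD(2)[OF s(1)] signalsD(2)[OF s(2)] by (intro ext eq_vecI) auto
    ultimately have "w \<oplus>\<^sub>s x \<in> full" by simp
    then have "w \<in> S" using S0 w(3) xn(1) M0(2) by blast
    then show "c \<in> can S \<inter> manifest" using w mem_can mem_manifest by blast
  next
    fix c assume "c \<in> can S \<inter> manifest"
    then obtain w where w: "c \<in> signals q" "c \<in> manifest" "w \<in> S" "w \<oplus>\<^sub>s c \<in> full" using mem_can by auto
    then obtain x where x: "w \<in> signals nw" "x \<in> C0" "w \<oplus>\<^sub>s x \<in> full" using S0 by blast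
    have s: "x \<in> signals q" using x C0q by blast
    have d: "(\<lambda>t. c t - x t) \<in> signals q" by (rule diff_signals[OF w(1) s])
    have "(\<lambda>t. w t - w t) \<oplus>\<^sub>s (\<lambda>t. c t - x t) \<in> full" by (rule full_diff[OF x(1) x(1) w(1) s w(4) x(3)])
    moreover have "(\<lambda>t. w t - w t) = (\<lambda>t. 0\<^sub>v nw)" using signalsD(1)[OF x(1)] by auto
    ultimately have "(\<lambda>t. c t - x t) \<in> ker_ddt T" using full_zero[OF d] by simp
    then have "(\<lambda>t. c t - x t) \<in> ker_ddt L" using ker_ddt_antimono[OF T L(1)] L(3) by blast
    moreover have "x \<in> ker_ddt L" using x(2) M0(2) ker_ddt_antimono[OF M0(1) L(1)] L(3) by blast
    ultimately have "(\<lambda>t. (c t - x t) + x t) \<in> ker_ddt L" by (rule ker_ddt_add)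
    moreover have "(\<lambda>t. (c t - x t) + x t) = c"
      using signalsD(2)[OF s] signalsD(2)[OF w(1)] by (intro ext eq_vecI) auto
    ultimately show "c \<in> ker_ddt L \<inter> manifest" using w(2) by simp
  qed
  then show ?thesis using reg unfolding can_reg_def by blast
qed

context
  fixes S :: "signal set" and C1 C2 P1 P2 :: "real poly mat" and c p :: nat
  assumes S: "behavior nw S"
    and C1: "C1 \<in> carrier_mat c nu" and C2: "C2 \<in> carrier_mat c ny"
    and P1: "P1 \<in> carrier_mat p nu" and P2: "P2 \<in> carrier_mat p ny"
    and full_C: "full_row_rank (C1 @\<^sub>c C2)"
    and man: "manifest = ker_ddt (P1 @\<^sub>c P2)"
    and can_C: "ker_ddt (C1 @\<^sub>c C2) \<in> can_reg R P Q S"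
begin

abbreviation "M \<equiv> C1 @\<^sub>c C2"
abbreviation "N \<equiv> P1 @\<^sub>c P2"

lemma M: "M \<in> carrier_mat c q" using C1 C2 by auto
lemma N: "N \<in> carrier_mat p q" using P1 P2 by auto
lemma N_rows: "row_span N = manifest_rows" by (rule row_span_manifest[OF N man])
lemma M_reg: "regular_rows M"
  using regular_controller_rows[OF M full_C] can_C by (simp add: can_reg_def)
lemma C_can: "ker_ddt M \<inter> manifest = can S \<inter> manifest" using can_C by (simp add: can_reg_def)

text \<open>The matrix \<open>[I, -V]\<close> turns the stacked \<open>C1\<close> and \<open>P1\<close> into \<open>F A1\<close>, where \<open>M = F A + V N\<close>. If a row
vector \<open>v\<close> annihilates \<open>F A1\<close>, then \<open>v F = 0\<close> because the outputs of the solving controller are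
among the components of \<open>u\<close>, so \<open>v M = v V N\<close> is an equation of the plant, and regularity of \<open>C\<close>
gives \<open>v = 0\<close>.\<close>

lemma rank_if_solvable:
  assumes "problem_solvable R P Q S"
  shows "c \<le> poly_rank (C1 @\<^sub>r P1)"
proof -
  obtain C Out In where sol: "regular_controller R P Q C" "implements R P Q C S"
    "io_partition q C Out In" "{nu..<q} \<subseteq> In"
    using assms unfolding problem_solvable_def solves_problem_def dims by blast
  then obtain a A where io: "Out \<union> In = {..<q}" "Out \<inter> In = {}" and A: "A \<in> carrier_mat a q"
    "full_row_rank A" "C = ker_ddt A" "full_row_rank (submatrix A UNIV Out)"
    unfolding io_partition_def by blast
  have Out: "Out \<subseteq> {..<nu}"
  proof
    fix j assume j: "j \<in> Out"
    then have "j \<in> {..<q}" "j \<notin> {nu..<q}" using io sol(4) by blast+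
    then show "j \<in> {..<nu}" by simp
  qed
  then have Out_q: "Out \<subseteq> {..<q}" by auto
  obtain A1 A2 where A12: "A1 \<in> carrier_mat a nu" "A2 \<in> carrier_mat a ny" "A = A1 @\<^sub>c A2"
    by (rule mat_split_cols[OF A(1)])
  have A1_inj: "u = 0\<^sub>v a" if u: "u \<in> carrier_vec a" "u \<star> A1 = 0\<^sub>v nu" for u
  proof -
    have "indep_rows (submatrix A UNIV Out)"
      using A(4) full_row_rank_iff_indep_rows[OF indep_rows_submatrix_iff(1)[OF A(1) Out_q]] by blast
    moreover have "(u \<star> A) $ j = 0" if "j \<in> Out" for j
    proof -
      have "j < nu" using that Out by auto
      then show ?thesis using u A12 by (simp add: row_mult_append_cols[OF A12(1,2) u(1)])
    qed
    ultimately show ?thesis using u(1) indep_rows_submatrix_iff(2)[OF A(1) Out_q] by blast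
  qed
  have AN: "A @\<^sub>r N \<in> carrier_mat (a + p) q" using A N by auto
  have "C \<subseteq> signals q" using A(1,3) mem_ker_ddt by blast
  then have "C \<inter> manifest \<subseteq> ker_ddt M"
    using implemented_subset_can[OF _ sol(2)] C_can by blast
  then have "ker_ddt (A @\<^sub>r N) \<subseteq> ker_ddt M"
    using ker_ddt_append_rows[OF A(1) N] A(3) man by simp
  then have "row_span M \<subseteq> row_span (A @\<^sub>r N)" using ker_ddt_subset_iff[OF AN M] by blast
  then obtain X where X: "X \<in> carrier_mat c (a + p)" "M = X * (A @\<^sub>r N)"
    by (rule row_span_subset_factor[OF M AN])
  obtain F V where FV: "F \<in> carrier_mat c a" "V \<in> carrier_mat c p" "X = F @\<^sub>c V"
    by (rule mat_split_cols[OF X(1)])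
  have vM: "v \<star> M = v \<star> F \<star> A + v \<star> V \<star> N" if v: "v \<in> carrier_vec c" for v
  proof -
    have "v \<star> M = v \<star> X \<star> (A @\<^sub>r N)" unfolding X(2) by (rule row_mult_assoc[OF v X(1) AN])
    also have "v \<star> X = v \<star> F @\<^sub>v v \<star> V" unfolding FV(3) by (rule row_mult_append_cols[OF FV(1,2) v])
    also have "(v \<star> F @\<^sub>v v \<star> V) \<star> (A @\<^sub>r N) = v \<star> F \<star> A + v \<star> V \<star> N"
      by (rule row_mult_append_rows[OF A(1) N row_mult_carrier[OF FV(1)] row_mult_carrier[OF FV(2)]])
    finally show ?thesis .
  qed
  have vC1: "v \<star> C1 = v \<star> F \<star> A1 + v \<star> V \<star> P1" if v: "v \<in> carrier_vec c" for v
  proof (rule eq_vecI)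
    fix j assume "j < dim_vec (v \<star> F \<star> A1 + v \<star> V \<star> P1)"
    then have j: "j < nu" using P1 by simp
    have "(v \<star> M) $ j = (v \<star> C1) $ j" using j C1 by (simp add: row_mult_append_cols[OF C1 C2 v])
    moreover have "(v \<star> F \<star> A) $ j = (v \<star> F \<star> A1) $ j" "(v \<star> V \<star> N) $ j = (v \<star> V \<star> P1) $ j"
      using j A12 P1 by (simp_all add: row_mult_append_cols[OF A12(1,2) row_mult_carrier[OF FV(1)]]
          row_mult_append_cols[OF P1 P2 row_mult_carrier[OF FV(2)]])
    moreover have "(v \<star> M) $ j = (v \<star> F \<star> A) $ j + (v \<star> V \<star> N) $ j"
      unfolding vM[OF v] using j carrier_matD(2)[OF N] by simp
    ultimately show "(v \<star> C1) $ j = (v \<star> F \<star> A1 + v \<star> V \<star> P1) $ j" using j P1 by simp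
  qed (use C1 P1 in simp)
  let ?Y = "1\<^sub>m c @\<^sub>c (- V)"
  have Y: "?Y \<in> carrier_mat c (c + p)" using FV(2) by auto
  have CP: "C1 @\<^sub>r P1 \<in> carrier_mat (c + p) nu" using C1 P1 by auto
  have YCP: "?Y * (C1 @\<^sub>r P1) \<in> carrier_mat c nu" using Y CP by auto
  have vY: "v \<star> (?Y * (C1 @\<^sub>r P1)) = v \<star> F \<star> A1" if v: "v \<in> carrier_vec c" for v
  proof -
    have mV: "- V \<in> carrier_mat c p" using FV(2) by simp
    have "v \<star> (- V) = - (v \<star> V)"
      using v FV(2) by (intro eq_vecI) (simp_all add: row_mult_index[OF v mV] row_mult_index[OF v FV(2)] sum_negf)
    then have "v \<star> (?Y * (C1 @\<^sub>r P1)) = (v @\<^sub>v - (v \<star> V)) \<star> (C1 @\<^sub>r P1)"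
      using v row_mult_assoc[OF v Y CP] row_mult_append_cols[OF one_carrier_mat mV v] by simp
    also have "\<dots> = v \<star> C1 + (- (v \<star> V)) \<star> P1"
      by (rule row_mult_append_rows[OF C1 P1 v]) (use FV in auto)
    also have "\<dots> = v \<star> F \<star> A1"
      unfolding vC1[OF v] row_mult_uminus[OF row_mult_carrier[OF FV(2)] P1]
      using A12 P1 by (intro eq_vecI) auto
    finally show ?thesis .
  qed
  have "indep_rows (?Y * (C1 @\<^sub>r P1))"
  proof (rule indep_rowsI[OF YCP])
    fix v assume v: "v \<in> carrier_vec c" "v \<star> (?Y * (C1 @\<^sub>r P1)) = 0\<^sub>v nu"
    then have "v \<star> F = 0\<^sub>v a" using A1_inj[of "v \<star> F"] FV(1) vY by simp
    then have "v \<star> M = v \<star> V \<star> N" using vM[OF v(1)] A(1) N by simp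
    then have "v \<star> M \<in> manifest_rows" using row_spanI[of "v \<star> V" p N q] FV(2) N N_rows by simp
    then have "v \<star> M = 0\<^sub>v q" using M_reg row_spanI[OF v(1) M] unfolding regular_rows_def by blast
    then show "v = 0\<^sub>v c" using M_reg indep_rowsD[OF _ M v(1)] unfolding regular_rows_def by blast
  qed
  then show ?thesis by (rule indep_rows_left_multiple_le_poly_rank[OF Y CP])
qed

text \<open>The rows of the new controller are \<open>M + V N\<close>. Modulo the rows \<open>N\<close> of the manifest behavior they
agree with \<open>M\<close>, so regularity and the intersection with the manifest behavior are inherited. The
outputs are \<open>c\<close> components of \<open>u\<close> whose columns in \<open>C1 + V P1\<close> are independent.\<close>

lemma solves_if_full_row_rank:
  assumes impl: "regularly_implementable R P Q S"
    and V: "V \<in> carrier_mat c p" and full: "full_row_rank (C1 + V * P1)"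
  shows "solves_problem R P Q S (ker_ddt ((C1 + V * P1) @\<^sub>c (C2 + V * P2)))"
proof -
  let ?D1 = "C1 + V * P1" and ?D2 = "C2 + V * P2"
  let ?D = "?D1 @\<^sub>c ?D2"
  have VP: "V * P1 \<in> carrier_mat c nu" "V * P2 \<in> carrier_mat c ny" using V P1 P2 by auto
  have D1: "?D1 \<in> carrier_mat c nu" and D2: "?D2 \<in> carrier_mat c ny" using C1 C2 VP by auto
  have D: "?D \<in> carrier_mat c q" using D1 D2 by auto
  have vD: "v \<star> ?D = v \<star> M + v \<star> V \<star> N" if v: "v \<in> carrier_vec c" for v
  proof -
    have "v \<star> ?D = (v \<star> C1 + v \<star> V \<star> P1) @\<^sub>v (v \<star> C2 + v \<star> V \<star> P2)"
      unfolding row_mult_append_cols[OF D1 D2 v] row_mult_add_mat[OF v C1 VP(1)] row_mult_add_mat[OF v C2 VP(2)]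
        row_mult_assoc[OF v V P1] row_mult_assoc[OF v V P2] ..
    also have "\<dots> = v \<star> M + v \<star> V \<star> N"
      unfolding row_mult_append_cols[OF C1 C2 v] row_mult_append_cols[OF P1 P2 row_mult_carrier[OF V]]
      using C1 C2 P1 P2 by (intro eq_vecI) auto
    finally show ?thesis .
  qed
  have VN: "v \<star> V \<star> N \<in> manifest_rows" if "v \<in> carrier_vec c" for v
    using row_spanI[of "v \<star> V" p N q] V N N_rows by simp
  have sub: "submodule_of q manifest_rows" by (rule submodule_manifest_rows)
  have inj: "v = 0\<^sub>v c" if v: "v \<in> carrier_vec c" "v \<star> ?D \<in> manifest_rows" for v
  proof -
    have "v \<star> M = v \<star> ?D + (-1) \<cdot>\<^sub>v (v \<star> V \<star> N)"
      unfolding vD[OF v(1)] using carrier_matD(2)[OF M] carrier_matD(2)[OF N] by (intro eq_vecI) auto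
    then have "v \<star> M \<in> manifest_rows" using sub v(2) VN[OF v(1)] by (simp add: submodule_of_def)
    then have "v \<star> M = 0\<^sub>v q" using M_reg row_spanI[OF v(1) M] unfolding regular_rows_def by blast
    then show ?thesis using M_reg indep_rowsD[OF _ M v(1)] unfolding regular_rows_def by blast
  qed
  have ind: "indep_rows ?D"
    by (rule indep_rowsI[OF D]) (use inj sub in \<open>auto simp: submodule_of_def\<close>)
  have "l = 0\<^sub>v q" if l: "l \<in> row_span ?D" "l \<in> manifest_rows" for l
  proof -
    obtain v where v: "v \<in> carrier_vec c" "l = v \<star> ?D" by (rule row_spanE[OF l(1) D])
    then show ?thesis using inj[OF v(1)] l(2) D by simp
  qed
  then have reg: "regular_controller R P Q (ker_ddt ?D)"
    using ind by (intro regular_controller_if_rows[OF D]) (auto simp: regular_rows_def)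
  have "x \<in> ker_ddt ?D \<longleftrightarrow> x \<in> ker_ddt M" if x: "x \<in> manifest" for x
  proof -
    have xq: "x \<in> signals q" using x mem_manifest by blast
    have "row_ddt (v \<star> ?D) x = row_ddt (v \<star> M) x" if v: "v \<in> carrier_vec c" for v
    proof -
      have "row_ddt (v \<star> V \<star> N) x = (\<lambda>t. 0)" using x VN[OF v] mem_manifest_rows by blast
      then show ?thesis
        unfolding vD[OF v] row_ddt_add[OF row_mult_carrier[OF M] row_mult_carrier[OF N]] by simp
    qed
    then show ?thesis
      using ker_ddt_row[OF D, of x] ker_ddt_row[OF M, of x] ker_ddt_rowI[OF D xq] ker_ddt_rowI[OF M xq] by metis
  qed
  then have "ker_ddt ?D \<inter> manifest = can S \<inter> manifest" using C_can by blast
  moreover obtain C0 where C0: "regular_controller R P Q C0" "implements R P Q C0 S"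
    using impl unfolding regularly_implementable_def by blast
  moreover obtain c0 M0 where M0: "M0 \<in> carrier_mat c0 q" "C0 = ker_ddt M0"
    by (rule regular_controllerE[OF C0(1)])
  moreover have Dq: "ker_ddt ?D \<subseteq> signals q" using mem_ker_ddt[OF D] by blast
  ultimately have impl_D: "implements R P Q (ker_ddt ?D) S"
    using implements_if_can[OF S M0(2,1) C0(2) Dq] by blast
  obtain J where J: "J \<subseteq> {..<nu}" "card J = c"
    "\<And>v. v \<in> carrier_vec c \<Longrightarrow> (\<And>j. j \<in> J \<Longrightarrow> (v \<star> ?D1) $ j = 0) \<Longrightarrow> v = 0\<^sub>v c"
    using indep_rows_column_selection[OF D1] full full_row_rank_iff_indep_rows[OF D1] by blast
  have Jq: "J \<subseteq> {..<q}" using J(1) by auto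
  have sm: "submatrix ?D UNIV J \<in> carrier_mat c c"
    using indep_rows_submatrix_iff(1)[OF D Jq] J(2) by simp
  have "(v \<star> ?D) $ j = (v \<star> ?D1) $ j" if "v \<in> carrier_vec c" "j \<in> J" for v j
  proof -
    have "j < nu" using that J(1) by auto
    then show ?thesis unfolding row_mult_append_cols[OF D1 D2 that(1)] using carrier_matD(2)[OF D1] carrier_matD(2)[OF D2]
      by simp
  qed
  then have "indep_rows (submatrix ?D UNIV J)"
    unfolding indep_rows_submatrix_iff(2)[OF D Jq] using J(3) by auto
  then have "full_row_rank (submatrix ?D UNIV J)" using full_row_rank_iff_indep_rows[OF sm] by blast
  moreover have "square_mat (submatrix ?D UNIV J)" using sm by auto
  moreover have "full_row_rank ?D" using ind full_row_rank_iff_indep_rows[OF D] by blast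
  moreover have "J \<union> ({..<q} - J) = {..<q}" "J \<inter> ({..<q} - J) = {}" using Jq by auto
  ultimately have "io_partition q (ker_ddt ?D) J ({..<q} - J)"
    unfolding io_partition_def using D by blast
  moreover have "{nu..<q} \<subseteq> {..<q} - J" using J(1) by auto
  ultimately show ?thesis
    unfolding solves_problem_def dims using reg impl_D by blast
qed

end

end

theorem mainTheorem3:
  fixes R P Q :: "real poly mat" and S :: "signal set" and g nw nu ny :: nat
  assumes "R \<in> carrier_mat g nw" and "P \<in> carrier_mat g nu" and "Q \<in> carrier_mat g ny"
    and "behavior nw S"
  shows
    "(\<not> regularly_implementable R P Q S \<longrightarrow> \<not> problem_solvable R P Q S) \<and>
     (regularly_implementable R P Q S \<longrightarrow>
        can_reg R P Q S \<noteq> {} \<and>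
        (\<forall>C \<in> can_reg R P Q S. \<forall>c p.
         \<forall>C1 \<in> carrier_mat c nu. \<forall>C2 \<in> carrier_mat c ny.
         \<forall>P1 \<in> carrier_mat p nu. \<forall>P2 \<in> carrier_mat p ny.
           full_row_rank (C1 @\<^sub>c C2) \<and> C = ker_ddt (C1 @\<^sub>c C2) \<and>
           full_row_rank (P1 @\<^sub>c P2) \<and> control_manifest R P Q = ker_ddt (P1 @\<^sub>c P2) \<longrightarrow>
             (problem_solvable R P Q S \<longleftrightarrow>
                poly_rank (C1 @\<^sub>r P1) \<ge> num_outputs (nu + ny) C) \<and>
             (poly_rank (C1 @\<^sub>r P1) \<ge> num_outputs (nu + ny) C \<longrightarrow>
                (\<exists>V \<in> carrier_mat c p. full_row_rank (C1 + V * P1)) \<and>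
                (\<forall>V \<in> carrier_mat c p. full_row_rank (C1 + V * P1) \<longrightarrow>
                   solves_problem R P Q S
                     (ker_ddt ((C1 + V * P1) @\<^sub>c (C2 + V * P2)))))))"
proof (intro conjI impI ballI allI)
  interpret plant R P Q g nw nu ny by (unfold_locales) (rule assms)+
  show "\<not> problem_solvable R P Q S" if "\<not> regularly_implementable R P Q S"
    using that unfolding problem_solvable_def solves_problem_def regularly_implementable_def by blast
  assume impl: "regularly_implementable R P Q S"
  show "can_reg R P Q S \<noteq> {}" by (rule can_reg_nonempty[OF impl])
  fix C c p C1 C2 P1 P2
  assume C: "C \<in> can_reg R P Q S" and C12: "C1 \<in> carrier_mat c nu" "C2 \<in> carrier_mat c ny"
    and P12: "P1 \<in> carrier_mat p nu" "P2 \<in> carrier_mat p ny"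
    and h: "full_row_rank (C1 @\<^sub>c C2) \<and> C = ker_ddt (C1 @\<^sub>c C2) \<and>
      full_row_rank (P1 @\<^sub>c P2) \<and> control_manifest R P Q = ker_ddt (P1 @\<^sub>c P2)"
  then have full_C: "full_row_rank (C1 @\<^sub>c C2)" and man: "control_manifest R P Q = ker_ddt (P1 @\<^sub>c P2)"
    and can_C: "ker_ddt (C1 @\<^sub>c C2) \<in> can_reg R P Q S" by auto
  have out: "num_outputs (nu + ny) C = c"
    using num_outputs_eq[OF append_cols_carrier[OF C12] full_C] h by simp
  have ex: "\<exists>V \<in> carrier_mat c p. full_row_rank (C1 + V * P1)"
    if "poly_rank (C1 @\<^sub>r P1) \<ge> num_outputs (nu + ny) C"
  proof -
    have "c \<le> poly_rank (C1 @\<^sub>r P1)" using that unfolding out .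
    then obtain V where "V \<in> carrier_mat c p" "indep_rows (C1 + V * P1)"
      using exists_indep_rows_perturbation[OF C12(1) P12(1)] by blast
    then show ?thesis
      using full_row_rank_iff_indep_rows[of "C1 + V * P1" c nu] C12(1) P12(1) by auto
  qed
  have sol: "solves_problem R P Q S (ker_ddt ((C1 + V * P1) @\<^sub>c (C2 + V * P2)))"
    if "V \<in> carrier_mat c p" "full_row_rank (C1 + V * P1)" for V
    by (rule solves_if_full_row_rank[OF assms(4) C12 P12 full_C man can_C impl that])
  show "problem_solvable R P Q S \<longleftrightarrow> poly_rank (C1 @\<^sub>r P1) \<ge> num_outputs (nu + ny) C"
    using rank_if_solvable[OF assms(4) C12 P12 full_C man can_C] out ex sol
    unfolding problem_solvable_def by auto
  {
    assume "poly_rank (C1 @\<^sub>r P1) \<ge> num_outputs (nu + ny) C"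
    then show "\<exists>V \<in> carrier_mat c p. full_row_rank (C1 + V * P1)" by (rule ex)
  }
  {
    fix V assume "V \<in> carrier_mat c p" "full_row_rank (C1 + V * P1)"
    then show "solves_problem R P Q S (ker_ddt ((C1 + V * P1) @\<^sub>c (C2 + V * P2)))" by (rule sol)
  }
qed

end
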